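(* Let $q_0\in\mathbb{R}$ be a constant, let $u_0\in q_0+H^2(\mathbb{R})$ be such that $|u_0|^2-q_0^2\in L^1(\mathbb{R})$, and let $u\in C((-T_{min},T^{max}),q_0+H^2(\mathbb{R}))$ be the associated unique maximal solution of $$i\partial_t u+\partial_x^2 u=-iu^2\,\partial_x\overline{u},\qquad u(0)=u_0 .$$ Then for all $t\in(-T_{min},T^{max})$ (with $u=u(t)$) the following hold: $$M(u):=\lim_{R\to\infty}\int_{\mathbb{R}}(|u|^2-q_0^2)\chi_R\,dx=M(u_0),$$ $$E(u):=\int_{\mathbb{R}}|\partial_x u|^2\,dx+\frac12\,\mathrm{Im}\int_{\mathbb{R}}(|u|^2\overline{u}-q_0^3)\,\partial_x u\,dx+\frac16\int_{\mathbb{R}}(|u|^2-q_0^2)^2(|u|^2+2q_0^2)\,dx=E(u_0),$$ $$P(u):=\frac12\,\mathrm{Im}\int_{\mathbb{R}}(u-q_0)\,\partial_x\overline{u}\,dx-\frac14\int_{\mathbb{R}}(|u|^2-q_0^2)^2\,dx=P(u_0).$$ In particular the limit defining $M(u(t))$ exists for every such $t$.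
   Context: $q_0+H^2(\mathbb{R})=\{q_0+w:w\in H^2(\mathbb{R})\}$ (complex-valued functions), with distance $\|u_1-u_2\|_{H^2}$. For every $u_0\in q_0+H^2(\mathbb{R})$ the Cauchy problem has a unique maximal solution $u\in C((-T_{min},T^{max}),q_0+H^2(\mathbb{R}))$ with $u_t\in C((-T_{min},T^{max}),L^2(\mathbb{R}))$, $T_{min},T^{max}\in(0,\infty]$, which depends continuously on the initial data in the $H^2$ distance, locally uniformly in time; this is the solution meant in the statement. The function $\chi$ is a fixed function with $\chi\in C^1(\mathbb{R})$, $\mathrm{supp}\,\chi\subset[-2,2]$, $\chi=1$ on $[-1,1]$, and $\chi_R(x)=\chi(x/R)$ for $R>0$. *)

theory Defs
  imports "HOL-Analysis.Analysis"
begin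

section \<open>Lebesgue and Sobolev spaces on the real line\<close>

text \<open>
  Elements of the function spaces are represented by functions; all notions below
  depend only on the class of a function modulo equality almost everywhere.
\<close>

definition L2 :: "(real \<Rightarrow> complex) set" where
  "L2 = {f. f \<in> borel_measurable lebesgue \<and> integrable lebesgue (\<lambda>x. (cmod (f x))\<^sup>2)}"

text \<open>Meaningful for members of \<open>L2\<close> only: a divergent integral has the value 0 here.\<close>

definition L2_norm :: "(real \<Rightarrow> complex) \<Rightarrow> real" where
  "L2_norm f = sqrt (LINT x|lebesgue. (cmod (f x))\<^sup>2)"

definition locally_integrable :: "(real \<Rightarrow> complex) \<Rightarrow> bool" where
  "locally_integrable f \<longleftrightarrow> (\<forall>K. compact K \<longrightarrow> set_integrable lebesgue K f)"

definition test_function :: "(real \<Rightarrow> real) \<Rightarrow> bool" where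
  "test_function \<phi> \<longleftrightarrow>
     (\<forall>n x. (deriv ^^ n) \<phi> field_differentiable (at x)) \<and> compact (closure {x. \<phi> x \<noteq> 0})"

definition has_weak_deriv :: "(real \<Rightarrow> complex) \<Rightarrow> (real \<Rightarrow> complex) \<Rightarrow> bool" where
  "has_weak_deriv f g \<longleftrightarrow> locally_integrable f \<and> locally_integrable g \<and>
     (\<forall>\<phi>. test_function \<phi> \<longrightarrow>
        (LINT x|lebesgue. deriv \<phi> x *\<^sub>R f x) = - (LINT x|lebesgue. \<phi> x *\<^sub>R g x))"

definition weakly_differentiable :: "(real \<Rightarrow> complex) \<Rightarrow> bool" where
  "weakly_differentiable f \<longleftrightarrow> (\<exists>g. has_weak_deriv f g)"

text \<open>The weak derivative is unique only almost everywhere; this chooses a representative.\<close>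

definition weak_deriv :: "(real \<Rightarrow> complex) \<Rightarrow> real \<Rightarrow> complex" where
  "weak_deriv f = (SOME g. has_weak_deriv f g)"

definition H2 :: "(real \<Rightarrow> complex) set" where
  "H2 = {w. w \<in> L2 \<and>
            weakly_differentiable w \<and> weak_deriv w \<in> L2 \<and>
            weakly_differentiable (weak_deriv w) \<and> weak_deriv (weak_deriv w) \<in> L2}"

definition H2_norm :: "(real \<Rightarrow> complex) \<Rightarrow> real" where
  "H2_norm w = sqrt ((L2_norm w)\<^sup>2 + (L2_norm (weak_deriv w))\<^sup>2
                     + (L2_norm (weak_deriv (weak_deriv w)))\<^sup>2)"

definition shifted_H2 :: "real \<Rightarrow> (real \<Rightarrow> complex) set" where
  "shifted_H2 q0 = {v. (\<lambda>x. v x - of_real q0) \<in> H2}"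


section \<open>The Cauchy problem\<close>

text \<open>
  \<open>is_solution q0 u0 Tmin Tmax u\<close>: on \<open>(-Tmin, Tmax)\<close>, \<open>u\<close> is a continuous curve in
  \<open>q0 + H2\<close>, its time derivative, taken in the norm of \<open>L2\<close>, is a continuous curve
  in \<open>L2\<close>, and the equation holds in \<open>L2\<close> at every time, with \<open>u 0 = u0\<close>.
  The first argument of \<open>u\<close> is time. The interval is open, so the limits at \<open>t\<close> see only
  times in the interval.
\<close>

definition is_solution ::
  "real \<Rightarrow> (real \<Rightarrow> complex) \<Rightarrow> ereal \<Rightarrow> ereal \<Rightarrow> (real \<Rightarrow> real \<Rightarrow> complex) \<Rightarrow> bool" where
  "is_solution q0 u0 Tmin Tmax u \<longleftrightarrow>
     0 < Tmin \<and> 0 < Tmax \<and>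
     (\<forall>t\<in>einterval (-Tmin) Tmax.
        u t \<in> shifted_H2 q0 \<and>
        ((\<lambda>s. H2_norm (\<lambda>x. u s x - u t x)) \<longlongrightarrow> 0) (at t)) \<and>
     (\<exists>ut. \<forall>t\<in>einterval (-Tmin) Tmax.
        ut t \<in> L2 \<and>
        ((\<lambda>s. L2_norm (\<lambda>x. (u s x - u t x) / of_real (s - t) - ut t x)) \<longlongrightarrow> 0) (at t) \<and>
        ((\<lambda>s. L2_norm (\<lambda>x. ut s x - ut t x)) \<longlongrightarrow> 0) (at t) \<and>
        (AE x in lebesgue.
           \<i> * ut t x + weak_deriv (weak_deriv (u t)) x
             = - \<i> * (u t x)\<^sup>2 * weak_deriv (\<lambda>y. cnj (u t y)) x)) \<and>
     (AE x in lebesgue. u 0 x = u0 x)"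

definition is_maximal_solution ::
  "real \<Rightarrow> (real \<Rightarrow> complex) \<Rightarrow> ereal \<Rightarrow> ereal \<Rightarrow> (real \<Rightarrow> real \<Rightarrow> complex) \<Rightarrow> bool" where
  "is_maximal_solution q0 u0 Tmin Tmax u \<longleftrightarrow>
     is_solution q0 u0 Tmin Tmax u \<and>
     (\<forall>Smin Smax v.
        is_solution q0 u0 Smin Smax v \<and> Tmin \<le> Smin \<and> Tmax \<le> Smax \<and>
        (\<forall>t\<in>einterval (-Tmin) Tmax. AE x in lebesgue. v t x = u t x)
        \<longrightarrow> Smin = Tmin \<and> Smax = Tmax)"


section \<open>Conserved quantities\<close>

definition is_cutoff :: "(real \<Rightarrow> real) \<Rightarrow> bool" where
  "is_cutoff chi \<longleftrightarrow> chi C1_differentiable_on UNIV \<and>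
     closure {x. chi x \<noteq> 0} \<subseteq> {-2..2} \<and> (\<forall>x\<in>{-1..1}. chi x = 1)"

definition truncated_mass :: "(real \<Rightarrow> real) \<Rightarrow> real \<Rightarrow> (real \<Rightarrow> complex) \<Rightarrow> real \<Rightarrow> real" where
  "truncated_mass chi q0 v R = (LINT x|lebesgue. ((cmod (v x))\<^sup>2 - q0\<^sup>2) * chi (x / R))"

definition mass :: "(real \<Rightarrow> real) \<Rightarrow> real \<Rightarrow> (real \<Rightarrow> complex) \<Rightarrow> real" where
  "mass chi q0 v = Lim at_top (truncated_mass chi q0 v)"

definition energy :: "real \<Rightarrow> (real \<Rightarrow> complex) \<Rightarrow> real" where
  "energy q0 v =
     (LINT x|lebesgue. (cmod (weak_deriv v x))\<^sup>2)
     + 1/2 * Im (LINT x|lebesgue.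
         (of_real ((cmod (v x))\<^sup>2) * cnj (v x) - of_real (q0 ^ 3)) * weak_deriv v x)
     + 1/6 * (LINT x|lebesgue. ((cmod (v x))\<^sup>2 - q0\<^sup>2)\<^sup>2 * ((cmod (v x))\<^sup>2 + 2 * q0\<^sup>2))"

definition momentum :: "real \<Rightarrow> (real \<Rightarrow> complex) \<Rightarrow> real" where
  "momentum q0 v =
     1/2 * Im (LINT x|lebesgue. (v x - of_real q0) * weak_deriv (\<lambda>y. cnj (v y)) x)
     - 1/4 * (LINT x|lebesgue. ((cmod (v x))\<^sup>2 - q0\<^sup>2)\<^sup>2)"

end

theory Submission
  imports Defs
begin

text \<open>
  Since \<open>u\<^sub>t\<close> exists only in \<open>L\<^sup>2\<close>, the time derivatives of the functionals are computed from difference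
  quotients: the increment of each functional is rewritten, by integration by parts in \<open>x\<close>, as a
  pairing of the increment of \<open>u\<close> with a curve that is continuous in \<open>L\<^sup>2\<close>. Inserting
  \<open>u\<^sub>t = i u\<^sub>x\<^sub>x - u\<^sup>2 \<partial>\<^sub>x(cnj u)\<close>, the resulting integrand becomes \<open>\<partial>\<^sub>x F\<close> for an explicit polynomial \<open>F\<close>
  in \<open>u\<close>, \<open>u\<^sub>x\<close> and their conjugates. For energy and momentum both \<open>F\<close> and \<open>\<partial>\<^sub>x F\<close> are integrable, so
  the derivative vanishes. For the mass density, \<open>\<partial>\<^sub>t \<bar>u\<bar>\<^sup>2 = \<partial>\<^sub>x J\<close> with a flux \<open>J\<close> in \<open>L\<^sup>2\<close> that is bounded
  locally uniformly in time; hence the mass localized by \<open>\<chi>\<^sub>R\<close> varies by at most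
  a multiple of the \<open>L\<^sup>2\<close> norm of \<open>\<chi>\<^sub>R'\<close>, which is \<open>O(R\<^bsup>-1/2\<^esup>)\<close>.
\<close>

section \<open>Test functions\<close>

text \<open>The definitions speak of classes modulo null sets and of an arbitrarily chosen weak
  derivative. The calculus therefore runs on representatives: \<open>u\<close> and
  \<open>u_x\<close> become absolutely continuous functions, while \<open>u_xx\<close> is only known
  almost everywhere. This is why derivatives are recorded by integrals (\<open>ac_deriv\<close>) and
  why identities involving \<open>u_xx\<close> or \<open>u_t\<close> are claimed almost everywhere.
  The difference quotient of \<open>u\<close> in time converges in L2 but that of \<open>u_x\<close>
  need not, so no x-derivative may remain on an increment when the limit is taken. The coefficients
  of the quotient are polynomials in \<open>u\<close> at two times; the one-dimensional supremum
  bound for H1 makes them converge uniformly. For nonzero \<open>q0\<close> the function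
  \<open>u\<close> itself is not in L2: densities are arranged so that each summand carries factors
  vanishing at \<open>u = q0\<close> or x-derivatives. The fluxes are related: that of the energy is
  minus half the square of the mass flux \<open>J\<close>. The mass needs a cutoff because
  \<open>|u|^2 - q0^2\<close> is known to be in L2 at every time, but in L1 only initially.\<close>

definition smooth :: "(real \<Rightarrow> real) \<Rightarrow> bool" where
  "smooth f \<longleftrightarrow> (\<forall>n x. (deriv ^^ n) f field_differentiable (at x))"

text \<open>Iterated derivatives of products and compositions have no convenient closed form, so
  smoothness is obtained from a set of differentiable functions that \<open>deriv\<close> maps into
  itself.\<close>

lemma smooth_coinduct:
  assumes "f \<in> S" and S: "\<And>g. g \<in> S \<Longrightarrow> (\<forall>x. g field_differentiable (at x)) \<and> deriv g \<in> S"
  shows "smooth f"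
proof -
  have "(deriv ^^ n) f \<in> S" for n
    by (induction n) (use assms in auto)
  then show ?thesis
    using S unfolding smooth_def by blast
qed

lemma smooth_differentiable: "smooth f \<Longrightarrow> f field_differentiable (at x)"
  unfolding smooth_def by (metis funpow_0)

lemma smooth_deriv:
  assumes "smooth f"
  shows "smooth (deriv f)"
proof -
  have "(deriv ^^ n) (deriv f) = (deriv ^^ Suc n) f" for n
    by (simp only: funpow_Suc_right o_apply)
  then show ?thesis
    using assms unfolding smooth_def by presburger
qed

lemma smooth_primitive:
  assumes "\<And>x. (F has_field_derivative f x) (at x)" "smooth f"
  shows "smooth F"
proof (rule smooth_coinduct[where S = "insert F (Collect smooth)"])
  have "deriv F = f"
    using assms(1) DERIV_imp_deriv by blast
  moreover have "F field_differentiable (at x)" for x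
    using assms(1) field_differentiable_def by blast
  ultimately show "(\<forall>x. g field_differentiable (at x)) \<and> deriv g \<in> insert F (Collect smooth)"
    if "g \<in> insert F (Collect smooth)" for g
    using that assms(2) smooth_deriv smooth_differentiable by auto
qed simp

text \<open>The invariant set for products: Leibniz' rule turns a product into a sum of products,
  and the chain rule for an affine argument only adds a constant factor, so \<open>deriv\<close>
  does not leave the set.\<close>

inductive_set smooth_alg :: "(real \<Rightarrow> real) set" where
  base: "smooth f \<Longrightarrow> f \<in> smooth_alg"
| affine: "smooth f \<Longrightarrow> (\<lambda>x. f (a * x + b)) \<in> smooth_alg"
| const: "(\<lambda>x. c) \<in> smooth_alg"
| add: "f \<in> smooth_alg \<Longrightarrow> g \<in> smooth_alg \<Longrightarrow> (\<lambda>x. f x + g x) \<in> smooth_alg"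
| mult: "f \<in> smooth_alg \<Longrightarrow> g \<in> smooth_alg \<Longrightarrow> (\<lambda>x. f x * g x) \<in> smooth_alg"

lemma smooth_alg_smooth:
  assumes "f \<in> smooth_alg"
  shows "smooth f"
proof -
  have "(\<forall>x. g field_differentiable (at x)) \<and> deriv g \<in> smooth_alg" if "g \<in> smooth_alg" for g
    using that
  proof induction
    case (base f)
    then show ?case
      using smooth_deriv smooth_differentiable smooth_alg.base by blast
  next
    case (affine f a b)
    have D: "((\<lambda>x. f (a * x + b)) has_field_derivative deriv f (a * x + b) * a) (at x)" for x
      by (rule DERIV_chain'[where g = f])
        (auto intro!: derivative_eq_intros field_differentiable_derivI smooth_differentiable affine)
    then have "deriv (\<lambda>x. f (a * x + b)) = (\<lambda>x. deriv f (a * x + b) * a)"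
      using DERIV_imp_deriv by blast
    moreover have "\<dots> \<in> smooth_alg"
      by (intro smooth_alg.mult smooth_alg.const smooth_alg.affine smooth_deriv affine)
    ultimately show ?case
      using D field_differentiable_def by fastforce
  next
    case (const c)
    have "deriv (\<lambda>x. c) = (\<lambda>x::real. 0)"
      by (simp add: fun_eq_iff)
    then show ?case
      using smooth_alg.const by (metis field_differentiable_const)
  next
    case (add f g)
    have "deriv (\<lambda>x. f x + g x) = (\<lambda>x. deriv f x + deriv g x)"
      using add by (auto simp: fun_eq_iff)
    then show ?case
      using add smooth_alg.add by (auto intro: field_differentiable_add)
  next
    case (mult f g)
    have "deriv (\<lambda>x. f x * g x) = (\<lambda>x. f x * deriv g x + deriv f x * g x)"
      using mult by (auto simp: fun_eq_iff)
    then show ?case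
      using mult smooth_alg.add smooth_alg.mult by (auto intro: field_differentiable_mult)
  qed
  then show ?thesis
    using assms smooth_coinduct by blast
qed

lemma smooth_mult: "smooth f \<Longrightarrow> smooth g \<Longrightarrow> smooth (\<lambda>x. f x * g x)"
  by (rule smooth_alg_smooth) (intro smooth_alg.mult smooth_alg.base)

lemma smooth_affine: "smooth f \<Longrightarrow> smooth (\<lambda>x. f (a * x + b))"
  using smooth_alg.affine smooth_alg_smooth by blast

lemma smooth_diff_scale:
  assumes "smooth f" "smooth g"
  shows "smooth (\<lambda>x. f x - c * g x)"
proof -
  have "smooth (\<lambda>x. f x + (- c) * g x)"
    by (rule smooth_alg_smooth) (intro smooth_alg.add smooth_alg.mult smooth_alg.base smooth_alg.const assms)
  then show ?thesis
    by simp
qed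

text \<open>With \<open>p = 1\<close> this is the function \<open>exp (-1/x)\<close>; the polynomial makes the family
  closed under differentiation.\<close>

definition flat_exp :: "real poly \<Rightarrow> real \<Rightarrow> real" where
  "flat_exp p x = (if x > 0 then poly p (1 / x) * exp (- (1 / x)) else 0)"

lemma poly_mult_exp_tendsto_0: "((\<lambda>y. poly p y * exp (- y)) \<longlongrightarrow> (0::real)) at_top"
proof -
  have "((\<lambda>y. \<Sum>i\<le>degree p. coeff p i * (y ^ i / exp y)) \<longlongrightarrow> (\<Sum>i\<le>degree p. coeff p i * 0)) at_top"
    by (intro tendsto_intros tendsto_power_div_exp_0)
  then show ?thesis
    by (simp add: poly_altdef exp_minus sum_distrib_right divide_inverse mult.assoc)
qed

text \<open>With y = 1/x, the x-derivative of p(y) exp(-y) is y^2 (p - p')(y) exp(-y), which is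
  again of the same form. At 0 the exponential beats every polynomial in y.\<close>

lemma flat_exp_has_field_derivative:
  "(flat_exp p has_field_derivative flat_exp (monom 1 2 * (p - pderiv p)) x) (at x)"
proof -
  consider "x > 0" | "x < 0" | "x = 0"
    by linarith
  then show ?thesis
  proof cases
    case 1
    have P: "((\<lambda>x. poly p (1 / x)) has_field_derivative poly (pderiv p) (1 / x) * - (1 / x\<^sup>2)) (at x)"
      using 1 by (intro DERIV_chain2[OF poly_DERIV])
        (auto intro!: derivative_eq_intros simp: power2_eq_square)
    have E: "((\<lambda>x. exp (- (1 / x))) has_field_derivative exp (- (1 / x)) * (1 / x\<^sup>2)) (at x)"
      using 1 by (auto intro!: derivative_eq_intros simp: power2_eq_square)
    have "poly p (1 / x) * (exp (- (1 / x)) * (1 / x\<^sup>2)) + poly (pderiv p) (1 / x) * - (1 / x\<^sup>2) * exp (- (1 / x))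
        = flat_exp (monom 1 2 * (p - pderiv p)) x"
      using 1 by (simp add: flat_exp_def poly_monom power_one_over algebra_simps)
    with DERIV_mult[OF P E]
    have "((\<lambda>x. poly p (1 / x) * exp (- (1 / x))) has_field_derivative
        flat_exp (monom 1 2 * (p - pderiv p)) x) (at x)"
      by (simp add: algebra_simps)
    then show ?thesis
      by (rule has_field_derivative_transform_within_open[where S = "{0<..}"])
        (use 1 in \<open>auto simp: flat_exp_def\<close>)
  next
    case 2
    have "((\<lambda>x. 0) has_field_derivative flat_exp (monom 1 2 * (p - pderiv p)) x) (at x)"
      using 2 by (simp add: flat_exp_def)
    then show ?thesis
      by (rule has_field_derivative_transform_within_open[where S = "{..<0}"])
        (use 2 in \<open>auto simp: flat_exp_def\<close>)
  next
    case 3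
    have "((\<lambda>h. flat_exp p h / h) \<longlongrightarrow> 0) (at_right 0)"
    proof -
      \<comment> \<open>Dividing by \<open>h\<close> multiplies the polynomial in 1/h by its
        variable, hence \<open>pCons 0 p\<close>.\<close>
      have "((\<lambda>h. poly (pCons 0 p) (inverse h) * exp (- inverse h)) \<longlongrightarrow> 0) (at_right (0::real))"
        using poly_mult_exp_tendsto_0 filterlim_inverse_at_top_right by (rule filterlim_compose)
      then show ?thesis
        by (rule Lim_transform_eventually)
          (auto simp: eventually_at_right_field flat_exp_def field_simps intro!: exI[of _ 1])
    qed
    moreover have "((\<lambda>h. flat_exp p h / h) \<longlongrightarrow> 0) (at_left 0)"
      by (rule Lim_transform_eventually[OF tendsto_const])
         (auto simp: eventually_at_left_field flat_exp_def intro!: exI[of _ "-1"])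
    ultimately have "((\<lambda>h. flat_exp p h / h) \<longlongrightarrow> 0) (at 0)"
      using filterlim_split_at by blast
    then show ?thesis
      using 3 by (simp add: DERIV_def flat_exp_def)
  qed
qed

lemma smooth_flat_exp: "smooth (flat_exp p)"
proof (rule smooth_coinduct[where S = "range flat_exp"])
  fix g assume "g \<in> range flat_exp"
  then obtain p where "g = flat_exp p"
    by blast
  moreover have "deriv (flat_exp p) = flat_exp (monom 1 2 * (p - pderiv p))"
    using DERIV_imp_deriv[OF flat_exp_has_field_derivative] by blast
  ultimately show "(\<forall>x. g field_differentiable (at x)) \<and> deriv g \<in> range flat_exp"
    using flat_exp_has_field_derivative field_differentiable_def by blast
qed simp

section \<open>Smooth bumps that approximate indicators of intervals\<close>

lemma test_function_iff: "test_function \<phi> \<longleftrightarrow> smooth \<phi> \<and> bounded {x. \<phi> x \<noteq> 0}"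
  unfolding test_function_def smooth_def by (meson bounded_closure bounded_subset closure_subset compact_closure)

text \<open>The factor \<open>Suc n\<close> steepens both flanks while the support stays in
  \<open>{a..b}\<close>. The bumps are bounded by 1 and tend pointwise to the indicator of the open
  interval, so test functions can detect integrals over intervals.\<close>

definition bump :: "real \<Rightarrow> real \<Rightarrow> nat \<Rightarrow> real \<Rightarrow> real" where
  "bump a b n x = flat_exp 1 (real (Suc n) * (x - a)) * flat_exp 1 (real (Suc n) * (b - x))"

lemma test_function_bump: "test_function (bump a b n)"
proof -
  have "smooth (\<lambda>x. flat_exp 1 (real (Suc n) * x + - real (Suc n) * a) *
                 flat_exp 1 (- real (Suc n) * x + real (Suc n) * b))"
    by (intro smooth_mult smooth_affine smooth_flat_exp)
  then have "smooth (bump a b n)"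
    by (simp add: bump_def[abs_def] algebra_simps)
  moreover have "{x. bump a b n x \<noteq> 0} \<subseteq> {a..b}"
    by (auto simp: bump_def flat_exp_def zero_less_mult_iff split: if_splits)
  ultimately show ?thesis
    unfolding test_function_iff using bounded_closed_interval bounded_subset by blast
qed

lemma flat_exp_1_bounds: "0 \<le> flat_exp 1 x" "flat_exp 1 x \<le> 1"
  by (auto simp: flat_exp_def)

lemma bump_le_indicator: "\<bar>bump a b n x\<bar> \<le> indicator {a..b} x"
  by (auto simp: bump_def flat_exp_def abs_mult zero_less_mult_iff indicator_def mult_le_one split: if_splits)

lemma bump_tendsto: "(\<lambda>n. bump a b n x) \<longlonglongrightarrow> indicator {a<..<b} x"
proof -
  have *: "(\<lambda>n. flat_exp 1 (real (Suc n) * y)) \<longlonglongrightarrow> (if y > 0 then 1 else 0)" for y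
  proof (cases "y > 0")
    case True
    have "(\<lambda>n. exp (- (1 / y * inverse (real (Suc n))))) \<longlonglongrightarrow> exp (- (1 / y * 0))"
      by (intro tendsto_intros LIMSEQ_inverse_real_of_nat)
    then show ?thesis
      using True by (simp add: flat_exp_def field_simps zero_less_mult_iff add_pos_nonneg)
  next
    case False
    then show ?thesis
      by (simp add: flat_exp_def zero_less_mult_iff del: of_nat_Suc)
  qed
  have "(\<lambda>n. bump a b n x) \<longlonglongrightarrow> (if x - a > 0 then 1 else 0) * (if b - x > 0 then 1 else 0)"
    unfolding bump_def by (intro tendsto_mult *)
  then show ?thesis
    by (rule back_subst[where P = "\<lambda>l. _ \<longlonglongrightarrow> l"]) (auto simp: indicator_def)
qed

section \<open>Absolutely continuous functions and their derivatives\<close>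

text \<open>Local absolute continuity, encoded by the fundamental theorem of calculus so that
  differentiability almost everywhere never has to be discussed. Increments of \<open>f\<close> are
  fixed at every point, whereas \<open>g\<close> matters only up to null sets.\<close>

definition ac_deriv :: "(real \<Rightarrow> complex) \<Rightarrow> (real \<Rightarrow> complex) \<Rightarrow> bool" where
  "ac_deriv f g \<longleftrightarrow> (\<forall>a b. a \<le> b \<longrightarrow>
     g absolutely_integrable_on {a..b} \<and> (g has_integral f b - f a) {a..b})"

lemma ac_deriv_integrable: "ac_deriv f g \<Longrightarrow> g absolutely_integrable_on {a..b}"
  unfolding ac_deriv_def by (cases "a \<le> b") (simp_all add: set_integrable_def)

lemma ac_deriv_has_integral: "ac_deriv f g \<Longrightarrow> a \<le> b \<Longrightarrow> (g has_integral f b - f a) {a..b}"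
  unfolding ac_deriv_def by blast

lemma ac_deriv_integral:
  assumes "ac_deriv f g" "a \<le> b"
  shows "integral {a..b} g = f b - f a"
  using ac_deriv_has_integral[OF assms] by (rule integral_unique)

lemma ac_deriv_continuous:
  assumes "ac_deriv f g"
  shows "continuous_on A f"
proof -
  have "isCont f x" for x
  proof -
    have "continuous_on {x - 1..x + 1} (\<lambda>y. f (x - 1) + integral {x - 1..y} g)"
      using set_lebesgue_integral_eq_integral(1)[OF ac_deriv_integrable[OF assms]]
      by (intro continuous_intros indefinite_integral_continuous_1)
    then have "continuous_on {x - 1..x + 1} f"
      by (rule continuous_on_eq) (use ac_deriv_integral[OF assms] in auto)
    then show ?thesis
      by (rule continuous_on_interior) simp
  qed
  then show ?thesis
    by (simp add: continuous_at_imp_continuous_on)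
qed

lemma absolutely_integrable_mult_continuous:
  fixes f g :: "real \<Rightarrow> complex"
  assumes "continuous_on {a..b} f" "g absolutely_integrable_on {a..b}"
  shows "(\<lambda>x. f x * g x) absolutely_integrable_on {a..b}"
proof (rule absolutely_integrable_bounded_measurable_product[where h = "(*)"])
  show "bounded (f ` {a..b})"
    using assms(1) compact_continuous_image compact_imp_bounded by blast
  show "bilinear ((*) :: complex \<Rightarrow> _)"
    by (simp add: bilinear_conv_bounded_bilinear bounded_bilinear_mult)
qed (use assms continuous_imp_measurable_on_sets_lebesgue[OF assms(1)] in auto)

lemma ac_deriv_const: "ac_deriv (\<lambda>x. c) (\<lambda>x. 0)"
  unfolding ac_deriv_def by (auto simp: set_integrable_def)

lemma ac_deriv_add:
  assumes "ac_deriv f f'" "ac_deriv g g'"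
  shows "ac_deriv (\<lambda>x. f x + g x) (\<lambda>x. f' x + g' x)"
  using assms unfolding ac_deriv_def by (auto intro: set_integral_add(1) has_integral_add simp: add_diff_add)

lemma ac_deriv_cnj:
  assumes "ac_deriv f f'"
  shows "ac_deriv (\<lambda>x. cnj (f x)) (\<lambda>x. cnj (f' x))"
  using assms unfolding ac_deriv_def
proof (intro allI impI conjI)
  fix a b :: real
  assume "a \<le> b"
  show "(\<lambda>x. cnj (f' x)) absolutely_integrable_on {a..b}"
    using integrable_cnj[OF ac_deriv_integrable[OF assms, of a b, unfolded set_integrable_def]]
    by (simp add: set_integrable_def)
  show "((\<lambda>x. cnj (f' x)) has_integral cnj (f b) - cnj (f a)) {a..b}"
    using ac_deriv_has_integral[OF assms \<open>a \<le> b\<close>] has_integral_cnj[of f' "f b - f a"] by (simp add: o_def)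
qed

text \<open>By Bolzano's interval induction it suffices to bound the defect of the product rule on a
  short interval by \<open>\<epsilon>\<close> times the integral of \<open>\<bar>f'\<bar> + \<bar>g'\<bar>\<close>, an additive function of the interval.\<close>

lemma ac_deriv_mult:
  assumes f: "ac_deriv f f'" and g: "ac_deriv g g'"
  shows "ac_deriv (\<lambda>x. f x * g x) (\<lambda>x. f' x * g x + f x * g' x)"
  unfolding ac_deriv_def
proof (intro allI impI conjI)
  fix a b :: real
  assume ab: "a \<le> b"
  let ?h = "\<lambda>x. f' x * g x + f x * g' x"
  let ?m = "\<lambda>x. cmod (f' x) + cmod (g' x)"
  have abs_int: "?h absolutely_integrable_on {x..y}" for x y
    using absolutely_integrable_mult_continuous[OF ac_deriv_continuous[OF g] ac_deriv_integrable[OF f]]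
      absolutely_integrable_mult_continuous[OF ac_deriv_continuous[OF f] ac_deriv_integrable[OF g]]
    by (intro set_integral_add(1)) (simp_all add: mult.commute)
  then show "?h absolutely_integrable_on {a..b}" .
  have h_int: "?h integrable_on {x..y}" for x y
    using abs_int set_lebesgue_integral_eq_integral(1) by blast
  have m_int: "?m integrable_on {x..y}" for x y
    using ac_deriv_integrable[OF f] ac_deriv_integrable[OF g]
    by (intro integrable_add) (auto simp: absolutely_integrable_on_def)
  define D where "D x y = f y * g y - f x * g x - integral {x..y} ?h" for x y
  have "cmod (D a b) \<le> \<epsilon> * integral {a..b} ?m" if "\<epsilon> > 0" for \<epsilon>
    using ab
  proof (induction rule: Bolzano)
    case (trans x y z)
    have "D x z = D x y + D y z"
      using Henstock_Kurzweil_Integration.integral_combine[OF trans(3,4) h_int, symmetric] by (simp add: D_def)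
    moreover have "integral {x..z} ?m = integral {x..y} ?m + integral {y..z} ?m"
      using Henstock_Kurzweil_Integration.integral_combine[OF trans(3,4) m_int] by simp
    ultimately show ?case
      using trans(1,2) norm_triangle_mono[of "D x y" _ "D y z"] by (simp add: distrib_left)
  next
    case (local x)
    have "isCont f x" "isCont g x"
      using ac_deriv_continuous[OF f, of UNIV] ac_deriv_continuous[OF g, of UNIV] by (simp_all add: continuous_on_eq_continuous_at[OF open_UNIV])
    then obtain d1 d2 where "d1 > 0" "d2 > 0"
      and d1: "\<And>y. \<bar>y - x\<bar> < d1 \<Longrightarrow> cmod (f y - f x) < \<epsilon> / 2"
      and d2: "\<And>y. \<bar>y - x\<bar> < d2 \<Longrightarrow> cmod (g y - g x) < \<epsilon> / 2"
      using \<open>\<epsilon> > 0\<close> unfolding continuous_at_eps_delta by (metis dist_norm half_gt_zero real_norm_def)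
    show ?case
    proof (intro exI conjI allI impI)
      show "0 < min d1 d2"
        using \<open>d1 > 0\<close> \<open>d2 > 0\<close> by simp
      fix l r assume lr: "l \<le> x \<and> x \<le> r \<and> r - l < min d1 d2"
      then have "l \<le> r" by simp
      have fb: "cmod (f l - f s) \<le> \<epsilon>" and gb: "cmod (g r - g s) \<le> \<epsilon>" if "s \<in> {l..r}" for s
      proof -
        have "\<bar>s - x\<bar> < d1" "\<bar>s - x\<bar> < d2" "\<bar>l - x\<bar> < d1" "\<bar>r - x\<bar> < d2"
          using lr that by auto
        then show "cmod (f l - f s) \<le> \<epsilon>" "cmod (g r - g s) \<le> \<epsilon>"
          using d1[of s] d1[of l] d2[of s] d2[of r] norm_triangle_ineq4[of "f l - f x" "f s - f x"]
            norm_triangle_ineq4[of "g r - g x" "g s - g x"]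
          by simp_all
      qed
      \<comment> \<open>Freezing \<open>g\<close> at the right end and \<open>f\<close> at the left
        end makes the product rule exact, since the two frozen increments telescope to
        \<open>f r * g r - f l * g l\<close>. The defect therefore only sees the oscillation of
        \<open>f\<close> and \<open>g\<close> on the short interval.\<close>
      have "((\<lambda>s. (f' s * g r + f l * g' s) - ?h s) has_integral
          ((f r - f l) * g r + f l * (g r - g l)) - integral {l..r} ?h) {l..r}"
        by (intro has_integral_diff has_integral_add has_integral_mult_left has_integral_mult_right
            ac_deriv_has_integral f g \<open>l \<le> r\<close> integrable_integral h_int)
      then have "((\<lambda>s. f' s * (g r - g s) + (f l - f s) * g' s) has_integral D l r) {l..r}"
        by (auto simp add: D_def algebra_simps)
      then have "D l r = integral {l..r} (\<lambda>s. f' s * (g r - g s) + (f l - f s) * g' s)"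
        and i: "(\<lambda>s. f' s * (g r - g s) + (f l - f s) * g' s) integrable_on {l..r}"
        by (auto simp: has_integral_iff)
      moreover have "cmod (f' s * (g r - g s) + (f l - f s) * g' s) \<le> \<epsilon> * ?m s" if "s \<in> {l..r}" for s
        using fb[OF that] gb[OF that]
        by (intro norm_triangle_le) (simp add: norm_mult distrib_left mult.commute[of \<epsilon>] add_mono mult_left_mono
            mult.commute[of "cmod (f l - f s)"])
      then have "cmod (integral {l..r} (\<lambda>s. f' s * (g r - g s) + (f l - f s) * g' s))
          \<le> integral {l..r} (\<lambda>s. \<epsilon> * ?m s)"
        by (intro Henstock_Kurzweil_Integration.integral_norm_bound_integral i integrable_on_mult_right m_int)
      ultimately show "cmod (D l r) \<le> \<epsilon> * integral {l..r} ?m"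
        by (simp add: integral_mult_right)
    qed
  qed
  note bound = this
  have K: "integral {a..b} ?m \<ge> 0"
    by (intro Henstock_Kurzweil_Integration.integral_nonneg m_int) simp
  have "cmod (D a b) \<le> 0 + e" if "e > 0" for e
  proof -
    have "cmod (D a b) \<le> e / (integral {a..b} ?m + 1) * integral {a..b} ?m"
      using bound[of "e / (integral {a..b} ?m + 1)"] K \<open>e > 0\<close> by simp
    also have "\<dots> \<le> e"
      using K \<open>e > 0\<close> by (simp add: field_simps)
    finally show ?thesis
      by simp
  qed
  then have "cmod (D a b) \<le> 0"
    by (rule field_le_epsilon)
  then show "(?h has_integral f b * g b - f a * g a) {a..b}"
    using h_int by (simp add: D_def has_integral_iff)
qed

lemma ac_deriv_scale: "ac_deriv f f' \<Longrightarrow> ac_deriv (\<lambda>x. c * f x) (\<lambda>x. c * f' x)"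
  using ac_deriv_mult[OF ac_deriv_const[of c]] by simp

lemma ac_deriv_diff:
  assumes "ac_deriv f f'" "ac_deriv g g'"
  shows "ac_deriv (\<lambda>x. f x - g x) (\<lambda>x. f' x - g' x)"
  using ac_deriv_add[OF assms(1) ac_deriv_scale[OF assms(2), of "-1"]] by simp

lemma ac_deriv_C1:
  assumes "\<And>x. (f has_vector_derivative f' x) (at x)" "continuous_on UNIV f'"
  shows "ac_deriv f f'"
  unfolding ac_deriv_def
proof (intro allI impI conjI)
  fix a b :: real
  assume "a \<le> b"
  show "f' absolutely_integrable_on {a..b}"
    using assms(2) continuous_on_subset by (intro absolutely_integrable_continuous_real) blast
  show "(f' has_integral f b - f a) {a..b}"
    using assms(1) \<open>a \<le> b\<close> has_vector_derivative_at_within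
    by (intro fundamental_theorem_of_calculus) blast+
qed

section \<open>Changes on null sets and existence of primitives\<close>

lemma absolutely_integrable_cong_AE:
  fixes g h :: "real \<Rightarrow> complex"
  assumes "AE x in lebesgue. g x = h x"
  shows "g absolutely_integrable_on A \<longleftrightarrow> h absolutely_integrable_on A"
proof -
  obtain N where "negligible N" and "{x. g x \<noteq> h x} \<subseteq> N"
    using assms unfolding eventually_ae_filter_negligible by blast
  then show ?thesis
    by (intro absolutely_integrable_spike_eq[OF \<open>negligible N\<close>]) force
qed

lemma ac_deriv_cong_AE:
  assumes "ac_deriv f g" "AE x in lebesgue. g x = h x"
  shows "ac_deriv f h"
proof -
  obtain N where N: "negligible N" "{x. g x \<noteq> h x} \<subseteq> N"
    using assms(2) unfolding eventually_ae_filter_negligible by blast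
  have "(h has_integral y) A" if "(g has_integral y) A" for y A
    using N by (intro has_integral_spike[OF N(1) _ that]) force
  then show ?thesis
    using assms(1) absolutely_integrable_cong_AE[OF assms(2)] unfolding ac_deriv_def by blast
qed

lemma ac_deriv_ex:
  assumes "\<And>a b. g absolutely_integrable_on {a..b}"
  shows "\<exists>f. ac_deriv f g"
proof
  \<comment> \<open>For each \<open>x\<close> at least one of the two intervals is empty or a single
    point, so the difference is the oriented integral from 0 to \<open>x\<close>.\<close>
  let ?f = "\<lambda>x. integral {0..x} g - integral {x..0} g"
  have i: "g integrable_on {a..b}" for a b
    using assms set_lebesgue_integral_eq_integral(1) by blast
  show "ac_deriv ?f g"
    unfolding ac_deriv_def
  proof (intro allI impI conjI assms)
    fix a b :: real
    assume "a \<le> b"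
    then consider "0 \<le> a" | "a \<le> 0" "0 \<le> b" | "b \<le> 0"
      by linarith
    then have "?f b - ?f a = integral {a..b} g"
    proof cases
      case 1
      have z: "integral {x..0} g = 0" if "0 \<le> x" for x
        using that by (cases "x = 0") auto
      show ?thesis
        using Henstock_Kurzweil_Integration.integral_combine[OF 1 \<open>a \<le> b\<close> i] z[of a] z[of b] 1 \<open>a \<le> b\<close>
        by (simp add: algebra_simps)
    next
      case 2
      have z: "integral {x..0} g = 0" "integral {0..y} g = 0" if "0 \<le> x" "y \<le> 0" for x y
        using that by (cases "x = 0"; cases "y = 0"; auto)+
      show ?thesis
        using Henstock_Kurzweil_Integration.integral_combine[OF 2 i] z[of b a] 2
        by (simp add: algebra_simps)
    next
      case 3
      have z: "integral {0..y} g = 0" if "y \<le> 0" for y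
        using that by (cases "y = 0") auto
      show ?thesis
        using Henstock_Kurzweil_Integration.integral_combine[OF \<open>a \<le> b\<close> 3 i] z[of a] z[of b] 3 \<open>a \<le> b\<close>
        by (simp add: algebra_simps)
    qed
    then show "(g has_integral ?f b - ?f a) {a..b}"
      using i by (simp add: has_integral_iff)
  qed
qed

section \<open>Weak derivatives\<close>

lemma locally_integrable_iff:
  "locally_integrable f \<longleftrightarrow> (\<forall>a b. f absolutely_integrable_on {a..b})"
proof
  assume *: "\<forall>a b. f absolutely_integrable_on {a..b}"
  show "locally_integrable f"
    unfolding locally_integrable_def
  proof (intro allI impI)
    fix K :: "real set" assume "compact K"
    then obtain a b where "K \<subseteq> {a..b}"
      using bounded_subset_cbox_symmetric[OF compact_imp_bounded] by (metis box_real(2))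
    then show "set_integrable lebesgue K f"
      using * \<open>compact K\<close> by (meson compact_imp_closed lebesgue_closedin set_integrable_subset lmeasurable_compact fmeasurableD)
  qed
qed (simp add: locally_integrable_def)

lemma locally_integrableD: "locally_integrable f \<Longrightarrow> f absolutely_integrable_on {a..b}"
  by (simp add: locally_integrable_iff)

lemma ac_deriv_locally_integrable:
  assumes "ac_deriv f g"
  shows "locally_integrable f" "locally_integrable g"
  using assms ac_deriv_integrable absolutely_integrable_continuous_real ac_deriv_continuous
  unfolding locally_integrable_iff by blast+

lemma locally_integrable_add:
  "locally_integrable f \<Longrightarrow> locally_integrable g \<Longrightarrow> locally_integrable (\<lambda>x. f x + g x)"
  unfolding locally_integrable_iff by (auto intro: set_integral_add(1))

lemma locally_integrable_scale:
  "locally_integrable f \<Longrightarrow> locally_integrable (\<lambda>x. c * f x)"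
  unfolding locally_integrable_iff by (auto intro: absolutely_integrable_mult_continuous)

lemma locally_integrable_diff:
  "locally_integrable f \<Longrightarrow> locally_integrable g \<Longrightarrow> locally_integrable (\<lambda>x. f x - g x)"
  using locally_integrable_add[OF _ locally_integrable_scale[of g "-1"]] by simp

lemma locally_integrable_const: "locally_integrable (\<lambda>x. c)"
  by (simp add: locally_integrable_iff absolutely_integrable_continuous_real)

lemma test_function_differentiable: "test_function \<phi> \<Longrightarrow> (\<phi> has_field_derivative deriv \<phi> x) (at x)"
  by (simp add: DERIV_deriv_iff_field_differentiable smooth_differentiable test_function_iff)

lemma test_function_deriv:
  assumes "test_function \<phi>"
  shows "test_function (deriv \<phi>)"
proof -
  have "x \<in> closure {x. \<phi> x \<noteq> 0}" if "deriv \<phi> x \<noteq> 0" for x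
  proof (rule ccontr)
    assume x: "x \<notin> closure {x. \<phi> x \<noteq> 0}"
    have "(\<phi> has_field_derivative 0) (at x)"
      by (rule has_field_derivative_transform_within_open[where S = "- closure {x. \<phi> x \<noteq> 0}" and f = "\<lambda>_. 0"])
        (use x closure_subset[of "{x. \<phi> x \<noteq> 0}"] in auto)
    with that show False
      using DERIV_imp_deriv by blast
  qed
  then have "{x. deriv \<phi> x \<noteq> 0} \<subseteq> closure {x. \<phi> x \<noteq> 0}"
    by blast
  moreover have "bounded (closure {x. \<phi> x \<noteq> 0})"
    using assms by (simp add: test_function_iff bounded_closure)
  ultimately have "bounded {x. deriv \<phi> x \<noteq> 0}"
    using bounded_subset by blast
  then show ?thesis
    using assms smooth_deriv by (simp add: test_function_iff)
qed

lemma test_function_continuous: "test_function \<phi> \<Longrightarrow> continuous_on A \<phi>"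
  by (meson DERIV_isCont continuous_at_imp_continuous_on test_function_differentiable)

lemma test_function_support:
  assumes "test_function \<phi>"
  obtains N where "N > 0" "\<And>x. \<bar>x\<bar> \<ge> N \<Longrightarrow> \<phi> x = 0"
proof -
  obtain B where "B > 0" "\<And>x. \<phi> x \<noteq> 0 \<Longrightarrow> \<bar>x\<bar> \<le> B"
    using assms unfolding test_function_iff bounded_pos by auto
  then show ?thesis
    by (intro that[of "B + 1"]) force+
qed

text \<open>Passage between the gauge integral over intervals, in which \<open>ac_deriv\<close> is
  stated, and the Lebesgue integral over the line, in which weak derivatives are stated.\<close>

lemma integral_support_interval:
  fixes h :: "real \<Rightarrow> complex"
  assumes "\<And>x. \<bar>x\<bar> \<ge> N \<Longrightarrow> h x = 0"
  shows "h absolutely_integrable_on {-N..N} \<longleftrightarrow> integrable lebesgue h"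
    and "integrable lebesgue h \<Longrightarrow> integral {-N..N} h = (LINT x|lebesgue. h x)"
proof -
  have *: "indicator {-N..N} x *\<^sub>R h x = h x" for x
    using assms[of x] by (auto simp: indicator_def)
  show **: "h absolutely_integrable_on {-N..N} \<longleftrightarrow> integrable lebesgue h"
    by (simp add: set_integrable_def *)
  assume "integrable lebesgue h"
  then have "(LINT x:{-N..N}|lebesgue. h x) = integral {-N..N} h"
    using ** by (intro set_lebesgue_integral_eq_integral(2)) blast
  then show "integral {-N..N} h = (LINT x|lebesgue. h x)"
    by (simp add: set_lebesgue_integral_def *)
qed

lemma test_function_integrable:
  assumes "test_function \<phi>" "locally_integrable f"
  shows "integrable lebesgue (\<lambda>x. \<phi> x *\<^sub>R f x)"
proof -
  obtain N where N: "\<And>x. \<bar>x\<bar> \<ge> N \<Longrightarrow> \<phi> x = 0"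
    using test_function_support[OF assms(1)] by blast
  have "(\<lambda>x. complex_of_real (\<phi> x) * f x) absolutely_integrable_on {-N..N}"
    by (intro absolutely_integrable_mult_continuous continuous_on_of_real
        test_function_continuous assms locally_integrableD)
  then show ?thesis
    using N by (subst (asm) integral_support_interval(1)) (auto simp: scaleR_conv_of_real)
qed

lemma ac_deriv_test_function:
  assumes "test_function \<phi>"
  shows "ac_deriv (\<lambda>x. of_real (\<phi> x)) (\<lambda>x. of_real (deriv \<phi> x))"
proof (rule ac_deriv_C1)
  show "((\<lambda>x. complex_of_real (\<phi> x)) has_vector_derivative of_real (deriv \<phi> x)) (at x)" for x
    using test_function_differentiable[OF assms, of x]
    by (intro has_vector_derivative_of_real) (simp add: has_real_derivative_iff_has_vector_derivative)
  show "continuous_on UNIV (\<lambda>x. complex_of_real (deriv \<phi> x))"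
    by (intro continuous_on_of_real test_function_continuous test_function_deriv assms)
qed

text \<open>The product of \<open>\<phi>\<close> and \<open>F\<close> is absolutely continuous and
  vanishes at the ends of an interval outside which both \<open>\<phi>\<close> and its derivative
  are zero; the integral of its derivative is then zero.\<close>

lemma ac_deriv_imp_has_weak_deriv:
  assumes "ac_deriv F g"
  shows "has_weak_deriv F g"
  unfolding has_weak_deriv_def
proof (intro conjI allI impI)
  fix \<phi> assume \<phi>: "test_function \<phi>"
  obtain N where "N > 0" and N: "\<And>x. \<bar>x\<bar> \<ge> N \<Longrightarrow> \<phi> x = 0"
    using test_function_support[OF \<phi>] by blast
  obtain N' where N': "\<And>x. \<bar>x\<bar> \<ge> N' \<Longrightarrow> deriv \<phi> x = 0"
    using test_function_support[OF test_function_deriv[OF \<phi>]] by blast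
  define M where "M = max N N'"
  let ?h = "\<lambda>x. complex_of_real (deriv \<phi> x) * F x + of_real (\<phi> x) * g x"
  have 1: "integrable lebesgue (\<lambda>x. complex_of_real (deriv \<phi> x) * F x)"
    and 2: "integrable lebesgue (\<lambda>x. complex_of_real (\<phi> x) * g x)"
    using test_function_integrable[OF test_function_deriv[OF \<phi>] ac_deriv_locally_integrable(1)[OF assms]]
      test_function_integrable[OF \<phi> ac_deriv_locally_integrable(2)[OF assms]]
    by (simp_all add: scaleR_conv_of_real)
  have "integral {-M..M} ?h = 0"
    using ac_deriv_integral[OF ac_deriv_mult[OF ac_deriv_test_function[OF \<phi>] assms], of "-M" M] \<open>N > 0\<close> N
    by (simp add: M_def)
  moreover have "integral {-M..M} ?h = (LINT x|lebesgue. ?h x)"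
    using 1 2 N N' by (intro integral_support_interval(2)) (auto simp: M_def)
  ultimately have "(LINT x|lebesgue. ?h x) = 0"
    by simp
  then show "(LINT x|lebesgue. deriv \<phi> x *\<^sub>R F x) = - (LINT x|lebesgue. \<phi> x *\<^sub>R g x)"
    using 1 2 by (simp add: scaleR_conv_of_real add_eq_0_iff2)
qed (use ac_deriv_locally_integrable[OF assms] in auto)

text \<open>Bumps increase the information to \<open>h\<close> having integral zero over every
  interval, by dominated convergence. Lebesgue's differentiation theorem recovers \<open>h\<close>
  almost everywhere from its interval averages.\<close>

lemma fundamental_lemma_calculus_of_variations:
  assumes h: "locally_integrable h"
    and 0: "\<And>\<psi>. test_function \<psi> \<Longrightarrow> (LINT x|lebesgue. \<psi> x *\<^sub>R h x) = 0"
  shows "AE x in lebesgue. h x = 0"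
proof -
  have int0: "integral {a..b} h = 0" for a b
  proof -
    have i: "integrable lebesgue (\<lambda>x. indicator {a..b} x *\<^sub>R h x)"
      using locally_integrableD[OF h] by (simp add: set_integrable_def)
    have eq: "bump a b n x *\<^sub>R h x = bump a b n x *\<^sub>R (indicator {a..b} x *\<^sub>R h x)" for n x
    proof (cases "x \<in> {a..b}")
      case False
      then have "bump a b n x = 0"
        using bump_le_indicator[of a b n x] by simp
      then show ?thesis
        by simp
    qed simp
    have ioo: "h absolutely_integrable_on {a<..<b}"
      using locally_integrableD[OF h, of a b] by (rule set_integrable_subset) auto
    have "(\<lambda>n. LINT x|lebesgue. bump a b n x *\<^sub>R h x) \<longlonglongrightarrow> (LINT x|lebesgue. indicator {a<..<b} x *\<^sub>R h x)"
    proof (rule integral_dominated_convergence[where w = "\<lambda>x. cmod (indicator {a..b} x *\<^sub>R h x)"])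
      show "(\<lambda>x. indicator {a<..<b} x *\<^sub>R h x) \<in> borel_measurable lebesgue"
        using ioo by (simp add: set_integrable_def borel_measurable_integrable)
      show "(\<lambda>x. bump a b n x *\<^sub>R h x) \<in> borel_measurable lebesgue" for n
        using test_function_integrable[OF test_function_bump h] borel_measurable_integrable by blast
      show "AE x in lebesgue. (\<lambda>n. bump a b n x *\<^sub>R h x) \<longlonglongrightarrow> indicator {a<..<b} x *\<^sub>R h x"
        by (intro AE_I2 tendsto_scaleR bump_tendsto tendsto_const)
      show "AE x in lebesgue. cmod (bump a b n x *\<^sub>R h x) \<le> cmod (indicator {a..b} x *\<^sub>R h x)" for n
        using bump_le_indicator[of a b n] by (auto intro!: AE_I2 mult_right_mono)
      show "integrable lebesgue (\<lambda>x. cmod (indicator {a..b} x *\<^sub>R h x))"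
        using i by (rule integrable_norm)
    qed
    then have "(LINT x:{a<..<b}|lebesgue. h x) = 0"
      using 0[OF test_function_bump] by (simp add: set_lebesgue_integral_def LIMSEQ_const_iff)
    then show ?thesis
      using set_lebesgue_integral_eq_integral(2)[OF ioo] integral_open_interval_real[of a b h] by simp
  qed
  obtain N where "negligible N" and
    N: "\<And>x e. \<lbrakk>x \<notin> N; 0 < e\<rbrakk> \<Longrightarrow> \<exists>d>0. \<forall>k. 0 < k \<and> k < d \<longrightarrow>
          cmod (integral (cbox x (x + k *\<^sub>R One)) h /\<^sub>R k ^ DIM(real) - h x) < e"
    using integrable_ccontinuous_explicit[of h] locally_integrableD[OF h] set_lebesgue_integral_eq_integral(1)
    by (metis box_real(2))
  have "h x = 0" if xN: "x \<notin> N" for x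
  proof (rule ccontr)
    assume "h x \<noteq> 0"
    then obtain d where "d > 0" and
      "\<And>k. 0 < k \<and> k < d \<Longrightarrow> cmod (integral (cbox x (x + k *\<^sub>R One)) h /\<^sub>R k ^ DIM(real) - h x) < cmod (h x)"
      using N[OF xN, of "cmod (h x)"] by auto
    from this(2)[of "d / 2"] \<open>d > 0\<close> show False
      using int0 by simp
  qed
  then show ?thesis
    using \<open>negligible N\<close> unfolding eventually_ae_filter_negligible by blast
qed

text \<open>To the right of the support the primitive is constant, equal to the total integral; mean
  zero is exactly what makes its support compact.\<close>

lemma test_function_primitive:
  assumes \<psi>: "test_function \<psi>" and 0: "(LINT x|lebesgue. \<psi> x) = 0"
  obtains \<Phi> where "test_function \<Phi>" "deriv \<Phi> = \<psi>"
proof -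
  obtain N where "N > 0" and N: "\<And>x. \<bar>x\<bar> \<ge> N \<Longrightarrow> \<psi> x = 0"
    using test_function_support[OF \<psi>] by blast
  \<comment> \<open>Starting the integral one unit left of \<open>-N\<close> leaves room on both
    sides of the case split below: points beyond \<open>-M\<close> are interior to the domain of
    integration, and the others have a neighbourhood \<open>{..<-N}\<close> on which the primitive
    vanishes.\<close>
  define M where "M = N + 1"
  define \<Phi> where "\<Phi> x = integral {-M..x} \<psi>" for x
  have zero: "integral {a..b} \<psi> = 0" if "\<And>x. x \<in> {a..b} \<Longrightarrow> \<bar>x\<bar> \<ge> N" for a b
    using that N by (subst Henstock_Kurzweil_Integration.integral_cong[where g = "\<lambda>_. 0"]) auto
  have left: "\<Phi> x = 0" if "x \<le> -N" for x
    unfolding \<Phi>_def using that \<open>N > 0\<close> by (intro zero) auto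
  have int: "\<psi> integrable_on {a..b}" for a b
    using test_function_continuous[OF \<psi>] by (rule integrable_continuous_real)
  have right: "\<Phi> x = 0" if "x \<ge> N" for x
  proof -
    have *: "indicator {-M..x} y *\<^sub>R \<psi> y = \<psi> y" for y
    proof (cases "y \<in> {-M..x}")
      case False
      then have "\<psi> y = 0"
        using that \<open>N > 0\<close> by (intro N) (auto simp: M_def)
      then show ?thesis
        by simp
    qed simp
    have "\<Phi> x = (LINT y:{-M..x}|lebesgue. \<psi> y)"
      unfolding \<Phi>_def using test_function_continuous[OF \<psi>]
      by (intro set_lebesgue_integral_eq_integral(2)[symmetric] absolutely_integrable_continuous_real)
    also have "\<dots> = 0"
      using 0 unfolding set_lebesgue_integral_def * .
    finally show ?thesis .
  qed
  have D: "(\<Phi> has_field_derivative \<psi> x) (at x)" for x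
  proof (cases "x > -M")
    case True
    have "(\<Phi> has_field_derivative \<psi> x) (at x within {-M..x+1})"
      unfolding \<Phi>_def using True test_function_continuous[OF \<psi>]
      by (intro integral_has_real_derivative) simp_all
    then show ?thesis
      using at_within_Icc_at[OF True, of "x + 1"] by simp
  next
    case False
    then have "\<psi> x = 0"
      using \<open>N > 0\<close> by (intro N) (simp add: M_def)
    show ?thesis
      unfolding \<open>\<psi> x = 0\<close>
      by (rule has_field_derivative_transform_within_open[where S = "{..<-N}" and f = "\<lambda>_. 0"])
        (use False left in \<open>auto simp: M_def\<close>)
  qed
  have "{x. \<Phi> x \<noteq> 0} \<subseteq> {-N..N}"
    using left right by (metis (mono_tags, lifting) atLeastAtMost_iff linorder_le_cases mem_Collect_eq subsetI)
  then have "test_function \<Phi>"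
    using smooth_primitive[OF D] \<psi> bounded_subset[OF bounded_closed_interval]
    unfolding test_function_iff by simp
  moreover have "deriv \<Phi> = \<psi>"
    using D DERIV_imp_deriv by blast
  ultimately show ?thesis
    by (rule that)
qed

text \<open>Subtracting a primitive \<open>G\<close> of \<open>g\<close> leaves a function
  \<open>h\<close> with weak derivative zero. So \<open>h\<close> annihilates all derivatives of
  test functions, among them every test function of mean zero. Each test function differs from one
  of mean zero by a multiple of a fixed bump, which forces \<open>h\<close> to be constant almost
  everywhere.\<close>

lemma du_Bois_Reymond:
  assumes fg: "has_weak_deriv f g"
  obtains F where "ac_deriv F g" "AE x in lebesgue. f x = F x"
proof -
  have f: "locally_integrable f" and g: "locally_integrable g"
    and weak: "\<And>\<phi>. test_function \<phi> \<Longrightarrow>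
        (LINT x|lebesgue. deriv \<phi> x *\<^sub>R f x) = - (LINT x|lebesgue. \<phi> x *\<^sub>R g x)"
    using fg unfolding has_weak_deriv_def by blast+
  obtain G where G: "ac_deriv G g"
    using ac_deriv_ex locally_integrableD[OF g] by blast
  have G_loc: "locally_integrable G"
    using ac_deriv_locally_integrable(1)[OF G] .
  define h where "h x = f x - G x" for x
  have h: "locally_integrable h"
    unfolding h_def[abs_def] by (intro locally_integrable_diff f G_loc)
  have weak_h: "(LINT x|lebesgue. deriv \<phi> x *\<^sub>R h x) = 0" if "test_function \<phi>" for \<phi>
    using weak[OF that] ac_deriv_imp_has_weak_deriv[OF G] that
      test_function_integrable[OF test_function_deriv[OF that]] f G_loc
    by (simp add: h_def scaleR_diff_right has_weak_deriv_def)
  let ?\<eta> = "bump 0 1 0"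
  have \<eta>: "test_function ?\<eta>"
    by (rule test_function_bump)
  have real_int: "integrable lebesgue \<psi>" if "test_function \<psi>" for \<psi>
    using integrable_Re[OF test_function_integrable[OF that locally_integrable_const[of 1]]] by simp
  define I where "I = (LINT x|lebesgue. ?\<eta> x)"
  \<comment> \<open>If \<open>h\<close> is a constant, it must be its average against the normalised
    bump.\<close>
  define c where "c = (LINT x|lebesgue. ?\<eta> x *\<^sub>R h x) /\<^sub>R I"
  \<comment> \<open>The bump is nonnegative and positive on the open unit interval, a set that is
    not null.\<close>
  have "I \<noteq> 0"
  proof
    assume "I = 0"
    then have "AE x in lebesgue. ?\<eta> x = 0"
      unfolding I_def by (subst (asm) integral_nonneg_eq_0_iff_AE)
        (auto simp: real_int \<eta> bump_def flat_exp_1_bounds)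
    then obtain N where N: "negligible N" "{x. ?\<eta> x \<noteq> 0} \<subseteq> N"
      unfolding eventually_ae_filter_negligible by blast
    have "{0<..<1} \<subseteq> {x. ?\<eta> x \<noteq> 0}"
      by (auto simp: bump_def flat_exp_def)
    with N have "negligible {0<..<1::real}"
      using negligible_subset by blast
    then show False
      using open_not_negligible[of "{0<..<1::real}"] by simp
  qed
  have "AE x in lebesgue. h x - c = 0"
  proof (rule fundamental_lemma_calculus_of_variations)
    show "locally_integrable (\<lambda>x. h x - c)"
      by (intro locally_integrable_diff h locally_integrable_const)
    fix \<psi> assume \<psi>: "test_function \<psi>"
    define J where "J = (LINT x|lebesgue. \<psi> x)"
    \<comment> \<open>The multiple \<open>J / I\<close> of the bump is the one that removes the mean
      of \<open>\<psi>\<close>.\<close>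
    have \<kappa>: "test_function (\<lambda>x. \<psi> x - J / I * ?\<eta> x)"
    proof -
      have "{x. \<psi> x - J / I * ?\<eta> x \<noteq> 0} \<subseteq> {x. \<psi> x \<noteq> 0} \<union> {x. ?\<eta> x \<noteq> 0}"
        by auto
      then show ?thesis
        using \<psi> \<eta> bounded_subset[of "{x. \<psi> x \<noteq> 0} \<union> {x. ?\<eta> x \<noteq> 0}"]
        unfolding test_function_iff by (intro conjI smooth_diff_scale) auto
    qed
    have "(LINT x|lebesgue. \<psi> x - J / I * ?\<eta> x) = 0"
      using real_int[OF \<psi>] real_int[OF \<eta>] \<open>I \<noteq> 0\<close> by (simp add: J_def[symmetric] I_def[symmetric])
    then obtain \<Phi> where "test_function \<Phi>" "deriv \<Phi> = (\<lambda>x. \<psi> x - J / I * ?\<eta> x)"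
      using test_function_primitive[OF \<kappa>] by blast
    then have "(LINT x|lebesgue. (\<psi> x - J / I * ?\<eta> x) *\<^sub>R h x) = 0"
      using weak_h by metis
    moreover have "(\<psi> x - J / I * ?\<eta> x) *\<^sub>R h x = \<psi> x *\<^sub>R h x - (J / I) *\<^sub>R (?\<eta> x *\<^sub>R h x)" for x
      by (simp add: scaleR_diff_left)
    ultimately have "(LINT x|lebesgue. \<psi> x *\<^sub>R h x - (J / I) *\<^sub>R (?\<eta> x *\<^sub>R h x)) = 0"
      by (simp only:)
    then have "(LINT x|lebesgue. \<psi> x *\<^sub>R h x) = (LINT x|lebesgue. (J / I) *\<^sub>R (?\<eta> x *\<^sub>R h x))"
      by (subst (asm) Bochner_Integration.integral_diff)
        (use test_function_integrable[OF \<psi> h] test_function_integrable[OF \<eta> h] in \<open>simp_all del: scaleR_scaleR\<close>)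
    also have "\<dots> = J *\<^sub>R c"
      unfolding integral_scaleR_right by (simp add: c_def divide_inverse)
    also have "\<dots> = (LINT x|lebesgue. \<psi> x *\<^sub>R c)"
      using real_int[OF \<psi>] by (simp add: J_def)
    finally show "(LINT x|lebesgue. \<psi> x *\<^sub>R (h x - c)) = 0"
      using test_function_integrable[OF \<psi> h] real_int[OF \<psi>] by (simp add: scaleR_diff_right)
  qed
  then have "AE x in lebesgue. f x = G x + c"
    by eventually_elim (simp add: h_def algebra_simps)
  moreover have "ac_deriv (\<lambda>x. G x + c) g"
    using ac_deriv_add[OF G ac_deriv_const[of c]] by simp
  ultimately show ?thesis
    using that by blast
qed

section \<open>Weak derivatives up to null sets\<close>

lemma has_weak_deriv_unique:
  assumes "has_weak_deriv f g" "has_weak_deriv f h"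
  shows "AE x in lebesgue. g x = h x"
proof -
  have "AE x in lebesgue. g x - h x = 0"
  proof (rule fundamental_lemma_calculus_of_variations)
    show "locally_integrable (\<lambda>x. g x - h x)"
      using assms unfolding has_weak_deriv_def by (simp add: locally_integrable_diff)
    show "(LINT x|lebesgue. \<psi> x *\<^sub>R (g x - h x)) = 0" if "test_function \<psi>" for \<psi>
      using assms that test_function_integrable[OF that] unfolding has_weak_deriv_def
      by (simp add: scaleR_diff_right)
  qed
  then show ?thesis
    by simp
qed

text \<open>Makes the arbitrary choice in \<open>weak_deriv\<close> harmless: under an integral it
  may be replaced by whichever derivative is at hand.\<close>

lemma weak_deriv_AE_eq:
  assumes "has_weak_deriv f g"
  shows "AE x in lebesgue. weak_deriv f x = g x"
  using has_weak_deriv_unique[OF someI[of "has_weak_deriv f", OF assms] assms] by (simp add: weak_deriv_def)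

lemma has_weak_deriv_weak_deriv:
  "weakly_differentiable f \<Longrightarrow> has_weak_deriv f (weak_deriv f)"
  using someI_ex[of "has_weak_deriv f"] by (simp add: weakly_differentiable_def weak_deriv_def)

lemma locally_integrable_cong_AE:
  assumes "AE x in lebesgue. f x = g x"
  shows "locally_integrable f \<longleftrightarrow> locally_integrable g"
  using absolutely_integrable_cong_AE[OF assms] unfolding locally_integrable_def by blast

lemma has_weak_deriv_ac:
  assumes F: "ac_deriv F g" and "AE x in lebesgue. f x = F x"
  shows "has_weak_deriv f g"
  unfolding has_weak_deriv_def
proof (intro conjI allI impI)
  show f: "locally_integrable f"
    using locally_integrable_cong_AE[OF assms(2)] ac_deriv_locally_integrable[OF F] by blast
  show "locally_integrable g"
    using ac_deriv_locally_integrable[OF F] by blast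
  fix \<phi> assume \<phi>: "test_function \<phi>"
  have "(LINT x|lebesgue. deriv \<phi> x *\<^sub>R f x) = (LINT x|lebesgue. deriv \<phi> x *\<^sub>R F x)"
    using test_function_integrable[OF test_function_deriv[OF \<phi>]] f ac_deriv_locally_integrable[OF F] assms(2)
    by (intro integral_cong_AE) (auto intro: borel_measurable_integrable)
  then show "(LINT x|lebesgue. deriv \<phi> x *\<^sub>R f x) = - (LINT x|lebesgue. \<phi> x *\<^sub>R g x)"
    using ac_deriv_imp_has_weak_deriv[OF F] \<phi> unfolding has_weak_deriv_def by simp
qed

lemma weak_deriv_ac:
  assumes "ac_deriv F g" "AE x in lebesgue. f x = F x"
  shows "AE x in lebesgue. weak_deriv f x = g x"
  by (rule weak_deriv_AE_eq[OF has_weak_deriv_ac[OF assms]])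

section \<open>Integrals of derivatives over the real line\<close>

text \<open>Stands in for decay at infinity. An integrable function need not have a limit, but if it
  stayed above a positive constant on a half-line, long intervals there would exhaust any bound on
  its L1 norm.\<close>

lemma integrable_lower_bound_nonpos:
  fixes h :: "real \<Rightarrow> real"
  assumes h: "integrable lebesgue h" and "\<And>y. y \<ge> N \<Longrightarrow> c \<le> h y"
  shows "c \<le> 0"
proof (rule ccontr)
  assume "\<not> c \<le> 0"
  then obtain n :: nat where n: "(LINT x|lebesgue. \<bar>h x\<bar>) < real n * c"
    using ex_less_of_nat_mult[of c] by (auto simp: not_le)
  have "real n * c = (LINT x|lebesgue. indicator {N..N + real n} x * c)"
    by simp
  also have "\<dots> \<le> (LINT x|lebesgue. \<bar>h x\<bar>)"
  proof (rule integral_mono)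
    show "integrable lebesgue (\<lambda>x. indicator {N..N + real n} x * c)"
      by (auto intro!: integrable_mult_left integrable_real_indicator)
    show "indicator {N..N + real n} x * c \<le> \<bar>h x\<bar>" for x
      using assms(2)[of x] by (auto simp: indicator_def)
  qed (use h in auto)
  finally show False
    using n by simp
qed

lemma ac_deriv_measurable: "ac_deriv f g \<Longrightarrow> f \<in> borel_measurable borel"
  using ac_deriv_continuous borel_measurable_continuous_onI by blast

lemma ac_deriv_measurable_lebesgue: "ac_deriv f g \<Longrightarrow> f \<in> borel_measurable lebesgue"
  by (simp add: ac_deriv_measurable measurable_completion)

text \<open>\<open>F x - F (-x)\<close> is integrable and tends to the integral of \<open>G\<close>, so this limit is 0.\<close>

lemma ac_deriv_integral_zero:
  assumes ac: "ac_deriv F G" and F: "integrable lebesgue F" and G: "integrable lebesgue G"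
  shows "(LINT x|lebesgue. G x) = 0"
proof -
  let ?I = "LINT x|lebesgue. G x"
  define H where "H x = F x - F (- x)" for x
  have "((\<lambda>r. LINT x|lebesgue. indicator {-r..r} x *\<^sub>R G x) \<longlongrightarrow> ?I) at_top"
  proof (rule integral_dominated_convergence_at_top[where w = "\<lambda>x. cmod (G x)"])
    show "AE x in lebesgue. ((\<lambda>r. indicator {-r..r} x *\<^sub>R G x) \<longlongrightarrow> G x) at_top"
    proof (intro AE_I2 tendsto_eventually)
      show "\<forall>\<^sub>F r in at_top. indicator {-r..r} x *\<^sub>R G x = G x" for x
        using eventually_ge_at_top[of "\<bar>x\<bar>"] by eventually_elim (auto simp: indicator_def abs_le_iff)
    qed
    show "\<forall>\<^sub>F r in at_top. AE x in lebesgue. cmod (indicator {-r..r} x *\<^sub>R G x) \<le> cmod (G x)"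
      by (auto simp: indicator_def)
    show "(\<lambda>x. indicator {-r..r} x *\<^sub>R G x) \<in> borel_measurable lebesgue" for r
      by (intro borel_measurable_scaleR borel_measurable_indicator borel_measurable_integrable G) simp
  qed (use G in auto)
  moreover have "\<forall>\<^sub>F r in at_top. (LINT x|lebesgue. indicator {-r..r} x *\<^sub>R G x) = H r"
    using eventually_ge_at_top[of 0]
  proof eventually_elim
    case (elim r)
    then show ?case
      using set_lebesgue_integral_eq_integral(2)[OF ac_deriv_integrable[OF ac, of "-r" r]]
        ac_deriv_integral[OF ac, of "-r" r]
      by (simp add: set_lebesgue_integral_def H_def)
  qed
  ultimately have "(H \<longlongrightarrow> ?I) at_top"
    by (rule Lim_transform_eventually)
  then have lim: "((\<lambda>r. cmod (H r)) \<longlongrightarrow> cmod ?I) at_top"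
    by (rule tendsto_norm)
  \<comment> \<open>The reflection rule is stated for \<open>lborel\<close>; \<open>F\<close> is
    continuous, hence Borel, so integrability passes to the completed measure and back.\<close>
  have "integrable lebesgue (\<lambda>x. F (- x))"
    using F lborel_integrable_real_affine[of F "-1" 0] ac_deriv_measurable[OF ac]
    by (subst (asm) integrable_completion) (auto simp: integrable_completion)
  then have H: "integrable lebesgue (\<lambda>x. cmod (H x))"
    unfolding H_def using F by (intro integrable_norm Bochner_Integration.integrable_diff)
  show ?thesis
  proof (rule ccontr)
    assume "?I \<noteq> 0"
    then have "\<forall>\<^sub>F r in at_top. cmod ?I / 2 < cmod (H r)"
      by (intro order_tendstoD(1)[OF lim]) simp
    then obtain N where "\<And>r. r \<ge> N \<Longrightarrow> cmod ?I / 2 \<le> cmod (H r)"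
      unfolding eventually_at_top_linorder by (meson less_imp_le)
    then show False
      using integrable_lower_bound_nonpos[OF H] \<open>?I \<noteq> 0\<close> by fastforce
  qed
qed

section \<open>Square integrable functions\<close>

lemma L2_measurable: "f \<in> L2 \<Longrightarrow> f \<in> borel_measurable lebesgue"
  and L2_integrable: "f \<in> L2 \<Longrightarrow> integrable lebesgue (\<lambda>x. (cmod (f x))\<^sup>2)"
  by (simp_all add: L2_def)

lemma L2_bound:
  assumes "f \<in> L2" "g \<in> borel_measurable lebesgue" "\<And>x. cmod (g x) \<le> C * cmod (f x)"
  shows "g \<in> L2"
proof -
  have "integrable lebesgue (\<lambda>x. (cmod (g x))\<^sup>2)"
  proof (rule Bochner_Integration.integrable_bound)
    show "integrable lebesgue (\<lambda>x. C\<^sup>2 * (cmod (f x))\<^sup>2)"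
      using L2_integrable[OF assms(1)] by simp
    show "AE x in lebesgue. norm ((cmod (g x))\<^sup>2) \<le> norm (C\<^sup>2 * (cmod (f x))\<^sup>2)"
      using power_mono[OF assms(3), of _ 2] by (auto simp: power_mult_distrib)
    show "(\<lambda>x. (cmod (g x))\<^sup>2) \<in> borel_measurable lebesgue"
      using assms(2) by measurable
  qed
  then show ?thesis
    using assms(2) by (simp add: L2_def)
qed

lemma borel_measurable_cnj [measurable (raw)]:
  "f \<in> borel_measurable M \<Longrightarrow> (\<lambda>x. cnj (f x)) \<in> borel_measurable M"
  by (rule measurable_compose[OF _ borel_measurable_continuous_onI]) (auto intro: continuous_intros)

lemma L2_cnj: "f \<in> L2 \<Longrightarrow> (\<lambda>x. cnj (f x)) \<in> L2"
  by (rule L2_bound[where C = 1]) (auto dest: L2_measurable intro: borel_measurable_cnj)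

lemma L2_scale: "f \<in> L2 \<Longrightarrow> (\<lambda>x. c * f x) \<in> L2"
  by (rule L2_bound[where C = "cmod c"]) (auto dest: L2_measurable simp: norm_mult)

lemma L2_mult_integrable:
  assumes f: "f \<in> L2" and g: "g \<in> L2"
  shows "integrable lebesgue (\<lambda>x. f x * g x)"
proof (rule Bochner_Integration.integrable_bound)
  show "integrable lebesgue (\<lambda>x. (cmod (f x))\<^sup>2 + (cmod (g x))\<^sup>2)"
    using L2_integrable f g by simp
  show "(\<lambda>x. f x * g x) \<in> borel_measurable lebesgue"
    using L2_measurable[OF f] L2_measurable[OF g] by measurable
  have "a * b \<le> a\<^sup>2 + b\<^sup>2" for a b :: real
    using sum_squares_bound[of a b] zero_le_power2[of a] zero_le_power2[of b] by linarith
  then show "AE x in lebesgue. cmod (f x * g x) \<le> norm ((cmod (f x))\<^sup>2 + (cmod (g x))\<^sup>2)"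
    by (simp add: norm_mult)
qed

lemma L2_cmod_mult_integrable:
  assumes "f \<in> L2" "g \<in> L2"
  shows "integrable lebesgue (\<lambda>x. cmod (f x) * cmod (g x))"
  using integrable_norm[OF L2_mult_integrable[OF assms]] by (simp add: norm_mult)

lemma L2_add:
  assumes f: "f \<in> L2" and g: "g \<in> L2"
  shows "(\<lambda>x. f x + g x) \<in> L2"
proof -
  have m: "(\<lambda>x. f x + g x) \<in> borel_measurable lebesgue"
    using L2_measurable[OF f] L2_measurable[OF g] by measurable
  have "integrable lebesgue (\<lambda>x. (cmod (f x + g x))\<^sup>2)"
  proof (rule Bochner_Integration.integrable_bound)
    show "integrable lebesgue (\<lambda>x. (cmod (f x))\<^sup>2 + (cmod (g x))\<^sup>2 + 2 * (cmod (f x) * cmod (g x)))"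
      using L2_integrable f g L2_cmod_mult_integrable by simp
    have "(cmod (f x + g x))\<^sup>2 \<le> (cmod (f x))\<^sup>2 + (cmod (g x))\<^sup>2 + 2 * (cmod (f x) * cmod (g x))" for x
      using power_mono[OF norm_triangle_ineq[of "f x" "g x"], of 2] by (simp add: power2_sum)
    then show "AE x in lebesgue. norm ((cmod (f x + g x))\<^sup>2)
        \<le> norm ((cmod (f x))\<^sup>2 + (cmod (g x))\<^sup>2 + 2 * (cmod (f x) * cmod (g x)))"
      by (auto intro: order_trans[OF _ abs_ge_self])
  qed (use m in measurable)
  then show ?thesis
    using m by (simp add: L2_def)
qed

lemma L2_diff:
  assumes "f \<in> L2" "g \<in> L2"
  shows "(\<lambda>x. f x - g x) \<in> L2"
  using L2_add[OF assms(1) L2_scale[OF assms(2), of "-1"]] by simp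

lemma L2_norm_nonneg [simp]: "L2_norm f \<ge> 0"
  by (simp add: L2_norm_def)

lemma L2_norm_power2: "(L2_norm f)\<^sup>2 = (LINT x|lebesgue. (cmod (f x))\<^sup>2)"
  by (simp add: L2_norm_def)

lemma L2_norm_cnj [simp]: "L2_norm (\<lambda>x. cnj (f x)) = L2_norm f"
  by (simp add: L2_norm_def)

lemma L2_cong_AE:
  assumes "f \<in> L2" "AE x in lebesgue. f x = g x"
  shows "g \<in> L2"
proof -
  have "g \<in> borel_measurable lebesgue"
    using L2_measurable[OF assms(1)] assms(2) by (rule borel_measurable_AE)
  moreover from this have "integrable lebesgue (\<lambda>x. (cmod (g x))\<^sup>2)"
    using assms(2) by (intro integrable_cong_AE_imp[OF L2_integrable[OF assms(1)]]) auto
  ultimately show ?thesis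
    by (simp add: L2_def)
qed

text \<open>Optimise the parameter in \<open>2ab \<le> \<lambda>a\<^sup>2 + b\<^sup>2/\<lambda>\<close>.\<close>

lemma L2_Cauchy_Schwarz:
  assumes f: "f \<in> L2" and g: "g \<in> L2"
  shows "(LINT x|lebesgue. cmod (f x) * cmod (g x)) \<le> L2_norm f * L2_norm g"
proof -
  define A B where "A = L2_norm f" and "B = L2_norm g"
  let ?I = "LINT x|lebesgue. cmod (f x) * cmod (g x)"
  have *: "2 * ?I \<le> l * A\<^sup>2 + B\<^sup>2 / l" if "l > 0" for l
  proof -
    have "2 * ?I = (LINT x|lebesgue. 2 * (cmod (f x) * cmod (g x)))"
      by simp
    also have "\<dots> \<le> (LINT x|lebesgue. l * (cmod (f x))\<^sup>2 + (cmod (g x))\<^sup>2 / l)"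
    proof (rule integral_mono)
      show "2 * (cmod (f x) * cmod (g x)) \<le> l * (cmod (f x))\<^sup>2 + (cmod (g x))\<^sup>2 / l" for x
      proof -
        have "0 \<le> (l * cmod (f x) - cmod (g x))\<^sup>2 / l"
          using \<open>l > 0\<close> by simp
        also have "\<dots> = l * (cmod (f x))\<^sup>2 + (cmod (g x))\<^sup>2 / l - 2 * (cmod (f x) * cmod (g x))"
          using \<open>l > 0\<close> by (simp add: power2_eq_square field_simps)
        finally show ?thesis by simp
      qed
    qed (use f g L2_integrable L2_cmod_mult_integrable in auto)
    also have "\<dots> = l * A\<^sup>2 + B\<^sup>2 / l"
      using f g L2_integrable by (simp add: A_def B_def L2_norm_power2)
    finally show ?thesis .
  qed
  have nonneg: "A \<ge> 0" "B \<ge> 0"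
    by (simp_all add: A_def B_def)
  have "?I \<le> A * B + e" if "e > 0" for e
  proof -
    \<comment> \<open>The optimal parameter is \<open>B / A\<close>. Adding \<open>d\<close> to both
      norms keeps it defined and positive when one of them is zero, at a total cost of
      \<open>d * (A + B)\<close>, which is at most \<open>e\<close>.\<close>
    define d where "d = e / (A + B + 1)"
    have "d > 0"
      using nonneg \<open>e > 0\<close> by (simp add: d_def)
    define l where "l = (B + d) / (A + d)"
    have "l > 0"
      using nonneg \<open>d > 0\<close> by (simp add: l_def add_nonneg_pos)
    have "l * A\<^sup>2 \<le> A * (B + d)"
    proof -
      have "l * A\<^sup>2 = A * (B + d) * (A / (A + d))"
        by (simp add: l_def power2_eq_square)
      also have "\<dots> \<le> A * (B + d) * 1"
        using nonneg \<open>d > 0\<close> by (intro mult_left_mono) auto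
      finally show ?thesis by simp
    qed
    moreover have "B\<^sup>2 / l \<le> B * (A + d)"
    proof -
      have "B\<^sup>2 / l = B * (A + d) * (B / (B + d))"
        by (simp add: l_def power2_eq_square)
      also have "\<dots> \<le> B * (A + d) * 1"
        using nonneg \<open>d > 0\<close> by (intro mult_left_mono) auto
      finally show ?thesis by simp
    qed
    ultimately have "2 * ?I \<le> 2 * (A * B) + d * (A + B)"
      using *[OF \<open>l > 0\<close>] by (simp add: algebra_simps)
    moreover have "d * (A + B) \<le> e"
      using nonneg \<open>e > 0\<close> by (simp add: d_def field_simps)
    ultimately show ?thesis
      using \<open>e > 0\<close> by linarith
  qed
  then show ?thesis
    unfolding A_def B_def by (rule field_le_epsilon)
qed

lemma L2_integral_mult_bound:
  assumes "f \<in> L2" "g \<in> L2"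
  shows "cmod (LINT x|lebesgue. f x * g x) \<le> L2_norm f * L2_norm g"
  using integral_norm_bound[of lebesgue "\<lambda>x. f x * g x"] L2_Cauchy_Schwarz[OF assms]
  by (simp add: norm_mult)

lemma L2_norm_mult_bound:
  assumes "f \<in> L2" "g \<in> borel_measurable lebesgue" "\<And>x. cmod (g x) \<le> C * cmod (f x)" "C \<ge> 0"
  shows "L2_norm g \<le> C * L2_norm f"
proof (rule power2_le_imp_le)
  have "(L2_norm g)\<^sup>2 \<le> (LINT x|lebesgue. C\<^sup>2 * (cmod (f x))\<^sup>2)"
    unfolding L2_norm_power2
    using power_mono[OF assms(3), of _ 2] L2_integrable[OF L2_bound[OF assms(1-3)]] L2_integrable[OF assms(1)]
    by (intro integral_mono) (auto simp: power_mult_distrib)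
  then show "(L2_norm g)\<^sup>2 \<le> (C * L2_norm f)\<^sup>2"
    by (simp add: power_mult_distrib L2_norm_power2)
qed (use assms in simp)

lemma L2_norm_triangle:
  assumes f: "f \<in> L2" and g: "g \<in> L2"
  shows "L2_norm (\<lambda>x. f x + g x) \<le> L2_norm f + L2_norm g"
proof (rule power2_le_imp_le)
  have "(L2_norm (\<lambda>x. f x + g x))\<^sup>2
      \<le> (LINT x|lebesgue. (cmod (f x))\<^sup>2 + (cmod (g x))\<^sup>2 + 2 * (cmod (f x) * cmod (g x)))"
    unfolding L2_norm_power2
  proof (rule integral_mono)
    show "(cmod (f x + g x))\<^sup>2 \<le> (cmod (f x))\<^sup>2 + (cmod (g x))\<^sup>2 + 2 * (cmod (f x) * cmod (g x))" for x
      using power_mono[OF norm_triangle_ineq[of "f x" "g x"], of 2] by (simp add: power2_sum)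
  qed (use f g L2_integrable L2_add L2_cmod_mult_integrable in auto)
  also have "\<dots> = (L2_norm f)\<^sup>2 + (L2_norm g)\<^sup>2 + 2 * (LINT x|lebesgue. cmod (f x) * cmod (g x))"
    using f g L2_integrable L2_cmod_mult_integrable by (simp add: L2_norm_power2)
  also have "\<dots> \<le> (L2_norm f + L2_norm g)\<^sup>2"
    using L2_Cauchy_Schwarz[OF f g] by (simp add: power2_sum)
  finally show "(L2_norm (\<lambda>x. f x + g x))\<^sup>2 \<le> (L2_norm f + L2_norm g)\<^sup>2" .
qed simp

text \<open>By \<open>2ab \<le> a\<^sup>2 + b\<^sup>2\<close>, the right-hand side bounds every
  increment of the squared modulus. If the squared modulus exceeded this bound at \<open>x\<close>,
  it would stay above a positive constant on the half-line to the right of \<open>x\<close>, against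
  its integrability.\<close>

lemma H1_sup_bound:
  assumes ac: "ac_deriv f f'" and f: "f \<in> L2" and f': "f' \<in> L2"
  shows "(cmod (f x))\<^sup>2 \<le> (L2_norm f)\<^sup>2 + (L2_norm f')\<^sup>2"
proof -
  let ?G = "\<lambda>x. f' x * cnj (f x) + f x * cnj (f' x)"
  have ac2: "ac_deriv (\<lambda>x. f x * cnj (f x)) ?G"
    by (intro ac_deriv_mult ac_deriv_cnj ac)
  have G: "integrable lebesgue ?G"
    by (intro Bochner_Integration.integrable_add L2_mult_integrable L2_cnj f f')
  have "(LINT x|lebesgue. cmod (?G x)) \<le> (LINT x|lebesgue. (cmod (f x))\<^sup>2 + (cmod (f' x))\<^sup>2)"
  proof (rule integral_mono)
    fix x
    have "cmod (?G x) \<le> 2 * (cmod (f x) * cmod (f' x))"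
      by (rule order_trans[OF norm_triangle_ineq]) (simp add: norm_mult)
    also have "\<dots> \<le> (cmod (f x))\<^sup>2 + (cmod (f' x))\<^sup>2"
      using sum_squares_bound[of "cmod (f x)" "cmod (f' x)"] by simp
    finally show "cmod (?G x) \<le> (cmod (f x))\<^sup>2 + (cmod (f' x))\<^sup>2" .
  qed (use G f f' L2_integrable in \<open>auto intro: integrable_norm\<close>)
  then have bound: "(LINT x|lebesgue. cmod (?G x)) \<le> (L2_norm f)\<^sup>2 + (L2_norm f')\<^sup>2"
    using f f' L2_integrable by (simp add: L2_norm_power2)
  have "(cmod (f x))\<^sup>2 - ((L2_norm f)\<^sup>2 + (L2_norm f')\<^sup>2) \<le> (cmod (f y))\<^sup>2" if "x \<le> y" for y
  proof -
    have "cmod (f y * cnj (f y) - f x * cnj (f x)) = cmod (LINT s:{x..y}|lebesgue. ?G s)"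
      using set_lebesgue_integral_eq_integral(2)[OF ac_deriv_integrable[OF ac2, of x y]]
        ac_deriv_integral[OF ac2 that] by simp
    also have "\<dots> \<le> (LINT s|lebesgue. cmod (?G s))"
      unfolding set_lebesgue_integral_def
      using ac_deriv_integrable[OF ac2, of x y] G
      by (intro Bochner_Integration.integral_norm_bound_integral) (auto simp: set_integrable_def indicator_def)
    finally have *: "cmod (f y * cnj (f y) - f x * cnj (f x)) \<le> (L2_norm f)\<^sup>2 + (L2_norm f')\<^sup>2"
      using bound by simp
    have eq: "f y * cnj (f y) - f x * cnj (f x) = of_real ((cmod (f y))\<^sup>2 - (cmod (f x))\<^sup>2)"
      by (simp add: complex_norm_square[symmetric] flip: of_real_power)
    have "\<bar>(cmod (f y))\<^sup>2 - (cmod (f x))\<^sup>2\<bar> \<le> (L2_norm f)\<^sup>2 + (L2_norm f')\<^sup>2"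
      using * unfolding eq norm_of_real .
    then show ?thesis
      by linarith
  qed
  then show ?thesis
    using integrable_lower_bound_nonpos[OF L2_integrable[OF f], of x] by fastforce
qed

lemma integral_by_parts_L2:
  assumes ac: "ac_deriv f f'" "ac_deriv g g'" and L2: "f \<in> L2" "f' \<in> L2" "g \<in> L2" "g' \<in> L2"
  shows "(LINT x|lebesgue. f' x * g x) = - (LINT x|lebesgue. f x * g' x)"
proof -
  have "(LINT x|lebesgue. f' x * g x + f x * g' x) = 0"
    using L2 by (intro ac_deriv_integral_zero[OF ac_deriv_mult[OF ac]] L2_mult_integrable
        Bochner_Integration.integrable_add)
  then show ?thesis
    using L2 by (simp add: L2_mult_integrable add_eq_0_iff2)
qed

section \<open>Convergence in the mean and uniform convergence\<close>

text \<open>Membership is part of the notion because \<open>L2_norm\<close> returns 0 on a divergent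
  integral, so small norms alone would prove nothing.\<close>

definition L2_tendsto :: "('a \<Rightarrow> real \<Rightarrow> complex) \<Rightarrow> (real \<Rightarrow> complex) \<Rightarrow> 'a filter \<Rightarrow> bool" where
  "L2_tendsto F f net \<longleftrightarrow> f \<in> L2 \<and> (\<forall>\<^sub>F s in net. F s \<in> L2) \<and>
     ((\<lambda>s. L2_norm (\<lambda>x. F s x - f x)) \<longlongrightarrow> 0) net"

text \<open>Bounded at every point rather than essentially: the multipliers are polynomials in
  continuous representatives, and this matches \<open>uniform_limit\<close>.\<close>

definition Linf :: "(real \<Rightarrow> complex) set" where
  "Linf = {h. h \<in> borel_measurable lebesgue \<and> bounded (range h)}"

definition Linf_tendsto :: "('a \<Rightarrow> real \<Rightarrow> complex) \<Rightarrow> (real \<Rightarrow> complex) \<Rightarrow> 'a filter \<Rightarrow> bool" where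
  "Linf_tendsto H h net \<longleftrightarrow> h \<in> Linf \<and> (\<forall>\<^sub>F s in net. H s \<in> Linf) \<and> uniform_limit UNIV H h net"

lemma LinfE:
  assumes "h \<in> Linf"
  obtains B where "B > 0" "\<And>x. cmod (h x) \<le> B"
  using assms unfolding Linf_def bounded_pos by auto

lemma LinfI: "h \<in> borel_measurable lebesgue \<Longrightarrow> (\<And>x. cmod (h x) \<le> B) \<Longrightarrow> h \<in> Linf"
  unfolding Linf_def bounded_iff by auto

lemma Linf_const: "(\<lambda>x. c) \<in> Linf"
  by (rule LinfI[where B = "cmod c"]) auto

lemma Linf_add: "f \<in> Linf \<Longrightarrow> g \<in> Linf \<Longrightarrow> (\<lambda>x. f x + g x) \<in> Linf"
  by (auto simp: Linf_def intro: bounded_plus_comp)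

lemma Linf_mult:
  assumes "f \<in> Linf" "g \<in> Linf"
  shows "(\<lambda>x. f x * g x) \<in> Linf"
proof -
  obtain A where "A > 0" "\<And>x. cmod (f x) \<le> A" using LinfE[OF assms(1)] by blast
  moreover obtain B where "B > 0" "\<And>x. cmod (g x) \<le> B" using LinfE[OF assms(2)] by blast
  ultimately show ?thesis
    using assms by (intro LinfI[where B = "A * B"]) (auto simp: Linf_def norm_mult intro!: mult_mono)
qed

lemma Linf_cnj: "f \<in> Linf \<Longrightarrow> (\<lambda>x. cnj (f x)) \<in> Linf"
  by (auto simp: Linf_def bounded_iff intro: borel_measurable_cnj)

lemma L2_mult_Linf:
  assumes "h \<in> Linf" "f \<in> L2"
  shows "(\<lambda>x. h x * f x) \<in> L2"
proof -
  obtain B where "B > 0" "\<And>x. cmod (h x) \<le> B" using LinfE[OF assms(1)] by blast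
  then show ?thesis
    using assms L2_measurable[OF assms(2)]
    by (intro L2_bound[OF assms(2), where C = B]) (auto simp: Linf_def norm_mult intro!: mult_right_mono)
qed

lemma L2_mult_Linf': "f \<in> L2 \<Longrightarrow> h \<in> Linf \<Longrightarrow> (\<lambda>x. f x * h x) \<in> L2"
  using L2_mult_Linf[of h f] by (simp add: mult.commute)

lemma Linf_tendsto_const: "h \<in> Linf \<Longrightarrow> Linf_tendsto (\<lambda>s. h) h net"
  by (simp add: Linf_tendsto_def uniform_limit_const)

lemma Linf_tendsto_add:
  assumes "Linf_tendsto F f net" "Linf_tendsto G g net"
  shows "Linf_tendsto (\<lambda>s x. F s x + G s x) (\<lambda>x. f x + g x) net"
  using assms unfolding Linf_tendsto_def
  by (auto intro: uniform_limit_add Linf_add elim: eventually_elim2)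

lemma Linf_tendsto_mult:
  assumes F: "Linf_tendsto F f net" and G: "Linf_tendsto G g net"
  shows "Linf_tendsto (\<lambda>s x. F s x * G s x) (\<lambda>x. f x * g x) net"
  unfolding Linf_tendsto_def
proof (intro conjI)
  show "(\<lambda>x. f x * g x) \<in> Linf"
    using F G unfolding Linf_tendsto_def by (blast intro: Linf_mult)
  have "\<forall>\<^sub>F s in net. F s \<in> Linf" "\<forall>\<^sub>F s in net. G s \<in> Linf"
    using F G unfolding Linf_tendsto_def by blast+
  then show "\<forall>\<^sub>F s in net. (\<lambda>x. F s x * G s x) \<in> Linf"
    by eventually_elim (rule Linf_mult)
  show "uniform_limit UNIV (\<lambda>s x. F s x * G s x) (\<lambda>x. f x * g x) net"
    using F G by (intro uniform_lim_mult) (auto simp: Linf_tendsto_def Linf_def)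
qed

lemma Linf_tendsto_cnj:
  assumes "Linf_tendsto F f net"
  shows "Linf_tendsto (\<lambda>s x. cnj (F s x)) (\<lambda>x. cnj (f x)) net"
  using assms unfolding Linf_tendsto_def
  by (auto intro: bounded_linear.uniform_limit[OF bounded_linear_cnj] Linf_cnj elim: eventually_mono)

lemma L2_tendsto_const: "f \<in> L2 \<Longrightarrow> L2_tendsto (\<lambda>s. f) f net"
  by (simp add: L2_tendsto_def L2_norm_def)

lemma L2_tendsto_add:
  assumes F: "L2_tendsto F f net" and G: "L2_tendsto G g net"
  shows "L2_tendsto (\<lambda>s x. F s x + G s x) (\<lambda>x. f x + g x) net"
  unfolding L2_tendsto_def
proof (intro conjI)
  have ev: "\<forall>\<^sub>F s in net. F s \<in> L2" "\<forall>\<^sub>F s in net. G s \<in> L2" and L2: "f \<in> L2" "g \<in> L2"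
    using F G by (auto simp: L2_tendsto_def)
  show "(\<lambda>x. f x + g x) \<in> L2"
    by (intro L2_add L2)
  show "\<forall>\<^sub>F s in net. (\<lambda>x. F s x + G s x) \<in> L2"
    using ev by eventually_elim (rule L2_add)
  have lim: "((\<lambda>s. L2_norm (\<lambda>x. F s x - f x) + L2_norm (\<lambda>x. G s x - g x)) \<longlongrightarrow> 0) net"
    using tendsto_add[of _ 0 net _ 0] F G by (auto simp: L2_tendsto_def)
  have le: "\<forall>\<^sub>F s in net. L2_norm (\<lambda>x. F s x + G s x - (f x + g x))
      \<le> L2_norm (\<lambda>x. F s x - f x) + L2_norm (\<lambda>x. G s x - g x)"
    using ev
  proof eventually_elim
    case (elim s)
    then show ?case
      using L2_norm_triangle[OF L2_diff[of "F s" f] L2_diff[of "G s" g]] L2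
      by (simp add: algebra_simps)
  qed
  show "((\<lambda>s. L2_norm (\<lambda>x. F s x + G s x - (f x + g x))) \<longlongrightarrow> 0) net"
    by (rule tendsto_sandwich[OF _ le tendsto_const lim]) simp
qed

lemma L2_tendsto_cnj:
  assumes "L2_tendsto F f net"
  shows "L2_tendsto (\<lambda>s x. cnj (F s x)) (\<lambda>x. cnj (f x)) net"
proof -
  have "L2_norm (\<lambda>x. cnj (F s x) - cnj (f x)) = L2_norm (\<lambda>x. F s x - f x)" for s
    using L2_norm_cnj[of "\<lambda>x. F s x - f x"] by simp
  moreover have "\<forall>\<^sub>F s in net. (\<lambda>x. cnj (F s x)) \<in> L2"
    using assms unfolding L2_tendsto_def by (auto intro: L2_cnj elim: eventually_mono)
  ultimately show ?thesis
    using assms unfolding L2_tendsto_def by (simp add: L2_cnj)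
qed

text \<open>Split the difference of the products as \<open>H s * (F s - f) + (H s - h) * f\<close>:
  a uniformly bounded multiplier times a small L2 function, plus a uniformly small multiplier times
  a fixed one.\<close>

lemma L2_tendsto_mult:
  assumes H: "Linf_tendsto H h net" and F: "L2_tendsto F f net"
  shows "L2_tendsto (\<lambda>s x. H s x * F s x) (\<lambda>x. h x * f x) net"
  unfolding L2_tendsto_def
proof (intro conjI)
  have ev: "\<forall>\<^sub>F s in net. F s \<in> L2" "\<forall>\<^sub>F s in net. H s \<in> Linf" and f: "f \<in> L2" and h: "h \<in> Linf"
    and lim: "((\<lambda>s. L2_norm (\<lambda>x. F s x - f x)) \<longlongrightarrow> 0) net" and u: "uniform_limit UNIV H h net"
    using F H by (auto simp: L2_tendsto_def Linf_tendsto_def)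
  show "(\<lambda>x. h x * f x) \<in> L2"
    by (intro L2_mult_Linf f h)
  show "\<forall>\<^sub>F s in net. (\<lambda>x. H s x * F s x) \<in> L2"
    using ev by eventually_elim (rule L2_mult_Linf)
  obtain B where "B > 0" and B: "\<And>x. cmod (h x) \<le> B"
    using LinfE[OF h] by blast
  have lim1: "((\<lambda>s. (B + 1) * L2_norm (\<lambda>x. F s x - f x)) \<longlongrightarrow> 0) net"
    using tendsto_mult_left[OF lim, of "B + 1"] by simp
  show "((\<lambda>s. L2_norm (\<lambda>x. H s x * F s x - h x * f x)) \<longlongrightarrow> 0) net"
  proof (rule tendstoI)
    fix e :: real assume "e > 0"
    \<comment> \<open>The bound 1 gives \<open>B + 1\<close> as a common bound for
      \<open>H s\<close>; the other entry makes \<open>d * L2_norm f\<close> less than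
      \<open>e / 2\<close>, with \<open>+ 1\<close> guarding against a zero norm.\<close>
    define d where "d = min 1 (e / (2 * (L2_norm f + 1)))"
    have "d > 0"
      using \<open>e > 0\<close> by (simp add: d_def add_nonneg_pos)
    have "d * L2_norm f \<le> e / (2 * (L2_norm f + 1)) * L2_norm f"
      by (intro mult_right_mono) (auto simp: d_def)
    also have "\<dots> = e / 2 * (L2_norm f / (L2_norm f + 1))"
      by simp
    also have "\<dots> < e / 2 * 1"
      using \<open>e > 0\<close> by (intro mult_strict_left_mono) (simp_all add: add_nonneg_pos)
    also have "\<dots> = e / 2"
      by simp
    finally have d: "d * L2_norm f < e / 2" .
    have "\<forall>\<^sub>F s in net. (B + 1) * L2_norm (\<lambda>x. F s x - f x) < e / 2"
      using \<open>e > 0\<close> by (intro order_tendstoD(2)[OF lim1]) simp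
    then show "\<forall>\<^sub>F s in net. dist (L2_norm (\<lambda>x. H s x * F s x - h x * f x)) 0 < e"
      using ev uniform_limitD[OF u \<open>d > 0\<close>]
    proof eventually_elim
      case (elim s)
      have H: "cmod (H s x - h x) \<le> d" for x
        using elim(4) by (simp add: dist_norm less_imp_le)
      have "cmod (H s x) \<le> B + 1" for x
        using norm_triangle_sub[of "H s x" "h x"] H[of x] B[of x] d_def by linarith
      then have 1: "L2_norm (\<lambda>x. H s x * (F s x - f x)) \<le> (B + 1) * L2_norm (\<lambda>x. F s x - f x)"
        using elim f \<open>B > 0\<close> L2_measurable[OF L2_diff[of "F s" f]]
        by (intro L2_norm_mult_bound L2_diff) (auto simp: Linf_def norm_mult intro!: mult_right_mono)
      have 2: "L2_norm (\<lambda>x. (H s x - h x) * f x) \<le> d * L2_norm f"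
        using elim f h \<open>d > 0\<close> L2_measurable[OF f] H
        by (intro L2_norm_mult_bound) (auto simp: Linf_def norm_mult intro!: mult_right_mono)
      have "(\<lambda>x. H s x - h x) \<in> Linf"
        using Linf_add[OF elim(3) Linf_mult[OF Linf_const[of "-1"] h]] by simp
      then have "L2_norm (\<lambda>x. H s x * (F s x - f x) + (H s x - h x) * f x)
          \<le> L2_norm (\<lambda>x. H s x * (F s x - f x)) + L2_norm (\<lambda>x. (H s x - h x) * f x)"
        using elim f by (intro L2_norm_triangle L2_mult_Linf L2_diff)
      then show ?case
        using 1 2 d elim(1) by (simp add: algebra_simps)
    qed
  qed
qed

lemma L2_tendsto_scale: "L2_tendsto F f net \<Longrightarrow> L2_tendsto (\<lambda>s x. c * F s x) (\<lambda>x. c * f x) net"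
  by (rule L2_tendsto_mult[OF Linf_tendsto_const[OF Linf_const]])

lemma L2_tendsto_diff:
  assumes "L2_tendsto F f net" "L2_tendsto G g net"
  shows "L2_tendsto (\<lambda>s x. F s x - G s x) (\<lambda>x. f x - g x) net"
  using L2_tendsto_add[OF assms(1) L2_tendsto_scale[OF assms(2), of "-1"]] by simp

lemma L2_tendsto_mult':
  assumes "L2_tendsto F f net" "Linf_tendsto H h net"
  shows "L2_tendsto (\<lambda>s x. F s x * H s x) (\<lambda>x. f x * h x) net"
  using L2_tendsto_mult[OF assms(2,1)] by (simp add: mult.commute)

lemma L2_tendsto_norm:
  assumes "L2_tendsto F f net"
  shows "((\<lambda>s. L2_norm (F s)) \<longlongrightarrow> L2_norm f) net"
proof (rule Lim_transform2)
  have lim: "((\<lambda>s. L2_norm (\<lambda>x. F s x - f x)) \<longlongrightarrow> 0) net" and f: "f \<in> L2"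
    and ev: "\<forall>\<^sub>F s in net. F s \<in> L2"
    using assms by (auto simp: L2_tendsto_def)
  have "\<forall>\<^sub>F s in net. norm (L2_norm f - L2_norm (F s)) \<le> norm (L2_norm (\<lambda>x. F s x - f x)) * 1"
    using ev
  proof eventually_elim
    case (elim s)
    have "L2_norm (\<lambda>x. (F s x - f x) + f x) \<le> L2_norm (\<lambda>x. F s x - f x) + L2_norm f"
      using elim f by (intro L2_norm_triangle L2_diff)
    moreover have "L2_norm (\<lambda>x. (f x - F s x) + F s x) \<le> L2_norm (\<lambda>x. f x - F s x) + L2_norm (F s)"
      using elim f by (intro L2_norm_triangle L2_diff)
    moreover have "L2_norm (\<lambda>x. f x - F s x) = L2_norm (\<lambda>x. F s x - f x)"
      by (simp add: L2_norm_def norm_minus_commute)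
    ultimately show ?case
      by simp
  qed
  then show "((\<lambda>s. L2_norm f - L2_norm (F s)) \<longlongrightarrow> 0) net"
    by (rule tendsto_0_le[OF lim])
qed (rule tendsto_const)

lemma L2_tendsto_integral:
  assumes F: "L2_tendsto F f net" and H: "L2_tendsto H h net"
  shows "((\<lambda>s. LINT x|lebesgue. F s x * H s x) \<longlongrightarrow> (LINT x|lebesgue. f x * h x)) net"
proof (rule Lim_transform2)
  have L2: "f \<in> L2" "h \<in> L2" and ev: "\<forall>\<^sub>F s in net. F s \<in> L2" "\<forall>\<^sub>F s in net. H s \<in> L2"
    using F H by (auto simp: L2_tendsto_def)
  have "((\<lambda>s. L2_norm (\<lambda>x. F s x - f x) * L2_norm (H s) + L2_norm f * L2_norm (\<lambda>x. H s x - h x))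
      \<longlongrightarrow> 0 * L2_norm h + L2_norm f * 0) net"
    using F H by (intro tendsto_intros L2_tendsto_norm) (auto simp: L2_tendsto_def)
  then have lim: "((\<lambda>s. L2_norm (\<lambda>x. F s x - f x) * L2_norm (H s) + L2_norm f * L2_norm (\<lambda>x. H s x - h x))
      \<longlongrightarrow> 0) net"
    by simp
  have "\<forall>\<^sub>F s in net. norm ((LINT x|lebesgue. f x * h x) - (LINT x|lebesgue. F s x * H s x))
      \<le> norm (L2_norm (\<lambda>x. F s x - f x) * L2_norm (H s) + L2_norm f * L2_norm (\<lambda>x. H s x - h x)) * 1"
    using ev
  proof eventually_elim
    case (elim s)
    have i: "integrable lebesgue (\<lambda>x. (F s x - f x) * H s x)" "integrable lebesgue (\<lambda>x. f x * (H s x - h x))"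
      using elim L2 by (auto intro: L2_mult_integrable L2_diff)
    have "(LINT x|lebesgue. F s x * H s x) - (LINT x|lebesgue. f x * h x)
        = (LINT x|lebesgue. F s x * H s x - f x * h x)"
      using elim L2 by (simp add: L2_mult_integrable)
    also have "\<dots> = (LINT x|lebesgue. (F s x - f x) * H s x + f x * (H s x - h x))"
      by (intro Bochner_Integration.integral_cong) (simp_all add: algebra_simps)
    also have "\<dots> = (LINT x|lebesgue. (F s x - f x) * H s x) + (LINT x|lebesgue. f x * (H s x - h x))"
      using i by (rule Bochner_Integration.integral_add)
    finally have "norm ((LINT x|lebesgue. F s x * H s x) - (LINT x|lebesgue. f x * h x))
        \<le> L2_norm (\<lambda>x. F s x - f x) * L2_norm (H s) + L2_norm f * L2_norm (\<lambda>x. H s x - h x)"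
      using L2_integral_mult_bound[OF L2_diff[OF elim(1) L2(1)] elim(2)]
        L2_integral_mult_bound[OF L2(1) L2_diff[OF elim(2) L2(2)]]
      by (simp only:) (rule order_trans[OF norm_triangle_ineq], rule add_mono)
    then show ?case
      by (simp add: norm_minus_commute)
  qed
  then show "((\<lambda>s. (LINT x|lebesgue. f x * h x) - (LINT x|lebesgue. F s x * H s x)) \<longlongrightarrow> 0) net"
    by (rule tendsto_0_le[OF lim])
qed (rule tendsto_const)

section \<open>Conservation laws\<close>

lemma ac_deriv_integral_zero_AE:
  assumes "ac_deriv F F'" "integrable lebesgue F" "integrable lebesgue G" "AE x in lebesgue. F' x = G x"
  shows "(LINT x|lebesgue. G x) = 0"
  using ac_deriv_integral_zero[OF ac_deriv_cong_AE[OF assms(1,4)] assms(2,3)] .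

lemma difference_quotient_tendsto:
  fixes \<Phi> :: "real \<Rightarrow> complex"
  assumes "\<forall>\<^sub>F s in at t. \<Phi> s - \<Phi> t = of_real (s - t) * \<Psi> s" "(\<Psi> \<longlongrightarrow> D) (at t)"
  shows "((\<lambda>s. Re (\<Phi> s)) has_real_derivative Re D) (at t)"
    and "((\<lambda>s. Im (\<Phi> s)) has_real_derivative Im D) (at t)"
proof -
  have ev: "\<forall>\<^sub>F s in at t. \<Psi> s = (\<Phi> s - \<Phi> t) / of_real (s - t)"
    using assms(1) eventually_neq_at_within[of t t UNIV] by eventually_elim simp
  have *: "((\<lambda>s. (\<Phi> s - \<Phi> t) / of_real (s - t)) \<longlongrightarrow> D) (at t)"
    by (rule Lim_transform_eventually[OF assms(2) ev])
  show "((\<lambda>s. Re (\<Phi> s)) has_real_derivative Re D) (at t)"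
    unfolding has_field_derivative_iff using tendsto_Re[OF *] by simp
  show "((\<lambda>s. Im (\<Phi> s)) has_real_derivative Im D) (at t)"
    unfolding has_field_derivative_iff using tendsto_Im[OF *] by simp
qed

text \<open>\<open>U t\<close>, \<open>V t\<close>, \<open>Z t\<close> are representatives of \<open>u\<close>, \<open>u\<^sub>x\<close>, \<open>u\<^sub>x\<^sub>x\<close> at time \<open>t\<close>, and \<open>ut t\<close> of \<open>u\<^sub>t\<close>.\<close>

locale dnls =
  fixes q :: real and I :: "real set" and U V Z ut :: "real \<Rightarrow> real \<Rightarrow> complex"
  assumes open_I: "open I" and conv_I: "convex I"
    and ac_U: "t \<in> I \<Longrightarrow> ac_deriv (U t) (V t)"
    and ac_V: "t \<in> I \<Longrightarrow> ac_deriv (V t) (Z t)"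
    and L2_W: "t \<in> I \<Longrightarrow> (\<lambda>x. U t x - of_real q) \<in> L2"
    and L2_V: "t \<in> I \<Longrightarrow> V t \<in> L2"
    and L2_Z: "t \<in> I \<Longrightarrow> Z t \<in> L2"
    and L2_ut: "t \<in> I \<Longrightarrow> ut t \<in> L2"
    and norm_U: "t \<in> I \<Longrightarrow> ((\<lambda>s. L2_norm (\<lambda>x. U s x - U t x)) \<longlongrightarrow> 0) (at t)"
    and norm_V: "t \<in> I \<Longrightarrow> ((\<lambda>s. L2_norm (\<lambda>x. V s x - V t x)) \<longlongrightarrow> 0) (at t)"
    and norm_Z: "t \<in> I \<Longrightarrow> ((\<lambda>s. L2_norm (\<lambda>x. Z s x - Z t x)) \<longlongrightarrow> 0) (at t)"
    and norm_ut: "t \<in> I \<Longrightarrow>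
      ((\<lambda>s. L2_norm (\<lambda>x. (U s x - U t x) / of_real (s - t) - ut t x)) \<longlongrightarrow> 0) (at t)"
    and eq: "t \<in> I \<Longrightarrow> AE x in lebesgue. ut t x = \<i> * Z t x - (U t x)\<^sup>2 * cnj (V t x)"
begin

section \<open>Densities, difference quotients and their limits\<close>

abbreviation a :: complex where "a \<equiv> of_real q"

definition \<rho> :: "real \<Rightarrow> real \<Rightarrow> complex" where
  "\<rho> t x = U t x * cnj (U t x)"

definition quot :: "real \<Rightarrow> real \<Rightarrow> real \<Rightarrow> complex" where
  "quot t s x = (U s x - U t x) / of_real (s - t)"

definition \<rho>t :: "real \<Rightarrow> real \<Rightarrow> complex" where
  "\<rho>t t x = ut t x * cnj (U t x) + U t x * cnj (ut t x)"

lemma near: "t \<in> I \<Longrightarrow> \<forall>\<^sub>F s in at t. s \<in> I \<and> s \<noteq> t"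
  using open_I by (auto intro!: eventually_conj eventually_at_in_open' eventually_neq_at_within)

lemma near_I: "t \<in> I \<Longrightarrow> \<forall>\<^sub>F s in at t. s \<in> I"
  by (rule eventually_mono[OF near]) simp_all

lemma near_mono: "t \<in> I \<Longrightarrow> (\<And>s. s \<in> I \<Longrightarrow> P s) \<Longrightarrow> \<forall>\<^sub>F s in at t. P s"
  by (rule eventually_mono[OF near_I])

lemma L2_diff_U: "s \<in> I \<Longrightarrow> t \<in> I \<Longrightarrow> (\<lambda>x. U s x - U t x) \<in> L2"
  using L2_diff[OF L2_W L2_W, of s t] by simp

lemma quot: "s \<noteq> t \<Longrightarrow> U s x - U t x = of_real (s - t) * quot t s x"
  by (simp add: quot_def)

lemma L2_quot: "s \<in> I \<Longrightarrow> t \<in> I \<Longrightarrow> quot t s \<in> L2"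
  using L2_scale[OF L2_diff_U, of s t "1 / of_real (s - t)"] by (simp add: quot_def[abs_def])

lemma W_tendsto: "t \<in> I \<Longrightarrow> L2_tendsto (\<lambda>s x. U s x - a) (\<lambda>x. U t x - a) (at t)"
  unfolding L2_tendsto_def by (intro conjI near_mono) (simp_all add: L2_W norm_U)

lemma V_tendsto: "t \<in> I \<Longrightarrow> L2_tendsto V (V t) (at t)"
  unfolding L2_tendsto_def by (intro conjI near_mono) (simp_all add: L2_V norm_V)

lemma Z_tendsto: "t \<in> I \<Longrightarrow> L2_tendsto Z (Z t) (at t)"
  unfolding L2_tendsto_def by (intro conjI near_mono) (simp_all add: L2_Z norm_Z)

lemma quot_tendsto: "t \<in> I \<Longrightarrow> L2_tendsto (quot t) (ut t) (at t)"
  unfolding L2_tendsto_def by (intro conjI near_mono L2_ut L2_quot norm_ut[folded quot_def])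

lemma ac_W: "t \<in> I \<Longrightarrow> ac_deriv (\<lambda>x. U t x - a) (V t)"
  using ac_deriv_diff[OF ac_U ac_deriv_const[of a]] by simp

lemma U_Linf:
  assumes t: "t \<in> I"
  shows "U t \<in> Linf"
proof -
  have "(\<lambda>x. U t x - a) \<in> Linf"
  proof (rule LinfI)
    show "(\<lambda>x. U t x - a) \<in> borel_measurable lebesgue"
      using L2_measurable[OF L2_W[OF t]] .
    show "cmod (U t x - a) \<le> sqrt ((L2_norm (\<lambda>x. U t x - a))\<^sup>2 + (L2_norm (V t))\<^sup>2)" for x
      using H1_sup_bound[OF ac_W[OF t] L2_W[OF t] L2_V[OF t]] by (rule real_le_rsqrt)
  qed
  from Linf_add[OF this Linf_const[of a]] show ?thesis
    by simp
qed

text \<open>The supremum bound, applied to the increments in time, upgrades H1 continuity to uniform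
  convergence, so polynomials in \<open>u\<close> are admissible multipliers of L2
  convergence.\<close>

lemma U_tendsto:
  assumes t: "t \<in> I"
  shows "Linf_tendsto U (U t) (at t)"
  unfolding Linf_tendsto_def
proof (intro conjI)
  show "U t \<in> Linf"
    using U_Linf[OF t] .
  show "\<forall>\<^sub>F s in at t. U s \<in> Linf"
    using near_I[OF t] by eventually_elim (rule U_Linf)
  show "uniform_limit UNIV U (U t) (at t)"
  proof (rule uniform_limitI)
    fix e :: real assume "e > 0"
    have "((\<lambda>s. L2_norm (\<lambda>x. U s x - U t x) + L2_norm (\<lambda>x. V s x - V t x)) \<longlongrightarrow> 0) (at t)"
      using tendsto_add[OF norm_U[OF t] norm_V[OF t]] by simp
    then have "\<forall>\<^sub>F s in at t. L2_norm (\<lambda>x. U s x - U t x) + L2_norm (\<lambda>x. V s x - V t x) < e"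
      using \<open>e > 0\<close> by (rule order_tendstoD)
    then show "\<forall>\<^sub>F s in at t. \<forall>x\<in>UNIV. dist (U s x) (U t x) < e"
      using near_I[OF t]
    proof eventually_elim
      case (elim s)
      show ?case
      proof
        fix x
        have "(cmod (U s x - U t x))\<^sup>2 \<le> (L2_norm (\<lambda>x. U s x - U t x))\<^sup>2 + (L2_norm (\<lambda>x. V s x - V t x))\<^sup>2"
          using elim(2) t by (intro H1_sup_bound ac_deriv_diff ac_U L2_diff_U L2_diff L2_V)
        also have "\<dots> \<le> (L2_norm (\<lambda>x. U s x - U t x) + L2_norm (\<lambda>x. V s x - V t x))\<^sup>2"
          by (simp add: power2_sum)
        finally have "cmod (U s x - U t x) \<le> L2_norm (\<lambda>x. U s x - U t x) + L2_norm (\<lambda>x. V s x - V t x)"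
          by (rule power2_le_imp_le) simp
        then show "dist (U s x) (U t x) < e"
          using elim(1) by (simp add: dist_norm)
      qed
    qed
  qed
qed

lemmas Linf_intros = Linf_const Linf_add Linf_mult Linf_cnj U_Linf
lemma \<rho>_Linf: "t \<in> I \<Longrightarrow> \<rho> t \<in> Linf"
  unfolding \<rho>_def[abs_def] by (intro Linf_mult Linf_cnj U_Linf)

lemma \<rho>_tendsto_Linf: "t \<in> I \<Longrightarrow> Linf_tendsto \<rho> (\<rho> t) (at t)"
  unfolding \<rho>_def[abs_def] by (intro Linf_tendsto_mult Linf_tendsto_cnj U_tendsto)

text \<open>Exhibits the density as a sum of bounded functions times \<open>U t - a\<close> or its
  conjugate. Membership in L2 and convergence in L2 are both read off from this form.\<close>

lemma r_eq: "\<rho> t x - a\<^sup>2 = (U t x - a) * cnj (U t x) + a * cnj (U t x - a)"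
  by (simp add: \<rho>_def algebra_simps power2_eq_square)

lemma r_L2: "t \<in> I \<Longrightarrow> (\<lambda>x. \<rho> t x - a\<^sup>2) \<in> L2"
  unfolding r_eq by (intro L2_add L2_mult_Linf' L2_mult_Linf L2_cnj L2_W Linf_cnj U_Linf Linf_const)

lemma r_tendsto: "t \<in> I \<Longrightarrow> L2_tendsto (\<lambda>s x. \<rho> s x - a\<^sup>2) (\<lambda>x. \<rho> t x - a\<^sup>2) (at t)"
  unfolding r_eq
  by (intro L2_tendsto_add L2_tendsto_mult' L2_tendsto_scale L2_tendsto_cnj W_tendsto
      Linf_tendsto_cnj U_tendsto)

lemma ac_\<rho>: "t \<in> I \<Longrightarrow> ac_deriv (\<rho> t) (\<lambda>x. V t x * cnj (U t x) + U t x * cnj (V t x))"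
  unfolding \<rho>_def[abs_def] by (intro ac_deriv_mult ac_deriv_cnj ac_U)

lemma ac_r: "t \<in> I \<Longrightarrow> ac_deriv (\<lambda>x. \<rho> t x - a\<^sup>2) (\<lambda>x. V t x * cnj (U t x) + U t x * cnj (V t x))"
  using ac_deriv_diff[OF ac_\<rho> ac_deriv_const[of "a\<^sup>2"]] by simp

lemma \<rho>t_L2: "t \<in> I \<Longrightarrow> \<rho>t t \<in> L2"
  unfolding \<rho>t_def[abs_def] by (intro L2_add L2_mult_Linf L2_mult_Linf' L2_ut L2_cnj Linf_cnj U_Linf)

lemma \<rho>_quot_tendsto:
  assumes t: "t \<in> I"
  shows "L2_tendsto (\<lambda>s x. quot t s x * cnj (U s x) + U t x * cnj (quot t s x)) (\<rho>t t) (at t)"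
  unfolding \<rho>t_def[abs_def]
  by (intro L2_tendsto_add L2_tendsto_mult' L2_tendsto_mult L2_tendsto_cnj quot_tendsto
      Linf_tendsto_cnj U_tendsto Linf_tendsto_const U_Linf t)

lemma \<rho>_quot: "s \<noteq> t \<Longrightarrow>
    \<rho> s x - \<rho> t x = of_real (s - t) * (quot t s x * cnj (U s x) + U t x * cnj (quot t s x))"
proof -
  assume "s \<noteq> t"
  have "\<rho> s x - \<rho> t x = (U s x - U t x) * cnj (U s x) + U t x * cnj (U s x - U t x)"
    by (simp add: \<rho>_def algebra_simps)
  also have "\<dots> = of_real (s - t) * (quot t s x * cnj (U s x) + U t x * cnj (quot t s x))"
    unfolding quot[OF \<open>s \<noteq> t\<close>] by (simp add: algebra_simps)
  finally show ?thesis .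
qed

text \<open>Every functional whose integrand is a polynomial in the density \<open>\<rho>\<close> is handled by
  factoring the increment of \<open>\<rho>\<close> out of the increment of the integrand.\<close>

lemma density_functional:
  assumes t: "t \<in> I"
    and int: "\<And>s. s \<in> I \<Longrightarrow> integrable lebesgue (f s)"
    and diff: "\<And>s x. s \<in> I \<Longrightarrow> f s x - f t x = (\<rho> s x - \<rho> t x) * m s x"
    and m: "L2_tendsto m mt (at t)"
  shows "\<forall>\<^sub>F s in at t. (LINT x|lebesgue. f s x) - (LINT x|lebesgue. f t x) = of_real (s - t) *
      (LINT x|lebesgue. (quot t s x * cnj (U s x) + U t x * cnj (quot t s x)) * m s x)"
    and "((\<lambda>s. LINT x|lebesgue. (quot t s x * cnj (U s x) + U t x * cnj (quot t s x)) * m s x)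
      \<longlongrightarrow> (LINT x|lebesgue. \<rho>t t x * mt x)) (at t)"
proof -
  show "\<forall>\<^sub>F s in at t. (LINT x|lebesgue. f s x) - (LINT x|lebesgue. f t x) = of_real (s - t) *
      (LINT x|lebesgue. (quot t s x * cnj (U s x) + U t x * cnj (quot t s x)) * m s x)"
    using near[OF t]
  proof eventually_elim
    case (elim s)
    then have s: "s \<in> I" "s \<noteq> t"
      by auto
    then have "(LINT x|lebesgue. f s x) - (LINT x|lebesgue. f t x) = (LINT x|lebesgue. f s x - f t x)"
      using int t by simp
    also have "\<dots> = (LINT x|lebesgue. of_real (s - t) *
        ((quot t s x * cnj (U s x) + U t x * cnj (quot t s x)) * m s x))"
      by (simp only: diff[OF s(1)] \<rho>_quot[OF s(2)] mult.assoc)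
    finally show ?case
      by (simp only: integral_mult_right_zero)
  qed
  show "((\<lambda>s. LINT x|lebesgue. (quot t s x * cnj (U s x) + U t x * cnj (quot t s x)) * m s x)
      \<longlongrightarrow> (LINT x|lebesgue. \<rho>t t x * mt x)) (at t)"
    by (intro L2_tendsto_integral \<rho>_quot_tendsto m t)
qed

section \<open>Time derivatives of the functionals that contain x-derivatives\<close>

definition gradient_energy :: "real \<Rightarrow> complex" where
  "gradient_energy t = (LINT x|lebesgue. V t x * cnj (V t x))"

text \<open>The increment of \<open>V\<close> divided by \<open>s - t\<close> need not converge in
  L2. Integration by parts moves the x-derivative to the other factor, leaving the quotient of
  \<open>U\<close> paired with \<open>Z\<close>, at time \<open>s\<close> in one term and at time
  \<open>t\<close> in the other.\<close>

lemma gradient_energy_deriv: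
  assumes t: "t \<in> I"
  shows "((\<lambda>s. Re (gradient_energy s)) has_real_derivative
    Re (- (LINT x|lebesgue. ut t x * cnj (Z t x)) - (LINT x|lebesgue. Z t x * cnj (ut t x)))) (at t)"
proof (rule difference_quotient_tendsto(1))
  let ?\<Psi> = "\<lambda>s. - (LINT x|lebesgue. quot t s x * cnj (Z s x)) - (LINT x|lebesgue. Z t x * cnj (quot t s x))"
  show "\<forall>\<^sub>F s in at t. gradient_energy s - gradient_energy t = of_real (s - t) * ?\<Psi> s"
    using near[OF t]
  proof eventually_elim
    case (elim s)
    then have s: "s \<in> I" "s \<noteq> t"
      by auto
    have "gradient_energy s - gradient_energy t = (LINT x|lebesgue. V s x * cnj (V s x) - V t x * cnj (V t x))"
      unfolding gradient_energy_def using s t L2_V by (simp add: L2_mult_integrable L2_cnj)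
    also have "\<dots> = (LINT x|lebesgue. (V s x - V t x) * cnj (V s x) + V t x * cnj (V s x - V t x))"
      by (simp add: algebra_simps)
    also have "\<dots> = (LINT x|lebesgue. (V s x - V t x) * cnj (V s x)) + (LINT x|lebesgue. V t x * cnj (V s x - V t x))"
      using s t by (intro Bochner_Integration.integral_add L2_mult_integrable L2_diff L2_cnj L2_V)
    also have "(LINT x|lebesgue. (V s x - V t x) * cnj (V s x)) = - (LINT x|lebesgue. (U s x - U t x) * cnj (Z s x))"
      using s t by (intro integral_by_parts_L2 ac_deriv_diff ac_deriv_cnj ac_U ac_V L2_diff_U L2_diff L2_cnj L2_V L2_Z)
    also have "(LINT x|lebesgue. V t x * cnj (V s x - V t x)) = - (LINT x|lebesgue. Z t x * cnj (U s x - U t x))"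
      using s t by (subst integral_by_parts_L2[of "V t" "Z t" "\<lambda>x. cnj (U s x - U t x)" "\<lambda>x. cnj (V s x - V t x)"])
        (intro ac_deriv_diff ac_deriv_cnj ac_U ac_V L2_diff_U L2_diff L2_cnj L2_V L2_Z | simp)+
    also have "- (LINT x|lebesgue. (U s x - U t x) * cnj (Z s x)) + - (LINT x|lebesgue. Z t x * cnj (U s x - U t x))
        = - (LINT x|lebesgue. of_real (s - t) * (quot t s x * cnj (Z s x)))
          - (LINT x|lebesgue. of_real (s - t) * (Z t x * cnj (quot t s x)))"
      unfolding quot[OF s(2)] by (simp add: mult.left_commute mult.assoc)
    also have "\<dots> = of_real (s - t) * ?\<Psi> s"
      unfolding integral_mult_right_zero by (simp add: algebra_simps)
    finally show ?case .
  qed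
  show "(?\<Psi> \<longlongrightarrow> - (LINT x|lebesgue. ut t x * cnj (Z t x)) - (LINT x|lebesgue. Z t x * cnj (ut t x))) (at t)"
    by (intro tendsto_intros L2_tendsto_integral quot_tendsto L2_tendsto_cnj Z_tendsto L2_tendsto_const L2_Z t)
qed

definition bilinear_momentum :: "real \<Rightarrow> complex" where
  "bilinear_momentum t = (LINT x|lebesgue. (U t x - a) * cnj (V t x))"

text \<open>Only the increment of \<open>cnj V\<close> has to be integrated by parts; its
  x-derivative falls on \<open>U t - a\<close>, which explains the antisymmetric form of the
  result.\<close>

lemma bilinear_momentum_deriv:
  assumes t: "t \<in> I"
  shows "((\<lambda>s. Im (bilinear_momentum s)) has_real_derivative
    Im ((LINT x|lebesgue. ut t x * cnj (V t x)) - (LINT x|lebesgue. V t x * cnj (ut t x)))) (at t)"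
proof (rule difference_quotient_tendsto(2))
  let ?\<Psi> = "\<lambda>s. (LINT x|lebesgue. quot t s x * cnj (V s x)) - (LINT x|lebesgue. V t x * cnj (quot t s x))"
  show "\<forall>\<^sub>F s in at t. bilinear_momentum s - bilinear_momentum t = of_real (s - t) * ?\<Psi> s"
    using near[OF t]
  proof eventually_elim
    case (elim s)
    then have s: "s \<in> I" "s \<noteq> t"
      by auto
    have "bilinear_momentum s - bilinear_momentum t
        = (LINT x|lebesgue. (U s x - a) * cnj (V s x) - (U t x - a) * cnj (V t x))"
      unfolding bilinear_momentum_def using s t L2_V L2_W by (simp add: L2_mult_integrable L2_cnj)
    also have "\<dots> = (LINT x|lebesgue. (U s x - U t x) * cnj (V s x) + (U t x - a) * cnj (V s x - V t x))"
      by (simp add: algebra_simps)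
    also have "\<dots> = (LINT x|lebesgue. (U s x - U t x) * cnj (V s x)) + (LINT x|lebesgue. (U t x - a) * cnj (V s x - V t x))"
      using s t by (intro Bochner_Integration.integral_add L2_mult_integrable L2_diff_U L2_diff L2_cnj L2_V L2_W)
    also have "(LINT x|lebesgue. (U t x - a) * cnj (V s x - V t x)) = - (LINT x|lebesgue. V t x * cnj (U s x - U t x))"
      using s t by (subst integral_by_parts_L2[of "\<lambda>x. U t x - a" "V t" "\<lambda>x. cnj (U s x - U t x)" "\<lambda>x. cnj (V s x - V t x)"])
        (intro ac_deriv_diff ac_deriv_cnj ac_U ac_W L2_diff_U L2_diff L2_cnj L2_V L2_W | simp)+
    also have "(LINT x|lebesgue. (U s x - U t x) * cnj (V s x)) + - (LINT x|lebesgue. V t x * cnj (U s x - U t x))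
        = (LINT x|lebesgue. of_real (s - t) * (quot t s x * cnj (V s x)))
          - (LINT x|lebesgue. of_real (s - t) * (V t x * cnj (quot t s x)))"
      unfolding quot[OF s(2)] by (simp add: mult.left_commute mult.assoc)
    also have "\<dots> = of_real (s - t) * ?\<Psi> s"
      unfolding integral_mult_right_zero by (simp add: algebra_simps)
    finally show ?case .
  qed
  show "(?\<Psi> \<longlongrightarrow> (LINT x|lebesgue. ut t x * cnj (V t x)) - (LINT x|lebesgue. V t x * cnj (ut t x))) (at t)"
    by (intro tendsto_intros L2_tendsto_integral quot_tendsto L2_tendsto_cnj V_tendsto L2_tendsto_const L2_V t)
qed

definition N :: "real \<Rightarrow> real \<Rightarrow> complex" where
  "N t x = U t x * cnj (U t x) * cnj (U t x)"

definition N' :: "real \<Rightarrow> real \<Rightarrow> complex" where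
  "N' t x = V t x * (cnj (U t x) * cnj (U t x)) + 2 * (U t x * cnj (U t x)) * cnj (V t x)"

definition quartic_energy :: "real \<Rightarrow> complex" where
  "quartic_energy t = (LINT x|lebesgue. (N t x - a ^ 3) * V t x)"

text \<open>The cubic term minus its value at \<open>u = a\<close> factors through
  \<open>U t - a\<close> and its conjugate with bounded coefficients.\<close>

lemma N_L2: "t \<in> I \<Longrightarrow> (\<lambda>x. N t x - a ^ 3) \<in> L2"
proof -
  have *: "N t x - a ^ 3 = (U t x - a) * (cnj (U t x) * cnj (U t x)) + cnj (U t x - a) * (a * (cnj (U t x) + a))" for x
    by (simp add: N_def algebra_simps power3_eq_cube)
  show "t \<in> I \<Longrightarrow> ?thesis"
    unfolding * by (intro L2_add L2_mult_Linf' L2_cnj L2_W Linf_intros)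
qed

lemma N'_L2: "t \<in> I \<Longrightarrow> N' t \<in> L2"
  unfolding N'_def[abs_def] by (intro L2_add L2_mult_Linf L2_mult_Linf' L2_cnj L2_V Linf_intros)

lemma ac_N:
  assumes "t \<in> I" shows "ac_deriv (\<lambda>x. N t x - a ^ 3) (N' t)"
proof (rule ac_deriv_cong_AE)
  show "ac_deriv (\<lambda>x. N t x - a ^ 3) (\<lambda>x. (V t x * cnj (U t x) + U t x * cnj (V t x)) * cnj (U t x)
      + U t x * cnj (U t x) * cnj (V t x) - 0)"
    unfolding N_def[abs_def] by (intro ac_deriv_diff ac_deriv_const ac_deriv_mult ac_deriv_cnj ac_U assms)
qed (simp add: N'_def algebra_simps)

lemma N_quot:
  assumes "s \<noteq> t"
  shows "N s x - N t x = of_real (s - t) * (quot t s x * (cnj (U s x) * cnj (U s x))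
    + U t x * (cnj (U s x) + cnj (U t x)) * cnj (quot t s x))"
proof -
  have "N s x - N t x = (U s x - U t x) * (cnj (U s x) * cnj (U s x))
      + U t x * (cnj (U s x) + cnj (U t x)) * cnj (U s x - U t x)"
    by (simp add: N_def algebra_simps)
  also have "\<dots> = of_real (s - t) * (quot t s x * (cnj (U s x) * cnj (U s x))
      + U t x * (cnj (U s x) + cnj (U t x)) * cnj (quot t s x))"
    unfolding quot[OF assms] by (simp add: algebra_simps)
  finally show ?thesis .
qed

text \<open>The increment of \<open>N\<close> is an expression in quotients of \<open>U\<close> and
  may stay paired with \<open>V s\<close>; the increment of \<open>V\<close> is integrated by parts
  onto the fixed function \<open>N' t\<close>.\<close>

lemma quartic_energy_deriv:
  assumes t: "t \<in> I"
  shows "((\<lambda>s. Im (quartic_energy s)) has_real_derivative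
    Im ((LINT x|lebesgue. (ut t x * (cnj (U t x) * cnj (U t x)) + U t x * (cnj (U t x) + cnj (U t x)) * cnj (ut t x)) * V t x)
      - (LINT x|lebesgue. N' t x * ut t x))) (at t)"
proof (rule difference_quotient_tendsto(2))
  let ?n = "\<lambda>s x. quot t s x * (cnj (U s x) * cnj (U s x)) + U t x * (cnj (U s x) + cnj (U t x)) * cnj (quot t s x)"
  let ?\<Psi> = "\<lambda>s. (LINT x|lebesgue. ?n s x * V s x) - (LINT x|lebesgue. N' t x * quot t s x)"
  show "\<forall>\<^sub>F s in at t. quartic_energy s - quartic_energy t = of_real (s - t) * ?\<Psi> s"
    using near[OF t]
  proof eventually_elim
    case (elim s)
    then have s: "s \<in> I" "s \<noteq> t"
      by auto
    have "quartic_energy s - quartic_energy t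
        = (LINT x|lebesgue. (N s x - a ^ 3) * V s x - (N t x - a ^ 3) * V t x)"
      unfolding quartic_energy_def using s t L2_V N_L2 by (simp add: L2_mult_integrable)
    also have "\<dots> = (LINT x|lebesgue. ((N s x - a ^ 3) - (N t x - a ^ 3)) * V s x + (N t x - a ^ 3) * (V s x - V t x))"
      by (simp add: algebra_simps)
    also have "\<dots> = (LINT x|lebesgue. ((N s x - a ^ 3) - (N t x - a ^ 3)) * V s x) + (LINT x|lebesgue. (N t x - a ^ 3) * (V s x - V t x))"
      using s t by (intro Bochner_Integration.integral_add L2_mult_integrable L2_diff L2_V N_L2)
    also have "(LINT x|lebesgue. (N t x - a ^ 3) * (V s x - V t x)) = - (LINT x|lebesgue. N' t x * (U s x - U t x))"
      using s t by (subst integral_by_parts_L2[of "\<lambda>x. N t x - a ^ 3" "N' t" "\<lambda>x. U s x - U t x" "\<lambda>x. V s x - V t x"])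
        (intro ac_deriv_diff ac_N ac_U N_L2 N'_L2 L2_diff_U L2_diff L2_V | simp)+
    also have "(LINT x|lebesgue. ((N s x - a ^ 3) - (N t x - a ^ 3)) * V s x) + - (LINT x|lebesgue. N' t x * (U s x - U t x))
        = (LINT x|lebesgue. of_real (s - t) * (?n s x * V s x))
          - (LINT x|lebesgue. of_real (s - t) * (N' t x * quot t s x))"
      using N_quot[OF s(2)] quot[OF s(2)] by (simp add: mult.left_commute mult.assoc)
    also have "\<dots> = of_real (s - t) * ?\<Psi> s"
      unfolding integral_mult_right_zero by (simp add: algebra_simps)
    finally show ?case .
  qed
  show "(?\<Psi> \<longlongrightarrow> (LINT x|lebesgue. (ut t x * (cnj (U t x) * cnj (U t x)) + U t x * (cnj (U t x) + cnj (U t x)) * cnj (ut t x)) * V t x)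
      - (LINT x|lebesgue. N' t x * ut t x)) (at t)"
    by (intro tendsto_intros L2_tendsto_integral L2_tendsto_add L2_tendsto_mult L2_tendsto_mult' quot_tendsto
        L2_tendsto_cnj V_tendsto L2_tendsto_const N'_L2 Linf_tendsto_add Linf_tendsto_mult Linf_tendsto_cnj U_tendsto
        Linf_tendsto_const[OF U_Linf] Linf_tendsto_const Linf_intros t)
qed

end

text \<open>The densities are differentiated as polynomials in independent variables; \<open>w\<close> and \<open>wb\<close> stand for
  the time derivative and its conjugate, eliminated through the equation.\<close>

lemma energy_density_identity:
  fixes u ub v vb z zb b i :: complex
  assumes "i * i = -1" "w = i * z - u\<^sup>2 * vb" "wb = - i * zb - ub\<^sup>2 * v"
    and "A = u * vb" "B = ub * v" "A' = v * vb + u * zb" "B' = vb * v + ub * z"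
    and "s = (u * ub - b) * (u * ub + b)" "r' = v * ub + u * vb"
    and "s' = r' * (u * ub + b) + (u * ub - b) * (r' + 0)"
    and "n = w * (ub * ub) + u * (ub + ub) * wb" "m = v * (ub * ub) + 2 * (u * ub) * vb"
  shows "1 / 2 * ((A' * A + A * A') + (B' * B + B * B')) - (A' * B + A * B')
     + i / 2 * (s' * (B - A) + s * (B' - A')) - 1 / 8 * (s' * s + s * s')
   = - (w * zb) - z * wb - i / 2 * (n * v - m * w)
     + 1 / 6 * ((w * ub + u * wb) * ((u * ub - b) * (3 * (u * ub + b))))"
proof -
  \<comment> \<open>The claim multiplied by 24, the common denominator: a polynomial identity with
    integer coefficients modulo the given equations.\<close>
  have "12 * ((A' * A + A * A') + (B' * B + B * B')) - 24 * (A' * B + A * B')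
     + 12 * i * (s' * (B - A) + s * (B' - A')) - 3 * (s' * s + s * s')
   = - 24 * (w * zb) - 24 * (z * wb) - 12 * i * (n * v - m * w)
     + 4 * ((w * ub + u * wb) * ((u * ub - b) * (3 * (u * ub + b))))"
    using assms by algebra
  moreover have "1 / 2 * X1 - X2 + i / 2 * X3 - 1 / 8 * X4 = - X5 - X6 - i / 2 * X7 + 1 / 6 * X8"
    if "12 * X1 - 24 * X2 + 12 * i * X3 - 3 * X4 = - 24 * X5 - 24 * X6 - 12 * i * X7 + 4 * X8"
    for X1 X2 X3 X4 X5 X6 X7 X8 :: complex
    using that by (simp add: field_simps) algebra
  ultimately show ?thesis
    by blast
qed

text \<open>Write \<open>T = ub * v - u * vb\<close>. The equation turns
  \<open>- i / 2 * (w * vb - v * wb)\<close> into half the x-derivative of \<open>v * vb\<close>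
  minus \<open>i / 2 * r' * T\<close>. The density term contributes \<open>- i / 2 * r * T'\<close>,
  which completes the derivative of \<open>r * T\<close>, and \<open>r * (r + b) * r' / 2\<close>,
  whose primitive is \<open>r\<^sup>2 * (r / 6 + b / 4)\<close>.\<close>

lemma momentum_density_identity:
  fixes u ub v vb z zb b i :: complex
  assumes "i * i = -1" "w = i * z - u\<^sup>2 * vb" "wb = - i * zb - ub\<^sup>2 * v"
    and "r = u * ub - b" "r' = v * ub + u * vb"
  shows "1 / 2 * (z * vb + v * zb) - i / 2 * (r' * (ub * v - u * vb) + r * ((vb * v + ub * z) - (v * vb + u * zb)))
      + (r' * (r * (1 / 6 * r + b / 4)) + r * (r' * (1 / 6 * r + b / 4) + r * (1 / 6 * r' + 0)))
   = - i / 2 * (w * vb - v * wb) - 1 / 4 * ((w * ub + u * wb) * (r + r))"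
proof -
  have "12 * (z * vb + v * zb) - 12 * i * (r' * (ub * v - u * vb) + r * ((vb * v + ub * z) - (v * vb + u * zb)))
      + (r' * (r * (4 * r + 6 * b)) + r * (r' * (4 * r + 6 * b) + r * (4 * r')))
    = - 12 * i * (w * vb - v * wb) - 6 * ((w * ub + u * wb) * (r + r))"
    using assms by algebra
  moreover have "1 / 2 * X1 - i / 2 * X2 + (r' * (r * (1 / 6 * r + b / 4)) + r * (r' * (1 / 6 * r + b / 4) + r * (1 / 6 * r' + 0)))
      = - i / 2 * X3 - 1 / 4 * X4"
    if "12 * X1 - 12 * i * X2 + (r' * (r * (4 * r + 6 * b)) + r * (r' * (4 * r + 6 * b) + r * (4 * r')))
      = - 12 * i * X3 - 6 * X4" for X1 X2 X3 X4 :: complex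
    using that by (simp add: field_simps) algebra
  ultimately show ?thesis
    by blast
qed

context dnls
begin

section \<open>Functionals of the density alone, and the mass flux\<close>

definition potential_energy :: "real \<Rightarrow> complex" where
  "potential_energy t = (LINT x|lebesgue. (\<rho> t x - a\<^sup>2)\<^sup>2 * (\<rho> t x + 2 * a\<^sup>2))"

text \<open>With b = a^2, the integrand is x^3 - 3 b^2 x + 2 b^3 at x = \<open>\<rho>\<close>; its
  derivative 3 (x^2 - b^2) has no linear term and is a multiple of the nonlinear part of the flux
  \<open>J\<close>.\<close>

lemma potential_energy_deriv:
  assumes t: "t \<in> I"
  shows "((\<lambda>s. Re (potential_energy s)) has_real_derivative
    Re (LINT x|lebesgue. \<rho>t t x * ((\<rho> t x - a\<^sup>2) * (3 * (\<rho> t x + a\<^sup>2))))) (at t)"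
proof -
  \<comment> \<open>The divided difference of the cubic between the two times, grouped so that each
    summand is a bounded function times \<open>\<rho> - a\<^sup>2\<close> at one of the
    times.\<close>
  let ?m = "\<lambda>s x. (\<rho> s x - a\<^sup>2) * (\<rho> s x + a\<^sup>2 + \<rho> t x) + (\<rho> t x - a\<^sup>2) * (\<rho> t x + a\<^sup>2 + a\<^sup>2)"
  have int: "integrable lebesgue (\<lambda>x. (\<rho> s x - a\<^sup>2)\<^sup>2 * (\<rho> s x + 2 * a\<^sup>2))" if "s \<in> I" for s
    unfolding power2_eq_square[of "\<rho> _ _ - _"] mult.assoc
    using that by (intro L2_mult_integrable L2_mult_Linf' r_L2 Linf_add \<rho>_Linf Linf_const)
  have diff: "(\<rho> s x - a\<^sup>2)\<^sup>2 * (\<rho> s x + 2 * a\<^sup>2) - (\<rho> t x - a\<^sup>2)\<^sup>2 * (\<rho> t x + 2 * a\<^sup>2)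
      = (\<rho> s x - \<rho> t x) * ?m s x" for s x
    by algebra
  have "L2_tendsto ?m (\<lambda>x. (\<rho> t x - a\<^sup>2) * (\<rho> t x + a\<^sup>2 + \<rho> t x) + (\<rho> t x - a\<^sup>2) * (\<rho> t x + a\<^sup>2 + a\<^sup>2)) (at t)"
    using t by (intro L2_tendsto_add L2_tendsto_mult' L2_tendsto_const L2_mult_Linf' r_tendsto r_L2
        Linf_tendsto_add Linf_tendsto_const Linf_add \<rho>_tendsto_Linf \<rho>_Linf Linf_const)
  moreover have "(\<rho> t x - a\<^sup>2) * (\<rho> t x + a\<^sup>2 + \<rho> t x) + (\<rho> t x - a\<^sup>2) * (\<rho> t x + a\<^sup>2 + a\<^sup>2)
      = (\<rho> t x - a\<^sup>2) * (3 * (\<rho> t x + a\<^sup>2))" for x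
    by algebra
  ultimately have m: "L2_tendsto ?m (\<lambda>x. (\<rho> t x - a\<^sup>2) * (3 * (\<rho> t x + a\<^sup>2))) (at t)"
    by (simp only:)
  show ?thesis
    using difference_quotient_tendsto(1)[OF density_functional[OF t int diff m]]
    by (simp add: potential_energy_def)
qed

definition quartic_density :: "real \<Rightarrow> complex" where
  "quartic_density t = (LINT x|lebesgue. (\<rho> t x - a\<^sup>2)\<^sup>2)"

lemma quartic_density_deriv:
  assumes t: "t \<in> I"
  shows "((\<lambda>s. Re (quartic_density s)) has_real_derivative
    Re (LINT x|lebesgue. \<rho>t t x * ((\<rho> t x - a\<^sup>2) + (\<rho> t x - a\<^sup>2)))) (at t)"
proof -
  have int: "integrable lebesgue (\<lambda>x. (\<rho> s x - a\<^sup>2)\<^sup>2)" if "s \<in> I" for s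
    unfolding power2_eq_square[of "\<rho> _ _ - _"] using that by (intro L2_mult_integrable r_L2)
  have diff: "(\<rho> s x - a\<^sup>2)\<^sup>2 - (\<rho> t x - a\<^sup>2)\<^sup>2
      = (\<rho> s x - \<rho> t x) * ((\<rho> s x - a\<^sup>2) + (\<rho> t x - a\<^sup>2))" for s x
    by algebra
  have m: "L2_tendsto (\<lambda>s x. (\<rho> s x - a\<^sup>2) + (\<rho> t x - a\<^sup>2)) (\<lambda>x. (\<rho> t x - a\<^sup>2) + (\<rho> t x - a\<^sup>2)) (at t)"
    using t by (intro L2_tendsto_add L2_tendsto_const r_tendsto r_L2)
  show ?thesis
    using difference_quotient_tendsto(1)[OF density_functional[OF t int diff m]]
    by (simp add: quartic_density_def)
qed

lemma density_deriv:
  assumes t: "t \<in> I" and \<eta>: "\<eta> \<in> L2"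
  shows "((\<lambda>s. Re (LINT x|lebesgue. (\<rho> s x - a\<^sup>2) * \<eta> x)) has_real_derivative
    Re (LINT x|lebesgue. \<rho>t t x * \<eta> x)) (at t)"
proof -
  have int: "integrable lebesgue (\<lambda>x. (\<rho> s x - a\<^sup>2) * \<eta> x)" if "s \<in> I" for s
    using that \<eta> by (intro L2_mult_integrable r_L2)
  have diff: "(\<rho> s x - a\<^sup>2) * \<eta> x - (\<rho> t x - a\<^sup>2) * \<eta> x = (\<rho> s x - \<rho> t x) * \<eta> x" for s x
    by algebra
  show ?thesis
    using difference_quotient_tendsto(1)[OF density_functional[OF t int diff L2_tendsto_const[OF \<eta>]]] .
qed

text \<open>The equation gives the continuity equation with flux
  \<open>\<i> * (cnj u * u_x - u * cnj u_x) - \<rho>\<^sup>2 / 2\<close>; adding the constant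
  \<open>a ^ 4 / 2\<close> does not affect its derivative and brings it into L2.\<close>

definition J :: "real \<Rightarrow> real \<Rightarrow> complex" where
  "J t x = \<i> * (cnj (U t x) * V t x - U t x * cnj (V t x)) - 1 / 2 * ((\<rho> t x - a\<^sup>2) * (\<rho> t x + a\<^sup>2))"

lemma eq_cnj:
  assumes "ut t x = \<i> * Z t x - (U t x)\<^sup>2 * cnj (V t x)"
  shows "cnj (ut t x) = - \<i> * cnj (Z t x) - (cnj (U t x))\<^sup>2 * V t x"
  unfolding assms by simp

lemma J_L2: "t \<in> I \<Longrightarrow> J t \<in> L2"
  unfolding J_def[abs_def]
  by (intro L2_diff L2_scale L2_mult_Linf L2_mult_Linf' Linf_add Linf_cnj U_Linf L2_cnj L2_V r_L2 \<rho>_Linf Linf_const)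

lemma J_tendsto: "t \<in> I \<Longrightarrow> L2_tendsto J (J t) (at t)"
  unfolding J_def[abs_def]
  by (intro L2_tendsto_diff L2_tendsto_scale L2_tendsto_mult L2_tendsto_mult' Linf_tendsto_add Linf_tendsto_cnj
      U_tendsto L2_tendsto_cnj V_tendsto r_tendsto \<rho>_tendsto_Linf Linf_tendsto_const Linf_const)

text \<open>The continuity equation tested against \<open>\<eta>\<close>. As \<open>\<eta>\<close>,
  \<open>\<eta>'\<close>, \<open>J t\<close> and \<open>\<rho>t t\<close> are all in L2, both the
  product of \<open>\<eta>\<close> with \<open>J t\<close> and its derivative are integrable, so
  nothing is left at infinity.\<close>

lemma mass_flux:
  assumes t: "t \<in> I" and ac: "ac_deriv \<eta> \<eta>'" and \<eta>: "\<eta> \<in> L2" "\<eta>' \<in> L2"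
  shows "(LINT x|lebesgue. \<rho>t t x * \<eta> x) = - (LINT x|lebesgue. \<eta>' x * J t x)"
proof -
  have i: "integrable lebesgue (\<lambda>x. \<rho>t t x * \<eta> x)" "integrable lebesgue (\<lambda>x. \<eta>' x * J t x)"
    by (intro L2_mult_integrable \<rho>t_L2 J_L2 t \<eta>)+
  have "(LINT x|lebesgue. \<rho>t t x * \<eta> x + \<eta>' x * J t x) = 0"
  proof (rule ac_deriv_integral_zero_AE[where F = "\<lambda>x. \<eta> x * J t x"])
    show "integrable lebesgue (\<lambda>x. \<eta> x * J t x)"
      using t \<eta> by (intro L2_mult_integrable J_L2)
    show "ac_deriv (\<lambda>x. \<eta> x * J t x) (\<lambda>x. \<eta>' x * J t x + \<eta> x *
      (\<i> * ((cnj (V t x) * V t x + cnj (U t x) * Z t x) - (V t x * cnj (V t x) + U t x * cnj (Z t x)))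
       - 1 / 2 * ((V t x * cnj (U t x) + U t x * cnj (V t x)) * (\<rho> t x + a\<^sup>2)
          + (\<rho> t x - a\<^sup>2) * (V t x * cnj (U t x) + U t x * cnj (V t x) + 0))))"
      unfolding J_def[abs_def]
      by (intro ac_deriv_mult ac_deriv_diff ac_deriv_scale ac_deriv_add ac_deriv_cnj ac_deriv_const ac ac_U ac_V ac_r ac_\<rho> t)
    show "AE x in lebesgue. \<eta>' x * J t x + \<eta> x *
      (\<i> * ((cnj (V t x) * V t x + cnj (U t x) * Z t x) - (V t x * cnj (V t x) + U t x * cnj (Z t x)))
       - 1 / 2 * ((V t x * cnj (U t x) + U t x * cnj (V t x)) * (\<rho> t x + a\<^sup>2)
          + (\<rho> t x - a\<^sup>2) * (V t x * cnj (U t x) + U t x * cnj (V t x) + 0))) = \<rho>t t x * \<eta> x + \<eta>' x * J t x"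
      using eq[OF t]
    proof eventually_elim
      case (elim x)
      show ?case
        unfolding \<rho>t_def eq_cnj[OF elim] unfolding elim \<rho>_def
        by (simp add: field_simps power2_eq_square)
    qed
  qed (use i in \<open>rule Bochner_Integration.integrable_add\<close>)
  then show ?thesis
    using i by (simp add: add_eq_0_iff2)
qed

lemma energy_identity:
  assumes t: "t \<in> I"
  shows "Re (- (LINT x|lebesgue. ut t x * cnj (Z t x)) - (LINT x|lebesgue. Z t x * cnj (ut t x)))
    + 1 / 2 * Im ((LINT x|lebesgue. (ut t x * (cnj (U t x) * cnj (U t x)) + U t x * (cnj (U t x) + cnj (U t x)) * cnj (ut t x)) * V t x)
      - (LINT x|lebesgue. N' t x * ut t x))
    + 1 / 6 * Re (LINT x|lebesgue. \<rho>t t x * ((\<rho> t x - a\<^sup>2) * (3 * (\<rho> t x + a\<^sup>2)))) = 0"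
proof -
  let ?u = "U t" and ?v = "V t" and ?z = "Z t"
  let ?n = "\<lambda>x. ut t x * (cnj (?u x) * cnj (?u x)) + ?u x * (cnj (?u x) + cnj (?u x)) * cnj (ut t x)"
  let ?c = "\<lambda>x. (\<rho> t x - a\<^sup>2) * (3 * (\<rho> t x + a\<^sup>2))"
  \<comment> \<open>The factor \<open>- \<i> / 2\<close> encodes the imaginary part, since
    \<open>Re (- \<i> * x) = Im x\<close>; the three contributions thus become one integrand, which
    is an exact x-derivative.\<close>
  let ?G = "\<lambda>x. - (ut t x * cnj (?z x)) - ?z x * cnj (ut t x) - \<i> / 2 * (?n x * ?v x - N' t x * ut t x)
      + 1 / 6 * (\<rho>t t x * ?c x)"
  let ?I1 = "LINT x|lebesgue. ut t x * cnj (?z x)" and ?I2 = "LINT x|lebesgue. ?z x * cnj (ut t x)"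
    and ?I3 = "LINT x|lebesgue. ?n x * ?v x" and ?I4 = "LINT x|lebesgue. N' t x * ut t x"
    and ?I5 = "LINT x|lebesgue. \<rho>t t x * ?c x"
  have hb: "has_bochner_integral lebesgue ?G (- ?I1 - ?I2 - \<i> / 2 * (?I3 - ?I4) + 1 / 6 * ?I5)"
    using t by (intro has_bochner_integral_add has_bochner_integral_diff has_bochner_integral_minus
        has_bochner_integral_mult_right has_bochner_integral_integrable L2_mult_integrable
        L2_add L2_mult_Linf L2_mult_Linf' L2_ut L2_cnj L2_Z L2_V N'_L2 \<rho>t_L2 r_L2 Linf_add Linf_mult
        Linf_cnj U_Linf \<rho>_Linf Linf_const)
  let ?A = "\<lambda>x. ?u x * cnj (?v x)"
  let ?T = "\<lambda>x. cnj (?u x) * ?v x - ?A x"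
  let ?s = "\<lambda>x. (\<rho> t x - a\<^sup>2) * (\<rho> t x + a\<^sup>2)"
  \<comment> \<open>This is \<open>- 1 / 2 * (J t x)\<^sup>2\<close> expanded:
    \<open>J t x = \<i> * ?T x - 1 / 2 * ?s x\<close> and \<open>?T x = cnj (?A x) - ?A x\<close>.
    Every summand is a product of two L2 functions.\<close>
  let ?F = "\<lambda>x. 1 / 2 * (?A x * ?A x + cnj (?A x) * cnj (?A x)) - ?A x * cnj (?A x) + \<i> / 2 * (?s x * ?T x) - 1 / 8 * (?s x * ?s x)"
  let ?A' = "\<lambda>x. ?v x * cnj (?v x) + ?u x * cnj (?z x)"
  let ?T' = "\<lambda>x. (cnj (?v x) * ?v x + cnj (?u x) * ?z x) - ?A' x"
  let ?r' = "\<lambda>x. ?v x * cnj (?u x) + ?u x * cnj (?v x)"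
  let ?s' = "\<lambda>x. ?r' x * (\<rho> t x + a\<^sup>2) + (\<rho> t x - a\<^sup>2) * (?r' x + 0)"
  have "(LINT x|lebesgue. ?G x) = 0"
  proof (rule ac_deriv_integral_zero_AE)
    show "ac_deriv ?F (\<lambda>x. 1 / 2 * ((?A' x * ?A x + ?A x * ?A' x) + (cnj (?A' x) * cnj (?A x) + cnj (?A x) * cnj (?A' x)))
        - (?A' x * cnj (?A x) + ?A x * cnj (?A' x)) + \<i> / 2 * (?s' x * ?T x + ?s x * ?T' x)
        - 1 / 8 * (?s' x * ?s x + ?s x * ?s' x))"
      by (intro ac_deriv_mult ac_deriv_diff ac_deriv_scale ac_deriv_add ac_deriv_cnj ac_deriv_const ac_U ac_V ac_r ac_\<rho> t)
    have A: "?A \<in> L2" and T: "?T \<in> L2" and s: "?s \<in> L2"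
      by (intro L2_diff L2_mult_Linf L2_mult_Linf' L2_cnj L2_V r_L2 Linf_add Linf_cnj U_Linf \<rho>_Linf Linf_const t)+
    show "integrable lebesgue ?F"
      by (intro Bochner_Integration.integrable_add Bochner_Integration.integrable_diff integrable_mult_right
          L2_mult_integrable L2_cnj A T s)
    show "integrable lebesgue ?G"
      using hb by (auto simp: has_bochner_integral_iff)
    show "AE x in lebesgue. 1 / 2 * ((?A' x * ?A x + ?A x * ?A' x) + (cnj (?A' x) * cnj (?A x) + cnj (?A x) * cnj (?A' x)))
        - (?A' x * cnj (?A x) + ?A x * cnj (?A' x)) + \<i> / 2 * (?s' x * ?T x + ?s x * ?T' x)
        - 1 / 8 * (?s' x * ?s x + ?s x * ?s' x) = ?G x"
      using eq[OF t]
    proof eventually_elim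
      case (elim x)
      show ?case
        using energy_density_identity[OF i_squared elim eq_cnj[OF elim] refl refl refl refl refl refl refl refl refl]
        unfolding \<rho>t_def N'_def \<rho>_def complex_cnj_add complex_cnj_mult complex_cnj_cnj by blast
    qed
  qed
  then have zero: "- ?I1 - ?I2 - \<i> / 2 * (?I3 - ?I4) + 1 / 6 * ?I5 = 0"
    using hb by (simp only: has_bochner_integral_iff)
  have Re_eq: "Re (- x1 - x2 - \<i> / 2 * (x3 - x4) + 1 / 6 * x5) = Re (- x1 - x2) + 1 / 2 * Im (x3 - x4) + 1 / 6 * Re x5"
    for x1 x2 x3 x4 x5
    by (simp add: Re_divide_numeral field_simps)
  show ?thesis
    using arg_cong[OF zero, of Re] unfolding Re_eq zero_complex.sel .
qed

lemma momentum_identity: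
  assumes t: "t \<in> I"
  shows "1 / 2 * Im ((LINT x|lebesgue. ut t x * cnj (V t x)) - (LINT x|lebesgue. V t x * cnj (ut t x)))
    - 1 / 4 * Re (LINT x|lebesgue. \<rho>t t x * ((\<rho> t x - a\<^sup>2) + (\<rho> t x - a\<^sup>2))) = 0"
proof -
  let ?u = "U t" and ?v = "V t" and ?z = "Z t"
  let ?r = "\<lambda>x. \<rho> t x - a\<^sup>2"
  let ?G = "\<lambda>x. - \<i> / 2 * (ut t x * cnj (?v x) - ?v x * cnj (ut t x)) - 1 / 4 * (\<rho>t t x * (?r x + ?r x))"
  let ?I1 = "LINT x|lebesgue. ut t x * cnj (?v x)" and ?I2 = "LINT x|lebesgue. ?v x * cnj (ut t x)"
    and ?I3 = "LINT x|lebesgue. \<rho>t t x * (?r x + ?r x)"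
  have hb: "has_bochner_integral lebesgue ?G (- \<i> / 2 * (?I1 - ?I2) - 1 / 4 * ?I3)"
    using t by (intro has_bochner_integral_add has_bochner_integral_diff
        has_bochner_integral_mult_right has_bochner_integral_integrable L2_mult_integrable
        L2_add L2_ut L2_cnj L2_V \<rho>t_L2 r_L2)
  let ?A = "\<lambda>x. ?u x * cnj (?v x)"
  let ?T = "\<lambda>x. cnj (?u x) * ?v x - ?A x"
  let ?F = "\<lambda>x. 1 / 2 * (?v x * cnj (?v x)) - \<i> / 2 * (?r x * ?T x) + ?r x * (?r x * (1 / 6 * ?r x + a\<^sup>2 / 4))"
  let ?A' = "\<lambda>x. ?v x * cnj (?v x) + ?u x * cnj (?z x)"
  let ?T' = "\<lambda>x. (cnj (?v x) * ?v x + cnj (?u x) * ?z x) - ?A' x"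
  let ?r' = "\<lambda>x. ?v x * cnj (?u x) + ?u x * cnj (?v x)"
  let ?F' = "\<lambda>x. 1 / 2 * (?z x * cnj (?v x) + ?v x * cnj (?z x)) - \<i> / 2 * (?r' x * ?T x + ?r x * ?T' x)
        + (?r' x * (?r x * (1 / 6 * ?r x + a\<^sup>2 / 4)) + ?r x * (?r' x * (1 / 6 * ?r x + a\<^sup>2 / 4) + ?r x * (1 / 6 * ?r' x + 0)))"
  have "(LINT x|lebesgue. ?G x) = 0"
  proof (rule ac_deriv_integral_zero_AE)
    show "ac_deriv ?F ?F'"
      by (intro ac_deriv_add ac_deriv_diff ac_deriv_scale ac_deriv_mult[of "\<lambda>x. \<rho> t x - a\<^sup>2"] ac_deriv_mult[of "U t"]
        ac_deriv_mult[of "\<lambda>x. cnj (U t x)"] ac_deriv_mult[of "V t"] ac_deriv_cnj ac_deriv_const ac_U ac_V ac_r t)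
    have T: "?T \<in> L2" and r: "?r \<in> L2"
      by (intro L2_diff L2_mult_Linf L2_mult_Linf' L2_cnj L2_V r_L2 Linf_cnj U_Linf t)+
    \<comment> \<open>In the cubic term of \<open>?F\<close> two factors \<open>?r\<close> are used
      as L2 functions and the remaining one as a bounded function.\<close>
    have r2: "?r \<in> Linf"
      using Linf_add[OF \<rho>_Linf[OF t] Linf_const[of "- a\<^sup>2"]] by simp
    show "integrable lebesgue ?F"
      using t by (intro Bochner_Integration.integrable_add Bochner_Integration.integrable_diff integrable_mult_right
          L2_mult_integrable[OF L2_V L2_cnj[OF L2_V]] L2_mult_integrable[OF r T]
          L2_mult_integrable[OF r L2_mult_Linf'[OF r]] Linf_add Linf_mult r2 Linf_const)
    show "integrable lebesgue ?G"
      using hb by (auto simp: has_bochner_integral_iff)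
    show "AE x in lebesgue. ?F' x = ?G x"
      using eq[OF t]
    proof eventually_elim
      case (elim x)
      show ?case
        using momentum_density_identity[OF i_squared elim eq_cnj[OF elim] refl refl]
        unfolding \<rho>t_def \<rho>_def by blast
    qed
  qed
  then have zero: "- \<i> / 2 * (?I1 - ?I2) - 1 / 4 * ?I3 = 0"
    using hb by (simp only: has_bochner_integral_iff)
  have Re_eq: "Re (- \<i> / 2 * (x1 - x2) - 1 / 4 * x3) = 1 / 2 * Im (x1 - x2) - 1 / 4 * Re x3"
    for x1 x2 x3
    by (simp add: Re_divide_numeral field_simps)
  show ?thesis
    using arg_cong[OF zero, of Re] unfolding Re_eq zero_complex.sel .
qed

section \<open>From the identities to conservation in time\<close>

lemma constant_of_deriv_zero:
  fixes f :: "real \<Rightarrow> real"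
  assumes "\<And>t. t \<in> I \<Longrightarrow> (f has_real_derivative 0) (at t)" "s \<in> I" "t \<in> I"
  shows "f s = f t"
proof -
  have "\<exists>c. \<forall>x\<in>I. f x = c"
    by (rule has_field_derivative_zero_constant[OF conv_I]) (rule has_field_derivative_at_within, rule assms(1))
  then show ?thesis
    using assms(2,3) by auto
qed

lemma energy_conserved:
  assumes "s \<in> I" "t \<in> I"
  shows "Re (gradient_energy s) + 1 / 2 * Im (quartic_energy s) + 1 / 6 * Re (potential_energy s)
    = Re (gradient_energy t) + 1 / 2 * Im (quartic_energy t) + 1 / 6 * Re (potential_energy t)"
proof (rule constant_of_deriv_zero[OF _ assms])
  fix t assume "t \<in> I"
  note t = this
  show "((\<lambda>s. Re (gradient_energy s) + 1 / 2 * Im (quartic_energy s) + 1 / 6 * Re (potential_energy s))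
      has_real_derivative 0) (at t)"
    unfolding energy_identity[OF t, symmetric]
    by (intro DERIV_add DERIV_cmult gradient_energy_deriv quartic_energy_deriv potential_energy_deriv t)
qed

lemma momentum_conserved:
  assumes "s \<in> I" "t \<in> I"
  shows "1 / 2 * Im (bilinear_momentum s) - 1 / 4 * Re (quartic_density s)
    = 1 / 2 * Im (bilinear_momentum t) - 1 / 4 * Re (quartic_density t)"
proof (rule constant_of_deriv_zero[OF _ assms])
  fix t assume "t \<in> I"
  note t = this
  show "((\<lambda>s. 1 / 2 * Im (bilinear_momentum s) - 1 / 4 * Re (quartic_density s)) has_real_derivative 0) (at t)"
    unfolding momentum_identity[OF t, symmetric]
    by (intro DERIV_diff DERIV_cmult bilinear_momentum_deriv quartic_density_deriv t)
qed

lemma flux_bounded: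
  assumes "s \<in> I" "t \<in> I"
  obtains K where "K \<ge> 0" "\<And>r. r \<in> closed_segment s t \<Longrightarrow> L2_norm (J r) \<le> K"
proof -
  have sub: "closed_segment s t \<subseteq> I"
    using conv_I assms by (meson convex_contains_segment)
  have "continuous_on (closed_segment s t) (\<lambda>r. L2_norm (J r))"
    unfolding continuous_on_def
  proof
    fix r assume "r \<in> closed_segment s t"
    then have "((\<lambda>r. L2_norm (J r)) \<longlongrightarrow> L2_norm (J r)) (at r)"
      using sub by (intro L2_tendsto_norm J_tendsto) auto
    then show "((\<lambda>r. L2_norm (J r)) \<longlongrightarrow> L2_norm (J r)) (at r within closed_segment s t)"
      using tendsto_within_subset by blast
  qed
  then have "bounded ((\<lambda>r. L2_norm (J r)) ` closed_segment s t)"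
    by (intro compact_imp_bounded compact_continuous_image) simp_all
  then obtain K where "\<And>r. r \<in> closed_segment s t \<Longrightarrow> \<bar>L2_norm (J r)\<bar> \<le> K" "K > 0"
    unfolding bounded_pos by auto
  then show ?thesis
    by (intro that[of K]) auto
qed

text \<open>Mean value inequality in time: the rate of change of the weighted mass is a pairing of
  \<open>\<eta>'\<close> with \<open>J\<close>, so only the derivative of the weight enters the
  bound.\<close>

lemma localized_mass_bound:
  assumes st: "s \<in> I" "t \<in> I" and K: "\<And>r. r \<in> closed_segment s t \<Longrightarrow> L2_norm (J r) \<le> K"
    and ac: "ac_deriv \<eta> \<eta>'" and \<eta>: "\<eta> \<in> L2" "\<eta>' \<in> L2"
  shows "\<bar>Re (LINT x|lebesgue. (\<rho> t x - a\<^sup>2) * \<eta> x) - Re (LINT x|lebesgue. (\<rho> s x - a\<^sup>2) * \<eta> x)\<bar>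
    \<le> L2_norm \<eta>' * K * \<bar>t - s\<bar>"
proof -
  have sub: "closed_segment s t \<subseteq> I"
    using conv_I st by (meson convex_contains_segment)
  have "norm (Re (LINT x|lebesgue. (\<rho> t x - a\<^sup>2) * \<eta> x) - Re (LINT x|lebesgue. (\<rho> s x - a\<^sup>2) * \<eta> x))
    \<le> L2_norm \<eta>' * K * norm (t - s)"
  proof (rule field_differentiable_bound[of "closed_segment s t" _ "\<lambda>r. Re (LINT x|lebesgue. \<rho>t r x * \<eta> x)"])
    show "((\<lambda>s. Re (LINT x|lebesgue. (\<rho> s x - a\<^sup>2) * \<eta> x)) has_field_derivative
        Re (LINT x|lebesgue. \<rho>t r x * \<eta> x)) (at r within closed_segment s t)"
      if "r \<in> closed_segment s t" for r
      using that sub by (intro has_field_derivative_at_within[OF density_deriv] \<eta>) auto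
    show "norm (Re (LINT x|lebesgue. \<rho>t r x * \<eta> x)) \<le> L2_norm \<eta>' * K" if "r \<in> closed_segment s t" for r
    proof -
      have "r \<in> I"
        using that sub by auto
      have "norm (Re (LINT x|lebesgue. \<rho>t r x * \<eta> x)) \<le> cmod (LINT x|lebesgue. \<rho>t r x * \<eta> x)"
        using abs_Re_le_cmod by simp
      also have "\<dots> = cmod (LINT x|lebesgue. \<eta>' x * J r x)"
        using mass_flux[OF \<open>r \<in> I\<close> ac \<eta>] by simp
      also have "\<dots> \<le> L2_norm \<eta>' * L2_norm (J r)"
        using \<eta> J_L2[OF \<open>r \<in> I\<close>] by (intro L2_integral_mult_bound)
      also have "\<dots> \<le> L2_norm \<eta>' * K"
        using K[OF that] by (intro mult_left_mono) auto
      finally show ?thesis .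
    qed
  qed (auto simp: closed_segment_eq_real_ivl)
  then show ?thesis
    by simp
qed

end

section \<open>Continuous representatives\<close>

text \<open>No measurability is needed: a function equal almost everywhere to a non-measurable one is
  not measurable either, and then both integrals have the junk value 0.\<close>

lemma lebesgue_integral_cong_AE:
  fixes f g :: "'a::euclidean_space \<Rightarrow> 'b::euclidean_space"
  assumes "AE x in lebesgue. f x = g x"
  shows "(LINT x|lebesgue. f x) = (LINT x|lebesgue. g x)"
proof (cases "f \<in> borel_measurable lebesgue")
  case True
  then show ?thesis
    using assms borel_measurable_AE[OF True assms] by (intro integral_cong_AE)
next
  case False
  have "g \<notin> borel_measurable lebesgue"
  proof
    assume "g \<in> borel_measurable lebesgue"
    then have "f \<in> borel_measurable lebesgue"
      by (rule borel_measurable_AE) (use assms in eventually_elim, simp)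
    with False show False ..
  qed
  with False show ?thesis
    by (metis borel_measurable_integrable not_integrable_integral_eq)
qed

lemma L2_norm_cong: "AE x in lebesgue. f x = g x \<Longrightarrow> L2_norm f = L2_norm g"
  unfolding L2_norm_def
  by (intro arg_cong[where f = sqrt] lebesgue_integral_cong_AE) (auto elim: eventually_mono)

text \<open>\<open>U\<close> and \<open>V\<close> are continuous, whereas \<open>Z\<close> is an
  arbitrary representative of its class.\<close>

definition H2_rep :: "(real \<Rightarrow> complex) \<Rightarrow> (real \<Rightarrow> complex) \<Rightarrow> (real \<Rightarrow> complex) \<Rightarrow> (real \<Rightarrow> complex) \<Rightarrow> bool" where
  "H2_rep f U V Z \<longleftrightarrow> ac_deriv U V \<and> ac_deriv V Z \<and> (AE x in lebesgue. f x = U x)"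

lemma H2_rep_weak_deriv:
  assumes "H2_rep f U V Z"
  shows "AE x in lebesgue. weak_deriv f x = V x"
    and "AE x in lebesgue. weak_deriv (weak_deriv f) x = Z x"
    and "AE x in lebesgue. weak_deriv (\<lambda>y. cnj (f y)) x = cnj (V x)"
proof -
  have UV: "ac_deriv U V" and VZ: "ac_deriv V Z" and f: "AE x in lebesgue. f x = U x"
    using assms by (auto simp: H2_rep_def)
  show V: "AE x in lebesgue. weak_deriv f x = V x"
    by (rule weak_deriv_ac[OF UV f])
  show "AE x in lebesgue. weak_deriv (weak_deriv f) x = Z x"
    by (rule weak_deriv_ac[OF VZ V])
  have "AE x in lebesgue. cnj (f x) = cnj (U x)"
    using f by eventually_elim simp
  then show "AE x in lebesgue. weak_deriv (\<lambda>y. cnj (f y)) x = cnj (V x)"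
    by (rule weak_deriv_ac[OF ac_deriv_cnj[OF UV]])
qed

lemma H2_rep_diff:
  assumes "H2_rep f U V Z" "H2_rep g U' V' Z'"
  shows "H2_rep (\<lambda>x. f x - g x) (\<lambda>x. U x - U' x) (\<lambda>x. V x - V' x) (\<lambda>x. Z x - Z' x)"
  using assms unfolding H2_rep_def by (auto intro: ac_deriv_diff)

lemma H2_rep_cong:
  assumes "H2_rep f U V Z" "AE x in lebesgue. f x = g x"
  shows "H2_rep g U V Z"
proof -
  have "AE x in lebesgue. f x = U x"
    using assms(1) by (simp add: H2_rep_def)
  with assms(2) have "AE x in lebesgue. g x = U x"
    by eventually_elim simp
  then show ?thesis
    using assms(1) by (simp add: H2_rep_def)
qed

text \<open>Carries convergence in \<open>H2_norm\<close>, which refers to chosen weak derivatives,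
  over to the representatives.\<close>

lemma L2_norm_le_H2_norm:
  assumes "H2_rep f U V Z"
  shows "L2_norm U \<le> H2_norm f" "L2_norm V \<le> H2_norm f" "L2_norm Z \<le> H2_norm f"
proof -
  have "L2_norm f = L2_norm U" "L2_norm (weak_deriv f) = L2_norm V"
    "L2_norm (weak_deriv (weak_deriv f)) = L2_norm Z"
    using assms H2_rep_weak_deriv[OF assms] by (auto simp: H2_rep_def intro: L2_norm_cong)
  then have "H2_norm f = sqrt ((L2_norm U)\<^sup>2 + (L2_norm V)\<^sup>2 + (L2_norm Z)\<^sup>2)"
    by (simp add: H2_norm_def)
  then show "L2_norm U \<le> H2_norm f" "L2_norm V \<le> H2_norm f" "L2_norm Z \<le> H2_norm f"
    by (auto intro!: real_le_rsqrt)
qed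

lemma shifted_H2_rep:
  assumes "v \<in> shifted_H2 q"
  obtains U V Z where "H2_rep v U V Z" "(\<lambda>x. U x - of_real q) \<in> L2" "V \<in> L2" "Z \<in> L2"
proof -
  define w where "w x = v x - of_real q" for x
  have w: "w \<in> L2" "weakly_differentiable w" "weak_deriv w \<in> L2"
      "weakly_differentiable (weak_deriv w)" "weak_deriv (weak_deriv w) \<in> L2"
    using assms by (auto simp: shifted_H2_def H2_def w_def[abs_def])
  obtain W where W: "ac_deriv W (weak_deriv w)" "AE x in lebesgue. w x = W x"
    using du_Bois_Reymond[OF has_weak_deriv_weak_deriv[OF w(2)]] by blast
  obtain V where V: "ac_deriv V (weak_deriv (weak_deriv w))" "AE x in lebesgue. weak_deriv w x = V x"
    using du_Bois_Reymond[OF has_weak_deriv_weak_deriv[OF w(4)]] by blast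
  \<comment> \<open>\<open>W\<close> came with the chosen function \<open>weak_deriv w\<close>;
    exchanging it for its continuous version \<open>V\<close> links the two first-order
    representations into a chain.\<close>
  have "ac_deriv (\<lambda>x. W x + of_real q) V"
    using ac_deriv_cong_AE[OF ac_deriv_add[OF W(1) ac_deriv_const] ] V(2) by simp
  moreover have "AE x in lebesgue. v x = W x + of_real q"
    using W(2) by eventually_elim (simp add: w_def algebra_simps)
  ultimately have "H2_rep v (\<lambda>x. W x + of_real q) V (weak_deriv (weak_deriv w))"
    using V(1) by (simp add: H2_rep_def)
  moreover have "W \<in> L2" "V \<in> L2"
    using L2_cong_AE[OF w(1) W(2)] L2_cong_AE[OF w(3) V(2)] by auto
  ultimately show ?thesis
    using w(5) by (intro that[of "\<lambda>x. W x + of_real q" V "weak_deriv (weak_deriv w)"]) simp_all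
qed

section \<open>The conserved quantities in terms of representatives\<close>

lemma integral_Re_of_real: "(LINT x|lebesgue. f x) = Re (LINT x|lebesgue. complex_of_real (f x))"
  by (simp add: integral_complex_of_real)

lemma energy_rep:
  assumes "H2_rep v U V Z"
  shows "energy q v = Re (LINT x|lebesgue. V x * cnj (V x))
    + 1 / 2 * Im (LINT x|lebesgue. (U x * cnj (U x) * cnj (U x) - of_real q ^ 3) * V x)
    + 1 / 6 * Re (LINT x|lebesgue. (U x * cnj (U x) - (of_real q)\<^sup>2)\<^sup>2 * (U x * cnj (U x) + 2 * (of_real q)\<^sup>2))"
proof -
  have v: "AE x in lebesgue. v x = U x" and v': "AE x in lebesgue. weak_deriv v x = V x"
    using assms H2_rep_weak_deriv[OF assms] by (auto simp: H2_rep_def)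
  have "(LINT x|lebesgue. complex_of_real ((cmod (weak_deriv v x))\<^sup>2)) = (LINT x|lebesgue. V x * cnj (V x))"
    by (rule lebesgue_integral_cong_AE, use v' in eventually_elim) (simp add: complex_norm_square[symmetric])
  moreover have "(LINT x|lebesgue. (of_real ((cmod (v x))\<^sup>2) * cnj (v x) - of_real (q ^ 3)) * weak_deriv v x)
      = (LINT x|lebesgue. (U x * cnj (U x) * cnj (U x) - of_real q ^ 3) * V x)"
    by (rule lebesgue_integral_cong_AE, use v v' in eventually_elim) (simp add: complex_norm_square[symmetric])
  moreover have "(LINT x|lebesgue. complex_of_real (((cmod (v x))\<^sup>2 - q\<^sup>2)\<^sup>2 * ((cmod (v x))\<^sup>2 + 2 * q\<^sup>2)))
      = (LINT x|lebesgue. (U x * cnj (U x) - (of_real q)\<^sup>2)\<^sup>2 * (U x * cnj (U x) + 2 * (of_real q)\<^sup>2))"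
    by (rule lebesgue_integral_cong_AE, use v in eventually_elim) (simp add: complex_norm_square[symmetric])
  ultimately show ?thesis
    unfolding energy_def integral_Re_of_real by (simp only:)
qed

lemma momentum_rep:
  assumes "H2_rep v U V Z"
  shows "momentum q v = 1 / 2 * Im (LINT x|lebesgue. (U x - of_real q) * cnj (V x))
    - 1 / 4 * Re (LINT x|lebesgue. (U x * cnj (U x) - (of_real q)\<^sup>2)\<^sup>2)"
proof -
  have v: "AE x in lebesgue. v x = U x"
    and v': "AE x in lebesgue. weak_deriv (\<lambda>y. cnj (v y)) x = cnj (V x)"
    using assms H2_rep_weak_deriv[OF assms] by (auto simp: H2_rep_def)
  have "(LINT x|lebesgue. (v x - of_real q) * weak_deriv (\<lambda>y. cnj (v y)) x)
      = (LINT x|lebesgue. (U x - of_real q) * cnj (V x))"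
    by (rule lebesgue_integral_cong_AE, use v v' in eventually_elim) (simp)
  moreover have "(LINT x|lebesgue. complex_of_real (((cmod (v x))\<^sup>2 - q\<^sup>2)\<^sup>2))
      = (LINT x|lebesgue. (U x * cnj (U x) - (of_real q)\<^sup>2)\<^sup>2)"
    by (rule lebesgue_integral_cong_AE, use v in eventually_elim) (simp add: complex_norm_square[symmetric])
  ultimately show ?thesis
    unfolding momentum_def integral_Re_of_real by (simp only:)
qed

lemma truncated_mass_rep:
  assumes "AE x in lebesgue. v x = U x"
  shows "truncated_mass chi q v R
    = Re (LINT x|lebesgue. (U x * cnj (U x) - (of_real q)\<^sup>2) * of_real (chi (x / R)))"
proof -
  have "(LINT x|lebesgue. complex_of_real (((cmod (v x))\<^sup>2 - q\<^sup>2) * chi (x / R)))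
      = (LINT x|lebesgue. (U x * cnj (U x) - (of_real q)\<^sup>2) * of_real (chi (x / R)))"
    by (rule lebesgue_integral_cong_AE, use assms in eventually_elim) (simp add: complex_norm_square[symmetric])
  then show ?thesis
    unfolding truncated_mass_def integral_Re_of_real by (simp only:)
qed

section \<open>Cutoff functions\<close>

lemma L2_indicator:
  assumes "c \<ge> 0"
  shows "(\<lambda>x. complex_of_real (indicator {-c..c} x)) \<in> L2"
    and "L2_norm (\<lambda>x. complex_of_real (indicator {-c..c} x)) = sqrt (2 * c)"
proof -
  have *: "(cmod (complex_of_real (indicator {-c..c} x)))\<^sup>2 = indicator {-c..c} x" for x :: real
    by (simp add: indicator_def)
  have "(\<lambda>x. complex_of_real (indicator {-c..c} x)) \<in> borel_measurable lebesgue"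
    by (intro measurable_compose[OF _ borel_measurable_of_real] borel_measurable_indicator) simp
  moreover have "integrable lebesgue (\<lambda>x. (cmod (complex_of_real (indicator {-c..c} x)))\<^sup>2)"
    unfolding * by (intro integrable_real_indicator) (simp_all add: emeasure_lborel_Icc_eq)
  ultimately show "(\<lambda>x. complex_of_real (indicator {-c..c} x)) \<in> L2"
    unfolding L2_def by blast
  show "L2_norm (\<lambda>x. complex_of_real (indicator {-c..c} x)) = sqrt (2 * c)"
    unfolding L2_norm_def * using assms by simp
qed

text \<open>The derivative of the rescaled cutoff is at most \<open>B / R\<close> in size and
  vanishes outside an interval of length \<open>4 * R\<close>, so its L2 norm is at most
  \<open>B / R * sqrt (4 * R)\<close>.\<close>

lemma cutoff_rescaled:
  assumes chi: "is_cutoff chi"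
  obtains B and d :: "real \<Rightarrow> real \<Rightarrow> complex" where "B \<ge> 0" "\<And>x. \<bar>chi x\<bar> \<le> B"
    and "\<And>R. R > 0 \<Longrightarrow> ac_deriv (\<lambda>x. of_real (chi (x / R))) (d R)"
    and "\<And>R. R > 0 \<Longrightarrow> (\<lambda>x. complex_of_real (chi (x / R))) \<in> L2"
    and "\<And>R. R > 0 \<Longrightarrow> d R \<in> L2"
    and "\<And>R. R > 0 \<Longrightarrow> L2_norm (d R) \<le> 2 * B / sqrt R"
proof -
  obtain D where D: "\<And>x. (chi has_vector_derivative D x) (at x)" and cont: "continuous_on UNIV D"
    using chi by (auto simp: is_cutoff_def C1_differentiable_on_def)
  have supp: "chi x = 0" if "\<bar>x\<bar> > 2" for x
    using chi closure_subset[of "{x. chi x \<noteq> 0}"] that by (force simp: is_cutoff_def)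
  have suppD: "D x = 0" if "\<bar>x\<bar> > 2" for x
  proof -
    have "(chi has_vector_derivative 0) (at x)"
    proof (rule has_vector_derivative_transform_within_open)
      show "open (- {-2..2::real})" "x \<in> - {-2..2}"
        using that by auto
      show "((\<lambda>_. 0) has_vector_derivative 0) (at x)"
        by simp
      show "0 = chi y" if "y \<in> - {-2..2}" for y
        using that supp[of y] by (auto simp: abs_if)
    qed
    then show ?thesis
      using D vector_derivative_unique_at by blast
  qed
  have contchi: "continuous_on UNIV chi"
    using D has_vector_derivative_continuous continuous_at_imp_continuous_on by blast
  have bdd: "\<exists>B. \<forall>x\<in>{-2..2}. \<bar>f x\<bar> \<le> B" if "continuous_on UNIV f" for f :: "real \<Rightarrow> real"
  proof -
    have "bounded (f ` {-2..2})"
      using that by (intro compact_imp_bounded compact_continuous_image) (auto intro: continuous_on_subset)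
    then show ?thesis
      by (auto simp: bounded_iff)
  qed
  obtain B1 B2 where B1: "\<And>x. x \<in> {-2..2} \<Longrightarrow> \<bar>chi x\<bar> \<le> B1" and B2: "\<And>x. x \<in> {-2..2} \<Longrightarrow> \<bar>D x\<bar> \<le> B2"
    using bdd[OF contchi] bdd[OF cont] by blast
  define B where "B = max B1 B2"
  have "B \<ge> 0"
    using B1[of 0] by (simp add: B_def)
  have boundchi: "\<bar>chi x\<bar> \<le> B * indicator {-2..2} x" for x
    using B1[of x] supp[of x] by (auto simp: B_def indicator_def abs_if)
  have boundD: "\<bar>D x\<bar> \<le> B * indicator {-2..2} x" for x
    using B2[of x] suppD[of x] by (auto simp: B_def indicator_def abs_if)
  have ind: "indicator {-2..2} (x / R) = (indicator {-(2 * R)..2 * R} x :: real)" if "R > 0" for x R :: real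
    using that by (auto simp: indicator_def field_simps)
  define d where "d R x = complex_of_real (D (x / R) * (1 / R))" for R x
  have ac: "ac_deriv (\<lambda>x. of_real (chi (x / R))) (d R)" if "R > 0" for R
    unfolding d_def[abs_def]
  proof (rule ac_deriv_C1)
    fix x
    have "(chi has_field_derivative D (x / R)) (at (x / R))"
      using D by (simp add: has_real_derivative_iff_has_vector_derivative)
    then have "((\<lambda>x. chi (x / R)) has_field_derivative D (x / R) * (1 / R)) (at x)"
      by (rule DERIV_chain2) (use that in \<open>auto intro!: derivative_eq_intros\<close>)
    then show "((\<lambda>x. complex_of_real (chi (x / R))) has_vector_derivative complex_of_real (D (x / R) * (1 / R))) (at x)"
      by (intro has_vector_derivative_of_real) (simp add: has_real_derivative_iff_has_vector_derivative)
    show "continuous_on UNIV (\<lambda>x. complex_of_real (D (x / R) * (1 / R)))"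
      by (intro continuous_intros continuous_on_compose2[OF cont]) (use that in auto)
  qed
  have chi_L2: "(\<lambda>x. complex_of_real (chi (x / R))) \<in> L2" if "R > 0" for R
  proof (rule L2_bound)
    show "(\<lambda>x. complex_of_real (indicator {-(2 * R)..2 * R} x)) \<in> L2"
      using L2_indicator(1)[of "2 * R"] that by simp
    show "(\<lambda>x. complex_of_real (chi (x / R))) \<in> borel_measurable lebesgue"
      by (rule ac_deriv_measurable_lebesgue[OF ac[OF that]])
    show "cmod (complex_of_real (chi (x / R))) \<le> B * cmod (complex_of_real (indicator {-(2 * R)..2 * R} x))" for x
      using boundchi[of "x / R"] ind[OF that, of x] by simp
  qed
  have d_meas: "d R \<in> borel_measurable lebesgue" if "R > 0" for R
  proof -
    have "continuous_on UNIV (d R)"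
      unfolding d_def by (intro continuous_intros continuous_on_compose2[OF cont]) (use that in auto)
    then show ?thesis
      by (intro measurable_completion) (simp add: borel_measurable_continuous_onI)
  qed
  have d_bound: "cmod (d R x) \<le> B / R * cmod (complex_of_real (indicator {-(2 * R)..2 * R} x))" if "R > 0" for R x
  proof -
    have "cmod (d R x) = \<bar>D (x / R)\<bar> / R"
      using that by (simp add: d_def norm_mult norm_divide)
    also have "\<dots> \<le> B * indicator {-2..2} (x / R) / R"
      using boundD that by (intro divide_right_mono) auto
    finally show ?thesis
      using ind[OF that, of x] by simp
  qed
  have "d R \<in> L2" if "R > 0" for R
    by (rule L2_bound[OF L2_indicator(1) d_meas[OF that] d_bound[OF that]]) (use that in simp)
  moreover have "L2_norm (d R) \<le> 2 * B / sqrt R" if "R > 0" for R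
  proof -
    have "L2_norm (d R) \<le> B / R * L2_norm (\<lambda>x. complex_of_real (indicator {-(2 * R)..2 * R} x))"
      by (rule L2_norm_mult_bound[OF L2_indicator(1) d_meas[OF that] d_bound[OF that]])
        (use that \<open>B \<ge> 0\<close> in simp_all)
    also have "\<dots> = B / R * sqrt (2\<^sup>2 * R)"
      using L2_indicator(2)[of "2 * R"] that by simp
    also have "\<dots> = 2 * B / sqrt R"
      using that by (simp add: real_sqrt_mult real_div_sqrt field_simps)
    finally show ?thesis .
  qed
  moreover have "\<bar>chi x\<bar> \<le> B" for x
    using order_trans[OF boundchi[of x] mult_left_mono[OF indicator_le_1 \<open>B \<ge> 0\<close>]] by simp
  ultimately show ?thesis
    using that[OF \<open>B \<ge> 0\<close> _ ac chi_L2] by blast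
qed

text \<open>Dominated convergence; at each point the integrand is eventually constant in
  \<open>R\<close> because the cutoff is 1 near the origin. This serves the initial datum, whose
  density is integrable by assumption.\<close>

lemma truncated_mass_tendsto:
  assumes chi: "is_cutoff chi" and int: "integrable lebesgue (\<lambda>x. (cmod (v x))\<^sup>2 - q\<^sup>2)"
  shows "(truncated_mass chi q v \<longlongrightarrow> (LINT x|lebesgue. (cmod (v x))\<^sup>2 - q\<^sup>2)) at_top"
proof -
  obtain B where "B \<ge> 0" and B: "\<And>x. \<bar>chi x\<bar> \<le> B"
    using cutoff_rescaled[OF chi] by metis
  have "continuous_on UNIV chi"
    using chi by (auto simp: is_cutoff_def intro: C1_differentiable_imp_continuous_on)
  then have meas: "(\<lambda>x. chi (x / R)) \<in> borel_measurable lebesgue" for R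
    by (intro measurable_completion)
      (auto intro!: borel_measurable_continuous_onI continuous_on_compose2[of UNIV chi] continuous_intros simp: divide_inverse)
  show ?thesis
    unfolding truncated_mass_def
  proof (rule integral_dominated_convergence_at_top[where w = "\<lambda>x. B * \<bar>(cmod (v x))\<^sup>2 - q\<^sup>2\<bar>"])
    show "(\<lambda>x. ((cmod (v x))\<^sup>2 - q\<^sup>2) * chi (x / R)) \<in> borel_measurable lebesgue" for R
      using int meas by (intro borel_measurable_times) auto
    show "AE x in lebesgue. ((\<lambda>R. ((cmod (v x))\<^sup>2 - q\<^sup>2) * chi (x / R)) \<longlongrightarrow> (cmod (v x))\<^sup>2 - q\<^sup>2) at_top"
    proof (intro AE_I2 tendsto_eventually)
      show "\<forall>\<^sub>F R in at_top. ((cmod (v x))\<^sup>2 - q\<^sup>2) * chi (x / R) = (cmod (v x))\<^sup>2 - q\<^sup>2" for x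
        using eventually_ge_at_top[of "max 1 \<bar>x\<bar>"]
      proof eventually_elim
        case (elim R)
        then have "x / R \<in> {-1..1}"
          by (auto simp: field_simps abs_le_iff)
        then show ?case
          using chi by (simp add: is_cutoff_def)
      qed
    qed
    show "\<forall>\<^sub>F R in at_top. AE x in lebesgue. norm (((cmod (v x))\<^sup>2 - q\<^sup>2) * chi (x / R)) \<le> B * \<bar>(cmod (v x))\<^sup>2 - q\<^sup>2\<bar>"
      using B by (auto intro!: always_eventually AE_I2 mult_left_mono simp: abs_mult mult.commute[of B])
  qed (use int in auto)
qed

section \<open>The Cauchy problem\<close>

text \<open>Representatives are chosen separately at each time. This loses nothing in time
  regularity, because the norms of increments depend only on the classes.\<close>

lemma solution_dnls:
  assumes sol: "is_solution q u0 Tmin Tmax u"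
  obtains U V Z ut where "dnls q (einterval (-Tmin) Tmax) U V Z ut"
    and "\<And>t. t \<in> einterval (-Tmin) Tmax \<Longrightarrow> H2_rep (u t) (U t) (V t) (Z t)"
proof -
  let ?I = "einterval (-Tmin) Tmax"
  have mem: "u t \<in> shifted_H2 q" and cont: "((\<lambda>s. H2_norm (\<lambda>x. u s x - u t x)) \<longlongrightarrow> 0) (at t)"
    if "t \<in> ?I" for t
    using sol that by (auto simp: is_solution_def)
  obtain ut where ut: "\<And>t. t \<in> ?I \<Longrightarrow> ut t \<in> L2"
    and quot: "\<And>t. t \<in> ?I \<Longrightarrow> ((\<lambda>s. L2_norm (\<lambda>x. (u s x - u t x) / of_real (s - t) - ut t x)) \<longlongrightarrow> 0) (at t)"
    and eq: "\<And>t. t \<in> ?I \<Longrightarrow> AE x in lebesgue. \<i> * ut t x + weak_deriv (weak_deriv (u t)) x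
        = - \<i> * (u t x)\<^sup>2 * weak_deriv (\<lambda>y. cnj (u t y)) x"
    using sol unfolding is_solution_def by blast
  have "\<exists>U V Z. H2_rep (u t) U V Z \<and> (\<lambda>x. U x - of_real q) \<in> L2 \<and> V \<in> L2 \<and> Z \<in> L2" if "t \<in> ?I" for t
    using shifted_H2_rep[OF mem[OF that]] by blast
  then obtain U V Z where rep: "\<And>t. t \<in> ?I \<Longrightarrow> H2_rep (u t) (U t) (V t) (Z t)"
    and L2: "\<And>t. t \<in> ?I \<Longrightarrow> (\<lambda>x. U t x - of_real q) \<in> L2" "\<And>t. t \<in> ?I \<Longrightarrow> V t \<in> L2" "\<And>t. t \<in> ?I \<Longrightarrow> Z t \<in> L2"
    by metis
  have near: "\<forall>\<^sub>F s in at t. s \<in> ?I" if "t \<in> ?I" for t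
    using that by (intro eventually_at_in_open') simp_all
  have rep_diff: "H2_rep (\<lambda>x. u s x - u t x) (\<lambda>x. U s x - U t x) (\<lambda>x. V s x - V t x) (\<lambda>x. Z s x - Z t x)"
    if "s \<in> ?I" "t \<in> ?I" for s t
    using H2_rep_diff[OF rep rep] that by blast
  have lim: "((\<lambda>s. L2_norm (\<lambda>x. F s x - F t x)) \<longlongrightarrow> 0) (at t)"
    if "t \<in> ?I" "\<And>s. s \<in> ?I \<Longrightarrow> L2_norm (\<lambda>x. F s x - F t x) \<le> H2_norm (\<lambda>x. u s x - u t x)" for t F
  proof (rule tendsto_sandwich[OF _ _ tendsto_const cont[OF that(1)]])
    show "\<forall>\<^sub>F s in at t. L2_norm (\<lambda>x. F s x - F t x) \<le> H2_norm (\<lambda>x. u s x - u t x)"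
      using near[OF that(1)] by eventually_elim (rule that(2))
  qed simp
  have "dnls q ?I U V Z ut"
  proof
    show "open ?I"
      by simp
    show "convex ?I"
      by (rule is_interval_convex) (auto simp: is_interval_1 einterval_iff,
        (meson ereal_less_eq(3) less_le_trans le_less_trans)+)
    fix t assume t: "t \<in> ?I"
    show "ac_deriv (U t) (V t)" "ac_deriv (V t) (Z t)"
      using rep[OF t] by (auto simp: H2_rep_def)
    show "(\<lambda>x. U t x - of_real q) \<in> L2" "V t \<in> L2" "Z t \<in> L2" "ut t \<in> L2"
      using L2 ut t by auto
    show "((\<lambda>s. L2_norm (\<lambda>x. U s x - U t x)) \<longlongrightarrow> 0) (at t)"
      using L2_norm_le_H2_norm(1)[OF rep_diff[OF _ t]] by (rule lim[OF t])
    show "((\<lambda>s. L2_norm (\<lambda>x. V s x - V t x)) \<longlongrightarrow> 0) (at t)"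
      using L2_norm_le_H2_norm(2)[OF rep_diff[OF _ t]] by (rule lim[OF t])
    show "((\<lambda>s. L2_norm (\<lambda>x. Z s x - Z t x)) \<longlongrightarrow> 0) (at t)"
      using L2_norm_le_H2_norm(3)[OF rep_diff[OF _ t]] by (rule lim[OF t])
    show "((\<lambda>s. L2_norm (\<lambda>x. (U s x - U t x) / of_real (s - t) - ut t x)) \<longlongrightarrow> 0) (at t)"
    proof (rule Lim_transform_eventually[OF quot[OF t]])
      show "\<forall>\<^sub>F s in at t. L2_norm (\<lambda>x. (u s x - u t x) / of_real (s - t) - ut t x)
          = L2_norm (\<lambda>x. (U s x - U t x) / of_real (s - t) - ut t x)"
        using near[OF t]
      proof eventually_elim
        case (elim s)
        have "AE x in lebesgue. u s x - u t x = U s x - U t x"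
          using rep_diff[OF elim t] by (simp add: H2_rep_def)
        then show ?case
          by (intro L2_norm_cong) (auto elim: eventually_mono)
      qed
    qed
    have "AE x in lebesgue. u t x = U t x"
      using rep[OF t] by (simp add: H2_rep_def)
    then show "AE x in lebesgue. ut t x = \<i> * Z t x - (U t x)\<^sup>2 * cnj (V t x)"
      using eq[OF t] H2_rep_weak_deriv(2,3)[OF rep[OF t]]
    proof eventually_elim
      case (elim x)
      \<comment> \<open>Writing \<open>- Z\<close> as \<open>\<i> * (\<i> * Z)\<close> exposes a
        common factor \<open>\<i>\<close>, which is then cancelled.\<close>
      then have "\<i> * ut t x = - \<i> * (U t x)\<^sup>2 * cnj (V t x) - Z t x"
        by (simp add: eq_diff_eq)
      also have "\<dots> = \<i> * (\<i> * Z t x - (U t x)\<^sup>2 * cnj (V t x))"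
        by (simp add: algebra_simps)
      finally show ?case
        by simp
    qed
  qed
  then show ?thesis
    using rep that by blast
qed

theorem theorem1p4:
  fixes q0 :: real and u0 :: "real \<Rightarrow> complex" and u :: "real \<Rightarrow> real \<Rightarrow> complex"
    and Tmin Tmax :: ereal and chi :: "real \<Rightarrow> real"
  assumes "is_cutoff chi"
    and "u0 \<in> shifted_H2 q0"
    and "integrable lebesgue (\<lambda>x. (cmod (u0 x))\<^sup>2 - q0\<^sup>2)"
    and "is_maximal_solution q0 u0 Tmin Tmax u"
  shows "\<forall>t\<in>einterval (-Tmin) Tmax.
           (truncated_mass chi q0 (u t) \<longlongrightarrow> mass chi q0 (u t)) at_top \<and>
           mass chi q0 (u t) = mass chi q0 u0 \<and>
           energy q0 (u t) = energy q0 u0 \<and>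
           momentum q0 (u t) = momentum q0 u0"
proof
  let ?I = "einterval (-Tmin) Tmax"
  fix t assume t: "t \<in> ?I"
  have sol: "is_solution q0 u0 Tmin Tmax u"
    using assms(4) by (simp add: is_maximal_solution_def)
  then have "0 < Tmin" "0 < Tmax" and u0: "AE x in lebesgue. u 0 x = u0 x"
    by (auto simp: is_solution_def)
  then have 0: "0 \<in> ?I"
    by (simp add: einterval_iff zero_ereal_def[symmetric] ereal_uminus_less_reorder)
  obtain U V Z ut where dnls: "dnls q0 ?I U V Z ut"
    and rep: "\<And>t. t \<in> ?I \<Longrightarrow> H2_rep (u t) (U t) (V t) (Z t)"
    using solution_dnls[OF sol] by blast
  interpret dnls q0 ?I U V Z ut
    by (rule dnls)
  have rep0: "H2_rep u0 (U 0) (V 0) (Z 0)"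
    using rep[OF 0] u0 by (rule H2_rep_cong)
  have energy: "energy q0 (u t) = energy q0 u0"
    using energy_conserved[OF t 0] unfolding energy_rep[OF rep[OF t]] energy_rep[OF rep0]
    by (simp add: gradient_energy_def quartic_energy_def potential_energy_def N_def \<rho>_def)
  have momentum: "momentum q0 (u t) = momentum q0 u0"
    using momentum_conserved[OF t 0] unfolding momentum_rep[OF rep[OF t]] momentum_rep[OF rep0]
    by (simp add: bilinear_momentum_def quartic_density_def \<rho>_def)
  let ?M = "LINT x|lebesgue. (cmod (u0 x))\<^sup>2 - q0\<^sup>2"
  have lim0: "(truncated_mass chi q0 u0 \<longlongrightarrow> ?M) at_top"
    by (rule truncated_mass_tendsto[OF assms(1,3)])
  have lim: "(truncated_mass chi q0 (u t) \<longlongrightarrow> ?M) at_top"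
  proof -
    obtain B and d :: "real \<Rightarrow> real \<Rightarrow> complex" where "B \<ge> 0"
      and ac: "\<And>R. R > 0 \<Longrightarrow> ac_deriv (\<lambda>x. of_real (chi (x / R))) (d R)"
      and chi_L2: "\<And>R. R > 0 \<Longrightarrow> (\<lambda>x. complex_of_real (chi (x / R))) \<in> L2"
      and d_L2: "\<And>R. R > 0 \<Longrightarrow> d R \<in> L2"
      and d_norm: "\<And>R. R > 0 \<Longrightarrow> L2_norm (d R) \<le> 2 * B / sqrt R"
      using cutoff_rescaled[OF assms(1)] by metis
    obtain K where "K \<ge> 0" and K: "\<And>r. r \<in> closed_segment 0 t \<Longrightarrow> L2_norm (J r) \<le> K"
      using flux_bounded[OF 0 t] by blast
    let ?e = "\<lambda>R. 2 * B / sqrt R * K * \<bar>t\<bar>"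
    have bound: "\<forall>\<^sub>F R in at_top. norm (truncated_mass chi q0 (u t) R - truncated_mass chi q0 u0 R) \<le> ?e R"
      using eventually_gt_at_top[of 0]
    proof eventually_elim
      case (elim R)
      have "AE x in lebesgue. u t x = U t x" "AE x in lebesgue. u0 x = U 0 x"
        using rep[OF t] rep0 by (auto simp: H2_rep_def)
      then have "norm (truncated_mass chi q0 (u t) R - truncated_mass chi q0 u0 R) \<le> L2_norm (d R) * K * \<bar>t - 0\<bar>"
        using localized_mass_bound[OF 0 t K ac[OF elim] chi_L2[OF elim] d_L2[OF elim]]
        by (simp add: truncated_mass_rep \<rho>_def)
      also have "\<dots> \<le> ?e R"
        using d_norm[OF elim] \<open>K \<ge> 0\<close> unfolding diff_zero by (intro mult_right_mono) auto
      finally show ?case .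
    qed
    have "((\<lambda>R. 1 / sqrt R) \<longlongrightarrow> 0) at_top"
      by (intro tendsto_divide_0[OF tendsto_const] filterlim_at_top_imp_at_infinity sqrt_at_top)
    then have "((\<lambda>R. 2 * B * K * \<bar>t\<bar> * (1 / sqrt R)) \<longlongrightarrow> 0) at_top"
      by (rule tendsto_mult_right_zero)
    then have "(?e \<longlongrightarrow> 0) at_top"
      by (simp add: mult_ac)
    then have "((\<lambda>R. truncated_mass chi q0 (u t) R - truncated_mass chi q0 u0 R) \<longlongrightarrow> 0) at_top"
      by (rule Lim_null_comparison[OF bound])
    from tendsto_add[OF this lim0] show ?thesis
      by simp
  qed
  have mass: "mass chi q0 (u t) = ?M" "mass chi q0 u0 = ?M"
    unfolding mass_def by (rule tendsto_Lim[OF _ lim] tendsto_Lim[OF _ lim0]; simp)+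
  show "(truncated_mass chi q0 (u t) \<longlongrightarrow> mass chi q0 (u t)) at_top \<and>
      mass chi q0 (u t) = mass chi q0 u0 \<and> energy q0 (u t) = energy q0 u0 \<and> momentum q0 (u t) = momentum q0 u0"
    using lim mass energy momentum by simp
qed

end
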